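(* Let $n\ge 1$ and $\omega>0$. For $i,j=1,\dots,n$ let $d_i,a_{ij},I_i,\tau_{ij}:\mathbf{R}^+\to\mathbf{R}$ be continuous $\omega$-periodic functions with $d_i(t)>0$ and $\tau_{ij}(t)>0$, and for each fixed $t\ge 0$ let $d_sK_{ij}(t,s)$ be a Lebesgue–Stieltjes measure in $s\in[0,\infty)$ satisfying $d_sK_{ij}(t+\omega,s)=d_sK_{ij}(t,s)$. Let $g_j,f_j:\mathbf{R}\to\mathbf{R}$ and consider the system $$\frac{du_i}{dt}=-d_i(t)u_i(t)+\sum_{j=1}^n a_{ij}(t)g_j(u_j(t))+\sum_{j=1}^n\int_0^\infty f_j\big(u_j(t-\tau_{ij}(t)-s)\big)\,d_sK_{ij}(t,s)+I_i(t),\quad i=1,\dots,n,\qquad ( * )$$ with initial conditions $u_i(s)=\phi_i(s)$ for $s\in(-\infty,0]$, where $\phi_i\in C(-\infty,0]$. Assume that for every such initial condition $( * )$ has a unique solution, depending continuously on the initial data. Suppose there are constants $G_j>0$, $F_j>0$, $C_j$, $D_j$ ($j=1,\dots,n$) with $|g_j(s)|\le G_j|s|+C_j$ and $|f_j(s)|\le F_j|s|+D_j$ for all $s\in\mathbf{R}$. If there exist positive constants $\xi_1,\dots,\xi_n$ and $\eta>0$ such that for all $t>0$ $$-\xi_i d_i(t)+\sum_{j=1}^n\xi_jG_j|a_{ij}(t)|+\sum_{j=1}^n\xi_jF_j\int_0^\infty|d_sK_{ij}(t,s)|<-\eta<0\quad(i=1,\dots,n),$$ then $( * )$ has at least one $\omega$-periodic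 solution $x(t)$. If, in addition, $|g_i(y+h)-g_i(y)|\le G_i|h|$ and $|f_i(y+h)-f_i(y)|\le F_i|h|$ for all $y,h\in\mathbf{R}$ and $i=1,\dots,n$, and there exists a constant $\alpha$ such that for all $t>0$ $$-\xi_i(d_i(t)-\alpha)+\sum_{j=1}^n\xi_jG_j|a_{ij}(t)|+\sum_{j=1}^n\xi_jF_je^{\alpha\tau_{ij}(t)}\int_0^\infty e^{\alpha s}|d_sK_{ij}(t,s)|\le 0\quad(i=1,\dots,n),$$ then for every solution $u(t)=[u_1(t),\dots,u_n(t)]$ of $( * )$ one has $\|u(t)-x(t)\|=O(e^{-\alpha t})$ as $t\to\infty$.
   Context: $|d_sK_{ij}(t,s)|$ denotes the total variation measure of $d_sK_{ij}(t,\cdot)$. $\|\cdot\|$ denotes a norm on $\mathbf{R}^n$. *)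

theory Defs
  imports "HOL-Analysis.Analysis" "HOL-Library.Landau_Symbols"
begin

text \<open>A (signed) Lebesgue--Stieltjes measure on [0,\<infinity>) is represented by its Jordan
decomposition: two positive Borel measures Kp, Km on the reals, both locally finite,
concentrated on [0,\<infinity>) and mutually singular.  The signed measure is Kp - Km and its
total variation measure is Kp + Km.\<close>

definition LS_signed :: "real measure \<Rightarrow> real measure \<Rightarrow> bool" where
  "LS_signed Kp Km \<longleftrightarrow>
     sets Kp = sets borel \<and> sets Km = sets borel \<and>
     emeasure Kp {..<0} = 0 \<and> emeasure Km {..<0} = 0 \<and>
     (\<forall>r. emeasure Kp {0..r} < \<infinity> \<and> emeasure Km {0..r} < \<infinity>) \<and>
     (\<exists>A\<in>sets borel. emeasure Kp (- A) = 0 \<and> emeasure Km A = 0)"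

definition tv_int :: "real measure \<Rightarrow> real measure \<Rightarrow> (real \<Rightarrow> real) \<Rightarrow> ennreal" where
  "tv_int Kp Km h = (\<integral>\<^sup>+ s. ennreal (h s) \<partial>Kp) + (\<integral>\<^sup>+ s. ennreal (h s) \<partial>Km)"

definition dde_rhs ::
  "('n::finite \<Rightarrow> real \<Rightarrow> real) \<Rightarrow> ('n \<Rightarrow> 'n \<Rightarrow> real \<Rightarrow> real) \<Rightarrow> ('n \<Rightarrow> real \<Rightarrow> real) \<Rightarrow>
   ('n \<Rightarrow> 'n \<Rightarrow> real \<Rightarrow> real) \<Rightarrow> ('n \<Rightarrow> 'n \<Rightarrow> real \<Rightarrow> real measure) \<Rightarrow> ('n \<Rightarrow> 'n \<Rightarrow> real \<Rightarrow> real measure) \<Rightarrow>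
   ('n \<Rightarrow> real \<Rightarrow> real) \<Rightarrow> ('n \<Rightarrow> real \<Rightarrow> real) \<Rightarrow> (real \<Rightarrow> real ^ 'n) \<Rightarrow> real \<Rightarrow> real ^ 'n" where
  "dde_rhs d a I tau Kp Km g f u t =
     (\<chi> i. - d i t * (u t $ i)
           + (\<Sum>j\<in>UNIV. a i j t * g j (u t $ j))
           + (\<Sum>j\<in>UNIV. (\<integral>s. f j (u (t - tau i j t - s) $ j) \<partial>(Kp i j t))
                       - (\<integral>s. f j (u (t - tau i j t - s) $ j) \<partial>(Km i j t)))
           + I i t)"

text \<open>u is a solution of (*) (with initial function its restriction to (-\<infinity>,0]):
u is continuous on the whole line, the Stieltjes integrals exist, and (*) holds for t \<ge> 0
(one-sided derivative at t = 0).\<close>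
definition is_solution ::
  "('n::finite \<Rightarrow> real \<Rightarrow> real) \<Rightarrow> ('n \<Rightarrow> 'n \<Rightarrow> real \<Rightarrow> real) \<Rightarrow> ('n \<Rightarrow> real \<Rightarrow> real) \<Rightarrow>
   ('n \<Rightarrow> 'n \<Rightarrow> real \<Rightarrow> real) \<Rightarrow> ('n \<Rightarrow> 'n \<Rightarrow> real \<Rightarrow> real measure) \<Rightarrow> ('n \<Rightarrow> 'n \<Rightarrow> real \<Rightarrow> real measure) \<Rightarrow>
   ('n \<Rightarrow> real \<Rightarrow> real) \<Rightarrow> ('n \<Rightarrow> real \<Rightarrow> real) \<Rightarrow> (real \<Rightarrow> real ^ 'n) \<Rightarrow> bool" where
  "is_solution d a I tau Kp Km g f u \<longleftrightarrow>
     continuous_on UNIV u \<and>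
     (\<forall>t\<ge>0. \<forall>i j. integrable (Kp i j t) (\<lambda>s. f j (u (t - tau i j t - s) $ j)) \<and>
                   integrable (Km i j t) (\<lambda>s. f j (u (t - tau i j t - s) $ j))) \<and>
     (\<forall>t\<ge>0. (u has_vector_derivative dde_rhs d a I tau Kp Km g f u t) (at t within {0..}))"

end

theory Submission
  imports Defs "HOL-Complex_Analysis.Great_Picard"
begin

text \<open>A solution cannot leave a large box \<open>|u i| \<le> \<xi> i * M\<close>, since at a first crossing the row condition
  makes it point inwards. For each N, Brouwer's theorem applied to the values at N equidistant times in
  a period yields a periodic initial function which the solution reproduces over one period up to
  O(1/N); Arzela-Ascoli and continuous dependence give a periodic solution in the limit.

  For the convergence, the difference of two solutions is compared with \<open>\<xi> i * Q * exp (- \<alpha> * t)\<close>, again by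
  a first-crossing argument, once the contribution of the (possibly unbounded) initial functions is
  under control. This is trivial for bounded f j. For unbounded f j, solvability for arbitrary initial
  functions forces the supports of the kernels to be bounded uniformly in time: otherwise a gliding hump
  produces an initial function for which the history integral is not the derivative of any function,
  because a derivative is bounded on some portion of every closed set and its primitives are bounded on
  compact intervals.\<close>

section \<open>Crossings, fixed points in boxes, and derivatives\<close>

text \<open>No continuity or measurability in t is assumed of the kernels. What is known about their
  dependence on t comes from solvability: history integrals along solutions are derivatives, up to
  continuous terms. Derivatives are gauge integrable and obey Baire-type theorems, but need be
  neither locally bounded nor Lebesgue integrable; this dictates the tools used for the supports.
  The delay is infinite, and continuous dependence is granted only for initial functions that are
  uniformly close on all of (-\<infinity>, 0]. Periodic histories reconcile this with compactness,
  since closeness on one period is closeness on the whole past. Finitely many nodal values suffice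
  as unknowns because the interpolated history depends on them continuously in the sup norm. For the
  decay, the exponential envelope must dominate the past from the start, although two histories may
  differ by an unbounded amount. Negative rates cost nothing: the row condition is stronger than the
  exponential condition at rate 0, so differences stay bounded anyway.\<close>

lemma first_crossing:
  fixes v :: "real \<Rightarrow> real^'n" and \<rho> :: "'n::finite \<Rightarrow> real \<Rightarrow> real"
  assumes v: "continuous_on {0..T} v" and \<rho>: "\<And>i. continuous_on {0..T} (\<rho> i)"
    and init: "\<And>i. \<bar>v 0 $ i\<bar> < \<rho> i 0"
    and cross: "\<And>t i. 0 < t \<Longrightarrow> t \<le> T \<Longrightarrow> (\<And>s j. 0 \<le> s \<Longrightarrow> s \<le> t \<Longrightarrow> \<bar>v s $ j\<bar> \<le> \<rho> j s) \<Longrightarrow> \<bar>v t $ i\<bar> = \<rho> i t \<Longrightarrow>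
       \<exists>D E. ((\<lambda>s. v s $ i) has_real_derivative D) (at t within {0..t}) \<and>
             (\<rho> i has_real_derivative E) (at t within {0..t}) \<and> sgn (v t $ i) * D < E"
    and t: "0 \<le> t" "t \<le> T"
  shows "\<bar>v t $ i\<bar> < \<rho> i t"
proof (rule ccontr)
  assume neg: "\<not> ?thesis"
  define S where "S = (\<Union>i. {t \<in> {0..T}. \<rho> i t \<le> \<bar>v t $ i\<bar>})"
  have cv: "continuous_on {0..T} (\<lambda>t. v t $ i)" for i
    by (intro continuous_intros v)
  have "closed S" unfolding S_def
    by (intro closed_UN finite_UNIV ballI continuous_on_closed_Collect_le continuous_intros \<rho> cv) auto
  have "t \<in> S" using neg t by (auto simp: S_def not_less)
  have bdd: "bdd_below S" by (rule bdd_belowI[of _ 0]) (auto simp: S_def)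
  define t0 where "t0 = Inf S"
  have t0S: "t0 \<in> S" unfolding t0_def
    using closed_contains_Inf[OF _ bdd \<open>closed S\<close>] \<open>t \<in> S\<close> by auto
  then obtain i where i: "\<rho> i t0 \<le> \<bar>v t0 $ i\<bar>" "0 \<le> t0" "t0 \<le> T" by (auto simp: S_def)
  have "t0 \<noteq> 0" using i init[of i] by auto
  then have t0: "0 < t0" using i by simp
  have before: "\<bar>v s $ j\<bar> < \<rho> j s" if "0 \<le> s" "s < t0" for s j
  proof -
    have "s \<notin> S" using that(2) cInf_lower[OF _ bdd, of s] unfolding t0_def by auto
    then show ?thesis using that i by (auto simp: S_def not_le)
  qed
  have upto: "\<bar>v s $ j\<bar> \<le> \<rho> j s" if "0 \<le> s" "s \<le> t0" for s j
  proof (cases "s < t0")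
    case True then show ?thesis using before that by (simp add: less_imp_le)
  next
    case False
    then have s: "s = t0" using that by simp
    have c1: "((\<lambda>s. v s $ j) \<longlongrightarrow> v t0 $ j) (at t0 within {0..t0})"
      and c2: "(\<rho> j \<longlongrightarrow> \<rho> j t0) (at t0 within {0..t0})"
      using cv[of j] \<rho>[of j] i(2,3) unfolding continuous_on_def
      by (auto intro: tendsto_within_subset[of _ _ _ "{0..T}"])
    have "trivial_limit (at t0 within {0..t0}) = False"
      using t0 by (simp add: trivial_limit_within islimpt_Icc)
    moreover have "eventually (\<lambda>s. \<bar>v s $ j\<bar> \<le> \<rho> j s) (at t0 within {0..t0})"
      unfolding eventually_at_filter
    proof (intro always_eventually allI impI)
      fix x assume "x \<noteq> t0" "x \<in> {0..t0}"
      then show "\<bar>v x $ j\<bar> \<le> \<rho> j x" by (intro less_imp_le[OF before]) auto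
    qed
    ultimately show ?thesis unfolding s
      using tendsto_le[OF _ c2 tendsto_rabs[OF c1]] by auto
  qed
  obtain D E where DE: "((\<lambda>s. v s $ i) has_real_derivative D) (at t0 within {0..t0})"
      "(\<rho> i has_real_derivative E) (at t0 within {0..t0})" "sgn (v t0 $ i) * D < E"
    using cross[OF t0 i(3) upto] i(1) upto[OF i(2) order_refl, of i] by (meson order_antisym)
  \<comment> \<open>Multiplying by the sign at \<open>t0\<close> instead of taking absolute values
    keeps the function differentiable from the left. It is nonnegative at \<open>t0\<close> and
    negative just before, by minimality of \<open>t0\<close>, whereas its negative left derivative
    makes it larger just before.\<close>
  define z where "z s = sgn (v t0 $ i) * v s $ i - \<rho> i s" for s
  have "(z has_real_derivative (sgn (v t0 $ i) * D - E)) (at t0 within {0..t0})"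
    unfolding z_def by (auto intro!: derivative_eq_intros DE)
  from has_real_derivative_neg_dec_left[OF this] DE(3) obtain \<delta>
    where \<delta>: "\<delta> > 0" "\<And>h. 0 < h \<Longrightarrow> t0 - h \<in> {0..t0} \<Longrightarrow> h < \<delta> \<Longrightarrow> z t0 < z (t0 - h)"
    by auto
  define h where "h = min t0 (\<delta>/2)"
  have h: "0 < h" "h < \<delta>" "h \<le> t0" using \<delta> t0 by (auto simp: h_def)
  have "z t0 = \<bar>v t0 $ i\<bar> - \<rho> i t0" by (simp add: z_def abs_sgn mult.commute)
  then have "z t0 \<ge> 0" using i by simp
  moreover have "z t0 < z (t0 - h)" using \<delta>(2)[of h] h by auto
  moreover have "z (t0 - h) < 0"
  proof -
    have "sgn (v t0 $ i) * v (t0 - h) $ i \<le> \<bar>v (t0 - h) $ i\<bar>"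
      by (auto simp: sgn_if)
    with before[of "t0 - h" i] h show ?thesis by (auto simp: z_def)
  qed
  ultimately show False by simp
qed

text \<open>The library's Brouwer theorem lives in a type of fixed dimension; the discretisation below
  needs boxes of varying dimension, hence this version, obtained directly from Kuhn's lemma.\<close>

lemma brouwer_finite_box:
  fixes \<Phi> :: "('a \<Rightarrow> real) \<Rightarrow> 'a \<Rightarrow> real" and \<rho> :: "'a \<Rightarrow> real"
  assumes fin: "finite A" and \<rho>: "\<And>a. a \<in> A \<Longrightarrow> \<rho> a > 0"
    and maps: "\<And>x a. (\<And>b. b \<in> A \<Longrightarrow> \<bar>x b\<bar> \<le> \<rho> b) \<Longrightarrow> a \<in> A \<Longrightarrow> \<bar>\<Phi> x a\<bar> \<le> \<rho> a"
    and cont: "\<And>X x a. (\<And>k b. b \<in> A \<Longrightarrow> \<bar>X k b\<bar> \<le> \<rho> b) \<Longrightarrow> (\<And>b. b \<in> A \<Longrightarrow> (\<lambda>k. X k b) \<longlonglongrightarrow> x b) \<Longrightarrow>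
        a \<in> A \<Longrightarrow> (\<lambda>k::nat. \<Phi> (X k) a) \<longlonglongrightarrow> \<Phi> x a"
  shows "\<exists>x. \<forall>a\<in>A. \<bar>x a\<bar> \<le> \<rho> a \<and> \<Phi> x a = x a"
proof -
  define n where "n = card A"
  obtain e where e: "bij_betw e {..<n} A"
    unfolding n_def using ex_bij_betw_nat_finite[OF fin] by (auto simp: atLeast0LessThan)
  define e' where "e' = the_inv_into {..<n} e"
  have e': "e' a < n" "e (e' a) = a" if "a \<in> A" for a
    using that e unfolding e'_def
    by (auto simp: bij_betw_def f_the_inv_into_f dest!: the_inv_into_into[OF _ _ order_refl])
  have e1: "e i \<in> A" "e' (e i) = i" if "i < n" for i
    using that e unfolding e'_def by (auto simp: bij_betw_def the_inv_into_f_f)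
  define pt where "pt p q a = - \<rho> a + 2 * \<rho> a * (real (q (e' a)) / real p)" for p and q :: "nat \<Rightarrow> nat" and a
  \<comment> \<open>Label 0 records that \<Phi> does not decrease the coordinate. The exception at
    \<open>q i = p\<close> enforces the label 1 that Kuhn's lemma demands on upper faces; on lower
    faces label 0 is automatic because \<Phi> stays in the box.\<close>
  define label where "label p q i = (if \<Phi> (pt p q) (e i) \<ge> pt p q (e i) \<and> q i \<noteq> p then 0 else (1::nat))" for p q i
  have pt_box: "\<bar>pt p q a\<bar> \<le> \<rho> a" if "p > 0" "\<forall>i<n. q i \<le> p" "a \<in> A" for p q a
  proof -
    have "0 \<le> real (q (e' a)) / real p" "real (q (e' a)) / real p \<le> 1"
      using that e' by (auto simp: divide_le_eq_1)
    then have "2 * \<rho> a * 0 \<le> 2 * \<rho> a * (real (q (e' a)) / real p)"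
      "2 * \<rho> a * (real (q (e' a)) / real p) \<le> 2 * \<rho> a * 1"
      using \<rho>[OF that(3)] by (intro mult_left_mono; simp)+
    then show ?thesis unfolding pt_def abs_le_iff by simp
  qed
  have "\<exists>q. (\<forall>i<n. q i < Suc m) \<and> (\<forall>i<n. \<exists>r s. (\<forall>j<n. q j \<le> r j \<and> r j \<le> q j + 1) \<and> (\<forall>j<n. q j \<le> s j \<and> s j \<le> q j + 1) \<and>
      label (Suc m) r i \<noteq> label (Suc m) s i)" for m
  proof -
    have l0: "label (Suc m) x i = 0" if x: "\<forall>i<n. x i \<le> Suc m" and i: "i < n" "x i = 0" for x i
    proof -
      have "\<bar>\<Phi> (pt (Suc m) x) (e i)\<bar> \<le> \<rho> (e i)"
        by (intro maps pt_box e1 i x) auto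
      moreover have "pt (Suc m) x (e i) = - \<rho> (e i)" using i e1 by (simp add: pt_def)
      ultimately show ?thesis using i by (simp add: label_def)
    qed
    have l1: "\<forall>x. (\<forall>i<n. x i \<le> Suc m) \<longrightarrow> (\<forall>i<n. label (Suc m) x i = 0 \<or> label (Suc m) x i = 1)"
      and l2: "\<forall>x. (\<forall>i<n. x i \<le> Suc m) \<longrightarrow> (\<forall>i<n. x i = Suc m \<longrightarrow> label (Suc m) x i = 1)"
      by (auto simp: label_def)
    have l0': "\<forall>x. (\<forall>i<n. x i \<le> Suc m) \<longrightarrow> (\<forall>i<n. x i = 0 \<longrightarrow> label (Suc m) x i = 0)"
      using l0 by blast
    obtain q where "\<forall>i<n. q i < Suc m" "\<forall>i<n. \<exists>r s. (\<forall>j<n. q j \<le> r j \<and> r j \<le> q j + 1) \<and> (\<forall>j<n. q j \<le> s j \<and> s j \<le> q j + 1) \<and>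
      label (Suc m) r i \<noteq> label (Suc m) s i"
      by (rule kuhn_lemma[OF zero_less_Suc l1 l0' l2])
    then show ?thesis by (rule_tac x=q in exI, rule conjI)
  qed
  then have "\<exists>q. \<forall>m. (\<forall>i<n. q m i < Suc m) \<and> (\<forall>i<n. \<exists>r s. (\<forall>j<n. q m j \<le> r j \<and> r j \<le> q m j + 1) \<and> (\<forall>j<n. q m j \<le> s j \<and> s j \<le> q m j + 1) \<and>
      label (Suc m) r i \<noteq> label (Suc m) s i)"
    by (intro choice allI)
  then obtain q where q: "\<And>m i. i < n \<Longrightarrow> q m i < Suc m"
    and q2: "\<And>m. \<forall>i<n. \<exists>r s. (\<forall>j<n. q m j \<le> r j \<and> r j \<le> q m j + 1) \<and> (\<forall>j<n. q m j \<le> s j \<and> s j \<le> q m j + 1) \<and>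
      label (Suc m) r i \<noteq> label (Suc m) s i" by blast
  define corner where "corner m i c r \<longleftrightarrow> (\<forall>j<n. q m j \<le> r j \<and> r j \<le> q m j + 1) \<and> label (Suc m) r i = c" for m i c r
  have ex: "\<exists>r. i < n \<longrightarrow> corner m i c r" if "c = 0 \<or> c = 1" for m i c
  proof (cases "i < n")
    case True
    obtain r s where rs: "(\<forall>j<n. q m j \<le> r j \<and> r j \<le> q m j + 1)" "(\<forall>j<n. q m j \<le> s j \<and> s j \<le> q m j + 1)"
      "label (Suc m) r i \<noteq> label (Suc m) s i" using q2[of m] True by blast
    have "label (Suc m) x i = 0 \<or> label (Suc m) x i = 1" for x by (auto simp: label_def)
    then have "label (Suc m) r i = c \<or> label (Suc m) s i = c" using rs(3) that by metis
    then show ?thesis using rs(1,2) unfolding corner_def by blast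
  qed simp
  have "\<exists>r. \<forall>m i. i < n \<longrightarrow> corner m i c (r m i)" if "c = 0 \<or> c = 1" for c
    using ex[OF that] by (intro choice allI)
  from this[of 0] this[of 1] obtain r s where rs: "\<And>m i. i < n \<Longrightarrow> corner m i 0 (r m i)" "\<And>m i. i < n \<Longrightarrow> corner m i 1 (s m i)"
    by auto
  have r: "q m j \<le> r m i j \<and> r m i j \<le> q m j + 1" and s: "q m j \<le> s m i j \<and> s m i j \<le> q m j + 1"
    if "i < n" "j < n" for m i j
    using rs[OF that(1), of m] that(2) by (auto simp: corner_def)
  have lr: "label (Suc m) (r m i) i = 0" and ls: "label (Suc m) (s m i) i = 1" if "i < n" for m i
    using rs[OF that, of m] by (auto simp: corner_def)
  \<comment> \<open>Compactness of the box, one coordinate at a time: every pass thins the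
    subsequence further and keeps the convergence already obtained.\<close>
  have "\<exists>l. strict_mono l \<and> (\<forall>i<k. convergent (\<lambda>m. pt (Suc (l m)) (q (l m)) (e i)))" if "k \<le> n" for k
    using that
  proof (induction k)
    case 0 show ?case by (rule exI[of _ id]) (auto simp: strict_mono_def)
  next
    case (Suc k)
    then obtain l where l: "strict_mono (l::nat\<Rightarrow>nat)" "\<And>i. i<k \<Longrightarrow> convergent (\<lambda>m. pt (Suc (l m)) (q (l m)) (e i))"
      by auto
    have "\<forall>m. pt (Suc (l m)) (q (l m)) (e k) \<in> {- \<rho> (e k) .. \<rho> (e k)}"
    proof
      fix m
      have "\<bar>pt (Suc (l m)) (q (l m)) (e k)\<bar> \<le> \<rho> (e k)"
        using Suc.prems q by (intro pt_box e1) (auto intro: less_imp_le)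
      then show "pt (Suc (l m)) (q (l m)) (e k) \<in> {- \<rho> (e k) .. \<rho> (e k)}" by auto
    qed
    then obtain y l' where l': "strict_mono (l'::nat\<Rightarrow>nat)" "((\<lambda>m. pt (Suc (l m)) (q (l m)) (e k)) \<circ> l') \<longlonglongrightarrow> y"
      using compact_Icc[of "- \<rho> (e k)" "\<rho> (e k)"] unfolding compact_def by meson
    have "convergent (\<lambda>m. pt (Suc ((l \<circ> l') m)) (q ((l \<circ> l') m)) (e i))" if "i < Suc k" for i
    proof (cases "i = k")
      case True then show ?thesis using l' by (auto simp: convergent_def o_def)
    next
      case False
      then have "i < k" using that by simp
      from convergent_subseq_convergent[OF l(2)[OF this] l'(1)] show ?thesis by (simp add: o_def)
    qed
    then show ?case using strict_mono_o[OF l(1) l'(1)] by blast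
  qed
  from this[OF order_refl] obtain l where l: "strict_mono (l::nat\<Rightarrow>nat)"
    and "\<forall>i<n. convergent (\<lambda>m. pt (Suc (l m)) (q (l m)) (e i))" by blast
  then obtain y where y: "\<And>i. i < n \<Longrightarrow> (\<lambda>m. pt (Suc (l m)) (q (l m)) (e i)) \<longlonglongrightarrow> y i"
    unfolding convergent_def by metis
  define x where "x a = y (e' a)" for a
  have xlim: "(\<lambda>m. pt (Suc (l m)) (q (l m)) a) \<longlonglongrightarrow> x a" if "a \<in> A" for a
    using y[of "e' a"] e'[OF that] by (simp add: x_def)
  have near: "(\<lambda>m. pt (Suc (l m)) (R m) a) \<longlonglongrightarrow> x a"
    if "\<And>m j. j < n \<Longrightarrow> q (l m) j \<le> R m j \<and> R m j \<le> q (l m) j + 1" "a \<in> A" for R a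
  proof -
    have "(\<lambda>m. 2 * \<rho> a * inverse (real (Suc (l m)))) \<longlonglongrightarrow> 2 * \<rho> a * 0"
      by (intro tendsto_mult tendsto_const LIMSEQ_subseq_LIMSEQ[OF LIMSEQ_inverse_real_of_nat l, unfolded o_def])
    then have "(\<lambda>m. 2 * \<rho> a * inverse (real (Suc (l m)))) \<longlonglongrightarrow> 0" by simp
    then have z: "(\<lambda>m. pt (Suc (l m)) (R m) a - pt (Suc (l m)) (q (l m)) a) \<longlonglongrightarrow> 0"
    proof (rule Lim_null_comparison[rotated], intro always_eventually allI)
      fix m
      have "pt (Suc (l m)) (R m) a - pt (Suc (l m)) (q (l m)) a
        = 2 * \<rho> a * inverse (real (Suc (l m))) * (real (R m (e' a)) - real (q (l m) (e' a)))"
        by (simp add: pt_def divide_inverse algebra_simps del: of_nat_Suc)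
      also have "norm \<dots> \<le> 2 * \<rho> a * inverse (real (Suc (l m))) * 1"
        unfolding norm_mult using \<rho>[OF that(2)] that(1)[of "e' a" m] e'[OF that(2)]
        by (intro mult_mono) auto
      finally show "norm (pt (Suc (l m)) (R m) a - pt (Suc (l m)) (q (l m)) a) \<le> 2 * \<rho> a * inverse (real (Suc (l m)))"
        by simp
    qed
    from tendsto_add[OF z xlim[OF that(2)]] show ?thesis by simp
  qed
  have "\<bar>x a\<bar> \<le> \<rho> a \<and> \<Phi> x a = x a" if a: "a \<in> A" for a
  proof -
    define i where "i = e' a"
    have i: "i < n" "e i = a" using e'[OF a] by (auto simp: i_def)
    have "r (l k) i j \<le> Suc (l k)" "s (l k) i j \<le> Suc (l k)" if "j < n" for k j
      using r[OF i(1) that, of "l k"] s[OF i(1) that, of "l k"] q[OF that, of "l k"] by auto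
    then have rb: "\<bar>pt (Suc (l k)) (r (l k) i) b\<bar> \<le> \<rho> b" and sb: "\<bar>pt (Suc (l k)) (s (l k) i) b\<bar> \<le> \<rho> b"
      if "b \<in> A" for k b
      by (intro pt_box that; simp)+
    have rl: "(\<lambda>k. pt (Suc (l k)) (r (l k) i) b) \<longlonglongrightarrow> x b" and sl: "(\<lambda>k. pt (Suc (l k)) (s (l k) i) b) \<longlonglongrightarrow> x b"
      if "b \<in> A" for b
      using r[OF i(1)] s[OF i(1)] that by (auto intro!: near)
    \<comment> \<open>The two differently labelled corners of a shrinking cell tend to the same
      point, so each contributes one of the two inequalities in the limit.\<close>
    have "pt (Suc (l k)) (r (l k) i) a \<le> \<Phi> (pt (Suc (l k)) (r (l k) i)) a" for k
      using lr[OF i(1), of "l k"] i by (auto simp: label_def split: if_splits)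
    then have 1: "x a \<le> \<Phi> x a"
      by (intro LIMSEQ_le[OF rl[OF a] cont[OF rb rl a]]) auto
    have 2: "\<Phi> x a \<le> x a"
    proof (rule LIMSEQ_le[OF cont[OF sb sl a] sl[OF a]], simp, simp, intro exI allI impI)
      fix k
      \<comment> \<open>Label 1 may come from the upper face rather than from a decrease; there the
        coordinate equals \<open>\<rho> a\<close>, which \<Phi> cannot exceed.\<close>
      from ls[OF i(1), of "l k"] i have "\<Phi> (pt (Suc (l k)) (s (l k) i)) a < pt (Suc (l k)) (s (l k) i) a \<or> s (l k) i i = Suc (l k)"
        by (auto simp: label_def split: if_splits)
      moreover have "pt (Suc (l k)) (s (l k) i) a = \<rho> a" if "s (l k) i i = Suc (l k)"
        using that by (simp add: pt_def i_def[symmetric] del: of_nat_Suc)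
      moreover have "\<bar>\<Phi> (pt (Suc (l k)) (s (l k) i)) a\<bar> \<le> \<rho> a" by (rule maps[OF sb a])
      ultimately show "\<Phi> (pt (Suc (l k)) (s (l k) i)) a \<le> pt (Suc (l k)) (s (l k) i) a" by fastforce
    qed
    have "\<bar>x a\<bar> \<le> \<rho> a"
      by (rule LIMSEQ_le_const2[OF tendsto_rabs[OF rl[OF a]]]) (use rb[OF a] in auto)
    with 1 2 show ?thesis by simp
  qed
  then show ?thesis by blast
qed

text \<open>At each point of \<open>P\<close> the difference quotients are bounded by some n + 1 at
  scale 1 / (n + 1). The sets \<open>E n\<close> of points with this property are closed by
  continuity of \<open>W\<close> and cover \<open>P\<close>, so by Baire one of them contains a
  portion of \<open>P\<close>. There the bound passes to the limit of the quotients, however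
  irregular the derivative is.\<close>

lemma derivative_bounded_on_portion:
  fixes W h :: "real \<Rightarrow> real"
  assumes der: "\<And>t. t \<in> {A..B} \<Longrightarrow> (W has_real_derivative h t) (at t within {A..B})"
    and P: "closed P" "P \<noteq> {}" "P \<subseteq> {A..B}" and AB: "A < B"
  shows "\<exists>U c. open U \<and> U \<inter> P \<noteq> {} \<and> (\<forall>t\<in>U \<inter> P. \<bar>h t\<bar> \<le> c)"
proof -
  have contW: "continuous_on {A..B} W"
    using der by (meson continuous_on_eq_continuous_within DERIV_continuous)
  define E where "E n = {x \<in> P. \<forall>y\<in>{A..B}. \<bar>y - x\<bar> < 1 / real (Suc n) \<longrightarrow> \<bar>W y - W x\<bar> \<le> real (Suc n) * \<bar>y - x\<bar>}" for n
  have clE: "closed (E n)" for n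
  proof -
    have "closed {x \<in> P. \<bar>y - x\<bar> < 1 / real (Suc n) \<longrightarrow> \<bar>W y - W x\<bar> \<le> real (Suc n) * \<bar>y - x\<bar>}" for y
    proof -
      have cP: "continuous_on P W" using contW P continuous_on_subset by blast
      have "closed {x \<in> P. 1 / real (Suc n) \<le> \<bar>y - x\<bar>}"
        by (intro continuous_on_closed_Collect_le continuous_intros P)
      moreover have "closed {x \<in> P. \<bar>W y - W x\<bar> \<le> real (Suc n) * \<bar>y - x\<bar>}"
        by (intro continuous_on_closed_Collect_le continuous_intros P cP)
      ultimately have "closed ({x \<in> P. 1 / real (Suc n) \<le> \<bar>y - x\<bar>} \<union> {x \<in> P. \<bar>W y - W x\<bar> \<le> real (Suc n) * \<bar>y - x\<bar>})"
        by (rule closed_Un)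
      also have "\<dots> = {x \<in> P. \<bar>y - x\<bar> < 1 / real (Suc n) \<longrightarrow> \<bar>W y - W x\<bar> \<le> real (Suc n) * \<bar>y - x\<bar>}"
        by auto
      finally show ?thesis .
    qed
    then have "closed (\<Inter>y\<in>{A..B}. {x \<in> P. \<bar>y - x\<bar> < 1 / real (Suc n) \<longrightarrow> \<bar>W y - W x\<bar> \<le> real (Suc n) * \<bar>y - x\<bar>})"
      by (intro closed_INT) blast
    moreover have "E n = P \<inter> (\<Inter>y\<in>{A..B}. {x \<in> P. \<bar>y - x\<bar> < 1 / real (Suc n) \<longrightarrow> \<bar>W y - W x\<bar> \<le> real (Suc n) * \<bar>y - x\<bar>})"
      using AB by (auto simp: E_def)
    ultimately show ?thesis using P by auto
  qed
  have cover: "\<exists>n. x \<in> E n" if x: "x \<in> P" for x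
  proof -
    have xAB: "x \<in> {A..B}" using x P by blast
    have "((\<lambda>y. (W y - W x) / (y - x)) \<longlongrightarrow> h x) (at x within {A..B})"
      using der[OF xAB] by (simp add: has_field_derivative_iff)
    from tendstoD[OF this, of 1] obtain \<delta> where \<delta>: "\<delta> > 0"
      and d: "\<And>y. y \<in> {A..B} \<Longrightarrow> y \<noteq> x \<Longrightarrow> \<bar>y - x\<bar> < \<delta> \<Longrightarrow> \<bar>(W y - W x) / (y - x) - h x\<bar> < 1"
      by (auto simp: eventually_at dist_real_def)
    obtain n where n: "real n > max (1 / \<delta>) (\<bar>h x\<bar> + 1)" using reals_Archimedean2 by blast
    have "x \<in> E n" unfolding E_def
    proof (intro CollectI conjI x ballI impI)
      fix y assume y: "y \<in> {A..B}" "\<bar>y - x\<bar> < 1 / real (Suc n)"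
      have "1 / real (Suc n) < \<delta>" using n \<delta> by (auto simp: field_simps)
      show "\<bar>W y - W x\<bar> \<le> real (Suc n) * \<bar>y - x\<bar>"
      proof (cases "y = x")
        case False
        have "\<bar>(W y - W x) / (y - x) - h x\<bar> < 1"
          by (rule d) (use y False \<open>1 / real (Suc n) < \<delta>\<close> in auto)
        then have "\<bar>(W y - W x) / (y - x)\<bar> < \<bar>h x\<bar> + 1" by linarith
        also have "\<dots> \<le> real (Suc n)" using n by simp
        finally have "\<bar>(W y - W x) / (y - x)\<bar> \<le> real (Suc n)" by simp
        then show ?thesis using False by (simp add: abs_divide pos_divide_le_eq)
      qed simp
    qed
    then show ?thesis by blast
  qed
  \<comment> \<open>If every \<open>P - E n\<close> were dense in \<open>P\<close>, so would be
    their intersection, which is empty by \<open>cover\<close>.\<close>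
  have "\<exists>n. \<not> P \<subseteq> closure (P - E n)"
  proof (rule ccontr)
    assume "\<not> ?thesis"
    then have "P \<subseteq> closure (\<Inter> (range (\<lambda>n. P - E n)))"
      using clE by (intro Baire P) (auto simp: Diff_eq intro!: openin_open_Int)
    moreover have "\<Inter> (range (\<lambda>n. P - E n)) = {}" using cover by blast
    ultimately show False using P by (metis closure_empty subset_empty)
  qed
  then obtain n x where x: "x \<in> P" "x \<notin> closure (P - E n)" by blast
  define U where "U = - closure (P - E n)"
  have "\<bar>h t\<bar> \<le> real (Suc n)" if t: "t \<in> U \<inter> P" for t
  proof -
    have tE: "t \<in> E n" using t closure_subset[of "P - E n"] by (auto simp: U_def)
    have tAB: "t \<in> {A..B}" using t P by blast
    have lim: "((\<lambda>y. \<bar>(W y - W t) / (y - t)\<bar>) \<longlongrightarrow> \<bar>h t\<bar>) (at t within {A..B})"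
      using der[OF tAB] unfolding has_field_derivative_iff by (rule tendsto_rabs)
    have "eventually (\<lambda>y. \<bar>(W y - W t) / (y - t)\<bar> \<le> real (Suc n)) (at t within {A..B})"
      unfolding eventually_at
    proof (intro exI[of _ "1 / real (Suc n)"] conjI ballI impI)
      fix y assume "y \<in> {A..B}" "y \<noteq> t \<and> dist y t < 1 / real (Suc n)"
      then show "\<bar>(W y - W t) / (y - t)\<bar> \<le> real (Suc n)"
        using tE by (auto simp: E_def dist_real_def abs_divide pos_divide_le_eq)
    qed simp
    moreover have "\<not> trivial_limit (at t within {A..B})"
      using tAB AB by (auto simp: trivial_limit_within islimpt_Icc)
    ultimately show ?thesis using tendsto_upperbound[OF lim] by blast
  qed
  then show ?thesis using x by (intro exI[of _ U] exI[of _ "real (Suc n)"]) (auto simp: U_def)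
qed

section \<open>Uniform boundedness of the supports of a family of measures\<close>

text \<open>Continuous stand-in for the indicator of the half-line beyond r, because histories have
  to be continuous. Slope \<open>Suc m\<close> lets every ramp, including m = 0, reach 1 by r +
  1.\<close>

definition ramp :: "nat \<Rightarrow> real \<Rightarrow> real \<Rightarrow> real" where
  "ramp m r s = max 0 (min 1 (real (Suc m) * (s - r)))"

lemma ramp_zero: "s \<le> r \<Longrightarrow> ramp m r s = 0"
proof -
  assume "s \<le> r"
  then have "real (Suc m) * (s - r) \<le> 0" by (intro mult_nonneg_nonpos) auto
  then show ?thesis by (simp add: ramp_def)
qed

lemma ramp_bounds: "0 \<le> ramp m r s" "ramp m r s \<le> 1"
  by (auto simp: ramp_def)

lemma ramp_one: "r + 1 \<le> s \<Longrightarrow> ramp m r s = 1"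
proof -
  assume "r + 1 \<le> s"
  then have "1 * 1 \<le> real (Suc m) * (s - r)" by (intro mult_mono) auto
  then show ?thesis by (simp add: ramp_def)
qed

lemma ramp_tendsto: "(\<lambda>m. ramp m r s) \<longlonglongrightarrow> indicator {r<..} s"
proof (cases "s \<le> r")
  case True then show ?thesis by (simp add: ramp_zero)
next
  case False
  obtain M where "1 < real M * (s - r)" using False ex_less_of_nat_mult[of "s - r" 1] by auto
  then have "ramp m r s = 1" if "m \<ge> M" for m
  proof -
    have "real M * (s - r) \<le> real (Suc m) * (s - r)" using that False by (intro mult_right_mono) auto
    then show ?thesis using \<open>1 < real M * (s - r)\<close> by (simp add: ramp_def)
  qed
  then have "(\<lambda>m. ramp m r s) \<longlonglongrightarrow> 1"
    by (intro tendsto_eventually) (auto simp: eventually_sequentially)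
  then show ?thesis using False by simp
qed

lemma continuous_ramp: "continuous_on UNIV (ramp m r)"
  unfolding ramp_def by (intro continuous_intros)

lemma borel_ramp[measurable]: "ramp m r \<in> borel_measurable borel"
  using continuous_ramp by (rule borel_measurable_continuous_onI)

lemma ramp_scaled: "\<bar>p * ramp m r s\<bar> \<le> \<bar>p\<bar>"
  using ramp_bounds[of m r s] by (simp add: abs_mult mult_left_le)

text \<open>Converts integrals over ramps into tail masses. The ramp passes level l / n at r + l /
  ((m + 1) n); jumping there by the increment of \<Psi> between consecutive levels telescopes to
  \<Psi> at a level within 1 / n of the ramp, and the Lipschitz bound does the rest.\<close>

lemma ramp_staircase:
  fixes \<Psi> :: "real \<Rightarrow> real"
  assumes lipP: "\<And>x y. \<bar>\<Psi> x - \<Psi> y\<bar> \<le> K * \<bar>x - y\<bar>" and n: "0 < n" and K: "0 \<le> K"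
  shows "\<bar>\<Psi> (ramp m r s) - \<Psi> 0 -
     (\<Sum>l<n. (\<Psi> (real (Suc l) / real n) - \<Psi> (real l / real n)) * indicator {r + real l / (real (Suc m) * real n) <..} s)\<bar> \<le> K / real n"
proof -
  define x where "x = real (Suc m) * (s - r) * real n"
  \<comment> \<open>\<open>j\<close> counts the thresholds strictly below \<open>s\<close>. As the
    tails are open half-lines these are the l < n with l < x, hence a ceiling.\<close>
  define j where "j = min n (nat \<lceil>x\<rceil>)"
  have ind: "s \<in> {r + real l / (real (Suc m) * real n) <..} \<longleftrightarrow> l < j" if "l < n" for l
  proof -
    have "s \<in> {r + real l / (real (Suc m) * real n) <..} \<longleftrightarrow> real l / (real (Suc m) * real n) < s - r" by auto
    also have "\<dots> \<longleftrightarrow> real l < x" using n by (simp add: x_def pos_divide_less_eq mult_ac del: of_nat_Suc)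
    also have "\<dots> \<longleftrightarrow> l < nat \<lceil>x\<rceil>" by linarith
    finally show ?thesis using that by (simp add: j_def)
  qed
  have "(\<Sum>l<n. (\<Psi> (real (Suc l) / real n) - \<Psi> (real l / real n)) * indicator {r + real l / (real (Suc m) * real n) <..} s)
    = (\<Sum>l<n. if l < j then \<Psi> (real (Suc l) / real n) - \<Psi> (real l / real n) else 0)"
    using ind by (intro sum.cong) (auto simp: indicator_def)
  also have "\<dots> = (\<Sum>l<j. \<Psi> (real (Suc l) / real n) - \<Psi> (real l / real n))"
    by (rule sum.mono_neutral_cong_right) (auto simp: j_def)
  also have "\<dots> = \<Psi> (real j / real n) - \<Psi> (real 0 / real n)"
    by (rule sum_lessThan_telescope)
  finally have eq: "\<Psi> (ramp m r s) - \<Psi> 0 -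
     (\<Sum>l<n. (\<Psi> (real (Suc l) / real n) - \<Psi> (real l / real n)) * indicator {r + real l / (real (Suc m) * real n) <..} s)
    = \<Psi> (ramp m r s) - \<Psi> (real j / real n)" by simp
  have "ramp m r s * real n = max 0 (min (real n) x)"
    using n by (auto simp: ramp_def x_def max_def min_def mult_le_0_iff zero_le_mult_iff)
  then have "\<bar>ramp m r s * real n - real j\<bar> \<le> 1"
    unfolding j_def by linarith
  then have "\<bar>(ramp m r s * real n - real j) / real n\<bar> \<le> 1 / real n"
    using n by (simp add: abs_divide divide_right_mono)
  moreover have "(ramp m r s * real n - real j) / real n = ramp m r s - real j / real n"
    using n by (simp add: diff_divide_distrib)
  ultimately have "\<bar>ramp m r s - real j / real n\<bar> \<le> 1 / real n" by simp
  from mult_left_mono[OF this K] show ?thesis unfolding eq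
    using lipP[of "ramp m r s" "real j / real n"] by simp
qed

section \<open>Continuous extensions and the gliding hump\<close>

locale glued_functions =
  fixes w :: "real \<Rightarrow> real" and R0 :: real
  assumes cont_w: "continuous_on UNIV w"
begin

definition extensions :: "(real \<Rightarrow> real) set" where
  "extensions = {\<psi>. continuous_on UNIV \<psi> \<and> (\<forall>s\<le>R0. \<psi> s = w s)}"

text \<open>Stages of the construction are constant from R on, so a bump attached there changes the
  value of f by an amount that depends only on the base value \<psi> R and on the bump.\<close>

definition ext_const :: "(real \<Rightarrow> real) \<Rightarrow> real \<Rightarrow> bool" where
  "ext_const \<psi> R \<longleftrightarrow> \<psi> \<in> extensions \<and> R0 \<le> R \<and> (\<forall>s\<ge>R. \<psi> s = \<psi> R)"

lemma ext_const_mono: "ext_const \<psi> R \<Longrightarrow> R \<le> R' \<Longrightarrow> ext_const \<psi> R'"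
  unfolding ext_const_def by (metis order_trans)

lemma gliding_hump:
  assumes step: "\<And>k \<psi> R. ext_const \<psi> R \<Longrightarrow> \<exists>\<psi>' R'. ext_const \<psi>' R' \<and> R + 1 \<le> R' \<and> (\<forall>s\<le>R. \<psi>' s = \<psi> s) \<and>
            (\<forall>\<theta>\<in>extensions. (\<forall>s\<le>R'. \<theta> s = \<psi>' s) \<longrightarrow> Q k \<theta>)"
  shows "\<exists>\<theta>\<in>extensions. \<forall>k::nat. Q k \<theta>"
proof -
  have start: "ext_const (\<lambda>s. w (min s R0)) R0"
    unfolding ext_const_def extensions_def
    by (auto intro!: continuous_on_compose2[OF cont_w] continuous_intros)
  have "\<exists>F. \<forall>n. (ext_const (fst (F n)) (snd (F n))) \<and>
     (snd (F n) + 1 \<le> snd (F (Suc n)) \<and> (\<forall>s\<le>snd (F n). fst (F (Suc n)) s = fst (F n) s) \<and>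
            (\<forall>\<theta>\<in>extensions. (\<forall>s\<le>snd (F (Suc n)). \<theta> s = fst (F (Suc n)) s) \<longrightarrow> Q n \<theta>))"
  proof (rule dependent_nat_choice)
    show "\<exists>x. ext_const (fst x) (snd x)" using start by auto
    show "\<exists>y. ext_const (fst y) (snd y) \<and>
             (snd x + 1 \<le> snd y \<and> (\<forall>s\<le>snd x. fst y s = fst x s) \<and>
             (\<forall>\<theta>\<in>extensions. (\<forall>s\<le>snd y. \<theta> s = fst y s) \<longrightarrow> Q n \<theta>))"
      if "ext_const (fst x) (snd x)" for x n
      using step[OF that, of n] by auto
  qed
  then obtain F where F: "\<And>n. ext_const (fst (F n)) (snd (F n))"
     "\<And>n. snd (F n) + 1 \<le> snd (F (Suc n))" "\<And>n s. s\<le>snd (F n) \<Longrightarrow> fst (F (Suc n)) s = fst (F n) s"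
     "\<And>n \<theta>. \<theta>\<in>extensions \<Longrightarrow> (\<forall>s\<le>snd (F (Suc n)). \<theta> s = fst (F (Suc n)) s) \<Longrightarrow> Q n \<theta>" by blast
  have mono: "snd (F n) \<le> snd (F m) \<and> (\<forall>s\<le>snd (F n). fst (F m) s = fst (F n) s)" if "n \<le> m" for n m
    using that
  proof (induction m rule: dec_induct)
    case (step m)
    have "snd (F m) \<le> snd (F (Suc m))" using F(2)[of m] by simp
    moreover have "fst (F (Suc m)) s = fst (F n) s" if "s \<le> snd (F n)" for s
      using F(3)[of s m] step that by auto
    ultimately show ?case using step by auto
  qed simp
  have large: "R0 + real n \<le> snd (F n)" for n
  proof (induction n)
    case 0 show ?case using F(1)[of 0] by (simp add: ext_const_def)
  next
    case (Suc n) then show ?case using F(2)[of n] by simp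
  qed
  \<comment> \<open>Stage n is frozen at least up to R0 + n, so the stage with index the ceiling of
    s - R0 already shows the final value at s.\<close>
  define \<theta> where "\<theta> s = fst (F (nat \<lceil>s - R0\<rceil>)) s" for s
  have eq: "\<theta> s = fst (F n) s" if "s \<le> snd (F n)" for n s
  proof -
    define m where "m = nat \<lceil>s - R0\<rceil>"
    have "s \<le> R0 + real m" unfolding m_def by linarith
    then have "s \<le> snd (F m)" using large[of m] by simp
    moreover have "\<theta> s = fst (F m) s" by (simp add: \<theta>_def m_def)
    ultimately show ?thesis using that mono[of n m] mono[of m n] by (cases "n \<le> m") auto
  qed
  have UN: "(\<Union>n. {..<snd (F n)}) = UNIV"
  proof -
    have "\<exists>n. s < snd (F n)" for s
    proof -
      obtain n where "s - R0 < real n" using reals_Archimedean2 by blast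
      then show ?thesis using large[of n] by (intro exI[of _ n]) simp
    qed
    then show ?thesis by auto
  qed
  have "continuous_on (\<Union>n. {..<snd (F n)}) \<theta>"
  proof (rule continuous_on_open_UN)
    fix n
    have "continuous_on {..<snd (F n)} (fst (F n))"
      using F(1)[of n] by (auto simp: ext_const_def extensions_def intro: continuous_on_subset)
    then show "continuous_on {..<snd (F n)} \<theta>"
      by (rule continuous_on_eq) (use eq[of _ n] in \<open>simp add: less_imp_le\<close>)
  qed auto
  then have "\<theta> \<in> extensions" unfolding UN extensions_def
    using F(1)[of 0] eq[of _ 0] by (auto simp: ext_const_def extensions_def)
  moreover have "Q n \<theta>" for n
    by (rule F(4)[OF \<open>\<theta> \<in> extensions\<close>]) (use eq[of _ "Suc n"] in blast)
  ultimately show ?thesis by blast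
qed

lemma ext_const_ramp:
  assumes "ext_const \<psi> R" "R \<le> r"
  shows "ext_const (\<lambda>s. \<psi> s + p * ramp m r s) (r + 1)" "s \<le> r \<Longrightarrow> \<psi> s + p * ramp m r s = \<psi> s"
    "r < s \<Longrightarrow> \<psi> s = \<psi> R"
proof -
  have \<psi>: "\<psi> \<in> extensions" "R0 \<le> R" and const: "\<And>s. R \<le> s \<Longrightarrow> \<psi> s = \<psi> R"
    using assms(1) unfolding ext_const_def by blast+
  have "continuous_on UNIV (\<lambda>s. \<psi> s + p * ramp m r s)"
    using \<psi>(1) by (intro continuous_intros continuous_ramp) (simp add: extensions_def)
  moreover have "\<psi> s + p * ramp m r s = w s" if "s \<le> R0" for s
    using \<psi> assms(2) that by (simp add: extensions_def ramp_zero)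
  ultimately have ext: "(\<lambda>s. \<psi> s + p * ramp m r s) \<in> extensions"
    by (simp add: extensions_def)
  have "\<psi> s + p * ramp m r s = \<psi> (r + 1) + p * ramp m r (r + 1)" if "r + 1 \<le> s" for s
    using const[of s] const[of "r + 1"] assms(2) that by (simp add: ramp_one)
  moreover have "R0 \<le> r + 1" using \<psi>(2) assms(2) by simp
  ultimately show "ext_const (\<lambda>s. \<psi> s + p * ramp m r s) (r + 1)"
    unfolding ext_const_def using ext by blast
  show "s \<le> r \<Longrightarrow> \<psi> s + p * ramp m r s = \<psi> s" by (simp add: ramp_zero)
  show "\<psi> s = \<psi> R" if "r < s" by (rule const) (use assms(2) that in simp)
qed

end

text \<open>The argument s of an extension stands for the time - s, and the tails of the measures see the
  distant past of the initial function.\<close>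

locale tail_measures = glued_functions w R0 for w :: "real \<Rightarrow> real" and R0 :: real +
  fixes A B V F :: real and \<mu>p \<mu>m :: "real \<Rightarrow> real measure" and f c :: "real \<Rightarrow> real"
  assumes AB: "A < B"
    and sets_mu: "\<And>t. t \<in> {A..B} \<Longrightarrow> sets (\<mu>p t) = sets borel" "\<And>t. t \<in> {A..B} \<Longrightarrow> sets (\<mu>m t) = sets borel"
    and mass: "\<And>t. t \<in> {A..B} \<Longrightarrow> emeasure (\<mu>p t) UNIV \<le> ennreal V" "\<And>t. t \<in> {A..B} \<Longrightarrow> emeasure (\<mu>m t) UNIV \<le> ennreal V"
    and V: "0 \<le> V"
    and singular: "\<And>t. t \<in> {A..B} \<Longrightarrow> \<exists>S\<in>sets borel. emeasure (\<mu>p t) (- S) = 0 \<and> emeasure (\<mu>m t) S = 0"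
    and lip: "\<And>x y. \<bar>f x - f y\<bar> \<le> F * \<bar>x - y\<bar>"
    and unbounded: "\<And>k. \<exists>p. k < \<bar>f p\<bar>"
    and int: "\<And>\<psi> t. \<psi> \<in> extensions \<Longrightarrow> t \<in> {A..B} \<Longrightarrow> integrable (\<mu>p t) (\<lambda>s. f (\<psi> s))"
       "\<And>\<psi> t. \<psi> \<in> extensions \<Longrightarrow> t \<in> {A..B} \<Longrightarrow> integrable (\<mu>m t) (\<lambda>s. f (\<psi> s))"
    and der: "\<And>\<psi>. \<psi> \<in> extensions \<Longrightarrow> \<exists>W. \<forall>t\<in>{A..B}. (W has_real_derivative
        ((\<integral>s. f (\<psi> s) \<partial>\<mu>p t) - (\<integral>s. f (\<psi> s) \<partial>\<mu>m t) + c t)) (at t within {A..B})"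
begin

section \<open>Tail masses and integrals for a family of signed measures\<close>

definition G :: "(real \<Rightarrow> real) \<Rightarrow> real \<Rightarrow> real" where
  "G \<psi> t = (\<integral>s. f (\<psi> s) \<partial>\<mu>p t) - (\<integral>s. f (\<psi> s) \<partial>\<mu>m t) + c t"

definition tail :: "real \<Rightarrow> real \<Rightarrow> real" where
  "tail r t = measure (\<mu>p t) {r<..} - measure (\<mu>m t) {r<..}"

definition null_beyond :: "real \<Rightarrow> real \<Rightarrow> bool" where
  "null_beyond t R \<longleftrightarrow> emeasure (\<mu>p t) {R<..} = 0 \<and> emeasure (\<mu>m t) {R<..} = 0"

lemma null_beyond_mono: "t \<in> {A..B} \<Longrightarrow> null_beyond t R \<Longrightarrow> R \<le> R' \<Longrightarrow> null_beyond t R'"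
  unfolding null_beyond_def
  using emeasure_mono[of "{R'<..}" "{R<..}" "\<mu>p t"] emeasure_mono[of "{R'<..}" "{R<..}" "\<mu>m t"] sets_mu[of t]
  by simp

lemma space_mu: "t \<in> {A..B} \<Longrightarrow> space (\<mu>p t) = UNIV" "t \<in> {A..B} \<Longrightarrow> space (\<mu>m t) = UNIV"
  using sets_mu[THEN sets_eq_imp_space_eq] by auto

lemma finite_mu: "t \<in> {A..B} \<Longrightarrow> finite_measure (\<mu>p t)" "t \<in> {A..B} \<Longrightarrow> finite_measure (\<mu>m t)"
  using mass[of t] by (intro finite_measureI; simp add: space_mu neq_top_trans[OF ennreal_neq_top])+

lemma measure_le_V: "t \<in> {A..B} \<Longrightarrow> measure (\<mu>p t) UNIV \<le> V" "t \<in> {A..B} \<Longrightarrow> measure (\<mu>m t) UNIV \<le> V"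
  using mass[of t] V unfolding measure_def by (simp_all add: enn2real_leI)

lemma F_nonneg: "0 \<le> F" using lip[of 1 0] abs_ge_zero[of "f 1 - f 0"] by simp

lemma cont_f: "continuous_on UNIV f"
proof -
  have "F-lipschitz_on UNIV f"
    using lip F_nonneg by (intro lipschitz_onI) (auto simp: dist_real_def)
  then show ?thesis by (rule lipschitz_on_continuous_on)
qed

lemma borel_f[measurable]: "f \<in> borel_measurable borel"
  using cont_f by (rule borel_measurable_continuous_onI)

lemma f_diff_bound: "\<bar>q\<bar> \<le> \<bar>p\<bar> \<Longrightarrow> \<bar>f (e + q) - f e\<bar> \<le> F * \<bar>p\<bar>"
  using lip[of "e + q" e] mult_left_mono[OF _ F_nonneg, of "\<bar>q\<bar>" "\<bar>p\<bar>"] by simp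

lemma unbounded_shift: "\<exists>p. k < \<bar>f (e + p)\<bar>"
proof -
  obtain q where "k < \<bar>f q\<bar>" using unbounded by blast
  then show ?thesis by (intro exI[of _ "q - e"]) simp
qed

lemma G_cong:
  assumes "\<psi> \<in> extensions" "\<theta> \<in> extensions" "t \<in> {A..B}" "null_beyond t R" "\<And>s. s \<le> R \<Longrightarrow> \<theta> s = \<psi> s"
  shows "G \<theta> t = G \<psi> t"
proof -
  have "AE s in \<mu>p t. s \<le> R" "AE s in \<mu>m t. s \<le> R"
    using assms(3,4) sets_mu[of t]
    by (auto intro!: AE_I[of _ _ "{R<..}"] simp: null_beyond_def space_mu)
  then have "(\<integral>s. f (\<theta> s) \<partial>\<mu>p t) = (\<integral>s. f (\<psi> s) \<partial>\<mu>p t)" "(\<integral>s. f (\<theta> s) \<partial>\<mu>m t) = (\<integral>s. f (\<psi> s) \<partial>\<mu>m t)"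
    using int[OF assms(1,3)] int[OF assms(2,3)] assms(5)
    by (auto intro!: integral_cong_AE dest: borel_measurable_integrable)
  then show ?thesis by (simp add: G_def)
qed

text \<open>If all signed tails from R on vanished, the positive and the negative part would agree
  on every half-line beyond R, hence on all Borel sets there. Two mutually singular measures that
  agree are zero.\<close>

lemma tail_nonzero:
  assumes t: "t \<in> {A..B}" and "\<not> null_beyond t R"
  shows "\<exists>r\<ge>R. tail r t \<noteq> 0"
proof (rule ccontr)
  assume "\<not> ?thesis"
  then have z: "tail r t = 0" if "r \<ge> R" for r using that by blast
  interpret p: finite_measure "\<mu>p t" using finite_mu t by blast
  interpret m: finite_measure "\<mu>m t" using finite_mu t by blast
  note [measurable_cong] = sets_mu(1)[OF t] sets_mu(2)[OF t]
  have dens: "emeasure (density M (indicator {R<..})) X = emeasure M ({R<..} \<inter> X)"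
    if "sets M = sets borel" "X \<in> sets borel" for M and X :: "real set"
    using that by (intro emeasure_restricted) auto
  have eq: "density (\<mu>p t) (indicator {R<..}) = density (\<mu>m t) (indicator {R<..})"
  proof (rule measure_eqI_lessThan)
    fix x
    have *: "{R<..} \<inter> {x<..} = {max R x<..}" by auto
    show "emeasure (density (\<mu>p t) (indicator {R<..})) {x<..} < \<infinity>"
      using sets_mu(1)[OF t] by (simp add: dens less_top[symmetric])
    show "emeasure (density (\<mu>p t) (indicator {R<..})) {x<..} = emeasure (density (\<mu>m t) (indicator {R<..})) {x<..}"
      using z[of "max R x"] sets_mu[OF t]
      by (simp add: dens * tail_def p.emeasure_eq_measure m.emeasure_eq_measure)
  qed (auto simp: sets_mu[OF t])
  obtain S where S: "S \<in> sets borel" "emeasure (\<mu>p t) (- S) = 0" "emeasure (\<mu>m t) S = 0"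
    using singular[OF t] by blast
  have e: "emeasure (\<mu>p t) ({R<..} \<inter> X) = emeasure (\<mu>m t) ({R<..} \<inter> X)" if "X \<in> sets borel" for X
    using dens[OF sets_mu(1)[OF t] that] dens[OF sets_mu(2)[OF t] that] eq by simp
  have zero: "emeasure (\<mu>p t) ({R<..} \<inter> S) = 0" "emeasure (\<mu>p t) ({R<..} \<inter> - S) = 0"
    "emeasure (\<mu>m t) ({R<..} \<inter> S) = 0" "emeasure (\<mu>m t) ({R<..} \<inter> - S) = 0"
    using e[of S] e[of "- S"] S sets_mu[OF t]
      emeasure_mono[of "{R<..} \<inter> S" S "\<mu>m t"] emeasure_mono[of "{R<..} \<inter> - S" "- S" "\<mu>p t"]
    by auto
  have "emeasure M {R<..} = 0" if "sets M = sets borel" "emeasure M ({R<..} \<inter> S) = 0" "emeasure M ({R<..} \<inter> - S) = 0" for M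
  proof -
    have "{R<..} = ({R<..} \<inter> S) \<union> ({R<..} \<inter> - S)" by auto
    then show ?thesis
      using emeasure_subadditive[of "{R<..} \<inter> S" M "{R<..} \<inter> - S"] that S(1)
      by (metis add_0 le_zero_eq sets.Int borel_open open_greaterThan sets.compl_sets Compl_eq_Diff_UNIV space_borel)
  qed
  then have "null_beyond t R" using zero sets_mu[OF t] by (simp add: null_beyond_def)
  with assms(2) show False by simp
qed

lemma mu_integral_bound:
  assumes t: "t \<in> {A..B}" and h: "h \<in> borel_measurable borel" "\<And>s. \<bar>h s\<bar> \<le> b"
  shows "integrable (\<mu>p t) h" "integrable (\<mu>m t) h"
    "\<bar>(\<integral>s. h s \<partial>\<mu>p t) - (\<integral>s. h s \<partial>\<mu>m t)\<bar> \<le> 2 * V * b"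
proof -
  have b: "0 \<le> b" using h(2)[of 0] by linarith
  have "integrable M h \<and> \<bar>\<integral>s. h s \<partial>M\<bar> \<le> V * b"
    if M: "sets M = sets borel" "finite_measure M" "measure M UNIV \<le> V" for M
  proof -
    interpret finite_measure M by fact
    have m: "h \<in> borel_measurable M" using h(1) M(1) by (simp cong: measurable_cong_sets)
    have i: "integrable M h" by (rule integrable_const_bound[of _ b]) (use h m in auto)
    have "\<bar>\<integral>s. h s \<partial>M\<bar> \<le> (\<integral>s. \<bar>h s\<bar> \<partial>M)" by (rule integral_abs_bound)
    also have "\<dots> \<le> (\<integral>s. b \<partial>M)" using h i by (intro integral_mono) auto
    also have "\<dots> = measure M UNIV * b" using sets_eq_imp_space_eq[OF M(1)] by simp
    also have "\<dots> \<le> V * b" using M(3) b by (rule mult_right_mono)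
    finally show ?thesis using i by simp
  qed
  from this[OF sets_mu(1)[OF t] finite_mu(1)[OF t] measure_le_V(1)[OF t]]
    this[OF sets_mu(2)[OF t] finite_mu(2)[OF t] measure_le_V(2)[OF t]]
  show "integrable (\<mu>p t) h" "integrable (\<mu>m t) h"
    "\<bar>(\<integral>s. h s \<partial>\<mu>p t) - (\<integral>s. h s \<partial>\<mu>m t)\<bar> \<le> 2 * V * b" by linarith+
qed

section \<open>Response of the history integral to a single bump\<close>

context
  fixes \<psi> :: "real \<Rightarrow> real" and R :: real
  assumes ec: "ext_const \<psi> R"
begin

definition bump :: "real \<Rightarrow> nat \<Rightarrow> real \<Rightarrow> real \<Rightarrow> real" where
  "bump p m r s = \<psi> s + p * ramp m r s"

definition rise :: "real \<Rightarrow> real" where "rise p = f (\<psi> R + p) - f (\<psi> R)"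

lemma psi_ext: "\<psi> \<in> extensions" using ec by (simp add: ext_const_def)

lemma bump_ext_const: "R \<le> r \<Longrightarrow> ext_const (bump p m r) (r + 1)"
  unfolding bump_def[abs_def] using ext_const_ramp(1)[OF ec] by blast

lemma bump_ext: "R \<le> r \<Longrightarrow> bump p m r \<in> extensions"
  using bump_ext_const by (auto simp: ext_const_def)

lemma bump_low: "s \<le> r \<Longrightarrow> bump p m r s = \<psi> s"
  by (simp add: bump_def ramp_zero)

lemma f_bump: assumes "R \<le> r" shows "f (bump p m r s) - f (\<psi> s) = f (\<psi> R + p * ramp m r s) - f (\<psi> R)"
proof (cases "s \<le> r")
  case True then show ?thesis by (simp add: bump_def ramp_zero)
next
  case False
  then have "\<psi> s = \<psi> R" using ext_const_ramp(3)[OF ec assms, of s] by simp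
  then show ?thesis by (simp add: bump_def)
qed

lemma G_bump:
  assumes t: "t \<in> {A..B}" and r: "R \<le> r"
  shows "G (bump p m r) t - G \<psi> t =
    (\<integral>s. f (\<psi> R + p * ramp m r s) - f (\<psi> R) \<partial>\<mu>p t) - (\<integral>s. f (\<psi> R + p * ramp m r s) - f (\<psi> R) \<partial>\<mu>m t)"
proof -
  have "(\<integral>s. f (\<psi> R + p * ramp m r s) - f (\<psi> R) \<partial>\<mu>p t) = (\<integral>s. f (bump p m r s) \<partial>\<mu>p t) - (\<integral>s. f (\<psi> s) \<partial>\<mu>p t)"
    "(\<integral>s. f (\<psi> R + p * ramp m r s) - f (\<psi> R) \<partial>\<mu>m t) = (\<integral>s. f (bump p m r s) \<partial>\<mu>m t) - (\<integral>s. f (\<psi> s) \<partial>\<mu>m t)"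
    using int[OF bump_ext[OF r] t] int[OF psi_ext t] unfolding f_bump[OF r, symmetric]
    by (simp_all add: Bochner_Integration.integral_diff)
  then show ?thesis by (simp add: G_def)
qed

lemma G_bump_bound:
  assumes t: "t \<in> {A..B}" and r: "R \<le> r"
  shows "\<bar>G (bump p m r) t - G \<psi> t\<bar> \<le> 2 * V * (F * \<bar>p\<bar>)"
  unfolding G_bump[OF assms]
  by (rule mu_integral_bound(3)[OF t]) (auto intro!: f_diff_bound ramp_scaled)

text \<open>Dominated convergence, ramps tending to the open tail. The limit splits into a factor
  depending only on the height of the bump and a factor depending only on the measures; the former
  can be made arbitrarily large.\<close>

lemma G_bump_tendsto:
  assumes t: "t \<in> {A..B}" and r: "R \<le> r"
  shows "(\<lambda>m. G (bump p m r) t - G \<psi> t) \<longlonglongrightarrow> rise p * tail r t"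
proof -
  have "(\<lambda>m. \<integral>s. f (\<psi> R + p * ramp m r s) - f (\<psi> R) \<partial>M) \<longlonglongrightarrow> rise p * measure M {r<..}"
    if M: "sets M = sets borel" "finite_measure M" for M
  proof -
    interpret finite_measure M by fact
    note [measurable_cong] = M(1)
    have "(\<lambda>m. \<integral>s. f (\<psi> R + p * ramp m r s) - f (\<psi> R) \<partial>M) \<longlonglongrightarrow> (\<integral>s. rise p * indicator {r<..} s \<partial>M)"
    proof (rule integral_dominated_convergence[where w = "\<lambda>_. F * \<bar>p\<bar>"])
      show "AE s in M. (\<lambda>m. f (\<psi> R + p * ramp m r s) - f (\<psi> R)) \<longlonglongrightarrow> rise p * indicator {r<..} s"
      proof (rule AE_I2)
        fix s
        have "(\<lambda>m. f (\<psi> R + p * ramp m r s) - f (\<psi> R)) \<longlonglongrightarrow> f (\<psi> R + p * indicator {r<..} s) - f (\<psi> R)"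
          using ramp_tendsto[of r s] by (intro tendsto_intros continuous_on_tendsto_compose[OF cont_f]) auto
        also have "f (\<psi> R + p * indicator {r<..} s) - f (\<psi> R) = rise p * indicator {r<..} s"
          by (simp add: rise_def indicator_def)
        finally show "(\<lambda>m. f (\<psi> R + p * ramp m r s) - f (\<psi> R)) \<longlonglongrightarrow> rise p * indicator {r<..} s" .
      qed
      show "AE s in M. norm (f (\<psi> R + p * ramp m r s) - f (\<psi> R)) \<le> F * \<bar>p\<bar>" for m
        by (auto intro!: f_diff_bound ramp_scaled)
    qed auto
    also have "(\<integral>s. rise p * indicator {r<..} s \<partial>M) = rise p * measure M {r<..}" by simp
    finally show ?thesis .
  qed
  from tendsto_diff[OF this[OF sets_mu(1)[OF t] finite_mu(1)[OF t]] this[OF sets_mu(2)[OF t] finite_mu(2)[OF t]]]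
  show ?thesis unfolding G_bump[OF assms] tail_def by (simp add: algebra_simps)
qed

lemma rise_unbounded: "\<exists>p. k < \<bar>rise p\<bar>"
proof -
  obtain p where "k + \<bar>f (\<psi> R)\<bar> < \<bar>f (\<psi> R + p)\<bar>" using unbounded_shift by blast
  then show ?thesis by (intro exI[of _ p]) (simp add: rise_def)
qed

text \<open>The nonzero tail is fixed first; \<open>rise\<close> being unbounded, the height of the
  bump can then beat both k and the value of G before the bump. A steep enough ramp comes close to
  the limit value.\<close>

lemma amplify_at_point:
  assumes t: "t \<in> {A..B}" and nn: "\<not> null_beyond t R"
  shows "\<exists>r\<ge>R. \<exists>p m. k < \<bar>G (bump p m r) t\<bar>"
proof -
  obtain r where r: "r \<ge> R" "tail r t \<noteq> 0" using tail_nonzero[OF t nn] by blast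
  obtain p where p: "(k + \<bar>G \<psi> t\<bar>) / \<bar>tail r t\<bar> < \<bar>rise p\<bar>" using rise_unbounded by blast
  then have "k + \<bar>G \<psi> t\<bar> < \<bar>rise p * tail r t\<bar>" using r by (simp add: abs_mult field_simps)
  from order_tendstoD(1)[OF tendsto_rabs[OF G_bump_tendsto[OF t r(1)]] this]
  obtain m where "k + \<bar>G \<psi> t\<bar> < \<bar>G (bump p m r) t - G \<psi> t\<bar>"
    by (auto simp: eventually_sequentially)
  then have "k < \<bar>G (bump p m r) t\<bar>" by linarith
  then show ?thesis using r by blast
qed

end

lemma G_primitive:
  assumes "\<psi> \<in> extensions"
  obtains W where "\<And>t. t \<in> {A..B} \<Longrightarrow> (W has_real_derivative G \<psi> t) (at t within {A..B})"
  using der[OF assms] unfolding G_def[symmetric] by blast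

text \<open>The integral is the gauge integral: it integrates every derivative, whereas nothing
  makes \<open>G \<psi>\<close> Lebesgue integrable or even measurable in t a priori.\<close>

lemma G_has_integral:
  assumes W: "\<And>t. t \<in> {A..B} \<Longrightarrow> (W has_real_derivative G \<psi> t) (at t within {A..B})"
    and ab: "A \<le> a'" "a' \<le> b'" "b' \<le> B"
  shows "(G \<psi> has_integral (W b' - W a')) {a'..b'}"
proof (rule fundamental_theorem_of_calculus[OF ab(2)])
  fix t assume "t \<in> {a'..b'}"
  then show "(W has_vector_derivative G \<psi> t) (at t within {a'..b'})"
    using W[of t] ab by (auto simp: has_real_derivative_iff_has_vector_derivative
        intro: has_vector_derivative_within_subset)
qed

lemma G_integrable: "\<psi> \<in> extensions \<Longrightarrow> A \<le> a' \<Longrightarrow> a' \<le> b' \<Longrightarrow> b' \<le> B \<Longrightarrow> G \<psi> integrable_on {a'..b'}"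
  using G_primitive[of \<psi>] G_has_integral by (metis integrable_on_def)

text \<open>If every tail had mass, hump k could be placed on a compact set of positive mass, high
  enough to contribute k to the integral of the absolute value of f. The glued function would then
  not be integrable.\<close>

lemma eventually_null:
  assumes M: "sets M = sets borel" "finite_measure M"
    and i: "\<And>\<psi>. \<psi> \<in> extensions \<Longrightarrow> integrable M (\<lambda>s. f (\<psi> s))"
  shows "\<exists>R. emeasure M {R<..} = 0"
proof (rule ccontr)
  interpret finite_measure M by fact
  note [measurable_cong] = M(1)
  assume "\<not> ?thesis"
  then have pos: "emeasure M {R<..} \<noteq> 0" for R by blast
  have "\<exists>\<theta>\<in>extensions. \<forall>k. ennreal (real k) \<le> (\<integral>\<^sup>+ s. ennreal \<bar>f (\<theta> s)\<bar> \<partial>M)"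
  proof (rule gliding_hump)
    fix k :: nat and \<psi> R
    assume ec: "ext_const \<psi> R"
    \<comment> \<open>The left cut at 1 / (n + 1) is where the ramp of slope n + 1 reaches 1, so on
      \<open>E n\<close> the hump has its full height.\<close>
    define E where "E n = {R + 1 / real (Suc n) .. R + real n}" for n
    have "(\<Union>n. E n) = {R<..}"
    proof
      show "(\<Union>n. E n) \<subseteq> {R<..}" 
      proof
        fix s assume "s \<in> (\<Union>n. E n)"
        then obtain n where "R + 1 / real (Suc n) \<le> s" by (auto simp: E_def)
        moreover have "0 < 1 / real (Suc n)" by (rule divide_pos_pos) auto
        ultimately have "R < s" by linarith
        then show "s \<in> {R<..}" by simp
      qed
      show "{R<..} \<subseteq> (\<Union>n. E n)"
      proof
        fix s assume "s \<in> {R<..}"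
        then have sR: "0 < s - R" by simp
        obtain n where n: "real n > max (s - R) (1 / (s - R))" using reals_Archimedean2 by blast
        have "1 / (s - R) \<le> real (Suc n)" using n by simp
        then have "1 / real (Suc n) \<le> s - R" using sR by (simp add: field_simps del: of_nat_Suc)
        then have "s \<in> E n" using n by (simp add: E_def)
        then show "s \<in> (\<Union>n. E n)" by blast
      qed
    qed
    moreover have "E n \<in> sets M" for n by (simp add: E_def M)
    ultimately obtain n where n: "emeasure M (E n) \<noteq> 0"
      using pos[of R] emeasure_UN_eq_0[of M E] by (metis image_subsetI)
    have cpos: "0 < measure M (E n)" using n by (simp add: emeasure_eq_measure measure_nonneg less_le)
    obtain p where p: "real k / measure M (E n) < \<bar>f (\<psi> R + p)\<bar>" using unbounded_shift by blast
    define \<psi>' where "\<psi>' = (\<lambda>s. \<psi> s + p * ramp n R s)"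
    have val: "\<psi>' s = \<psi> R + p" if "s \<in> E n" for s
    proof -
      have "1 / real (Suc n) \<le> s - R" using that by (simp add: E_def)
      then have "1 \<le> real (Suc n) * (s - R)" by (simp add: field_simps del: of_nat_Suc)
      moreover have "R < s" using \<open>1 / real (Suc n) \<le> s - R\<close> by (smt (verit) divide_pos_pos of_nat_0_less_iff zero_less_Suc)
      ultimately show ?thesis using ext_const_ramp(3)[OF ec order_refl, of s]
        by (simp add: \<psi>'_def ramp_def)
    qed
    have big: "ennreal (real k) \<le> (\<integral>\<^sup>+ s. ennreal \<bar>f (\<theta> s)\<bar> \<partial>M)"
      if "\<forall>s\<le>max (R + 1) (R + real n). \<theta> s = \<psi>' s" for \<theta>
    proof -
      have "real k \<le> \<bar>f (\<psi> R + p)\<bar> * measure M (E n)"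
        using p cpos by (simp add: pos_divide_less_eq less_imp_le)
      then have "ennreal (real k) \<le> ennreal \<bar>f (\<psi> R + p)\<bar> * emeasure M (E n)"
        by (simp add: emeasure_eq_measure ennreal_mult[symmetric] measure_nonneg ennreal_leI del: ennreal_of_nat_eq_real_of_nat)
      also have "\<dots> = (\<integral>\<^sup>+ s. ennreal \<bar>f (\<psi> R + p)\<bar> * indicator (E n) s \<partial>M)"
        by (rule nn_integral_cmult_indicator[symmetric]) (simp add: E_def M)
      also have "\<dots> \<le> (\<integral>\<^sup>+ s. ennreal \<bar>f (\<theta> s)\<bar> \<partial>M)"
      proof (rule nn_integral_mono)
        fix s show "ennreal \<bar>f (\<psi> R + p)\<bar> * indicator (E n) s \<le> ennreal \<bar>f (\<theta> s)\<bar>"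
        proof (cases "s \<in> E n")
          case True
          then have "s \<le> max (R + 1) (R + real n)" by (simp add: E_def le_max_iff_disj)
          then have "\<theta> s = \<psi>' s" using that by blast
          then show ?thesis using val[OF True] True by simp
        qed simp
      qed
      finally show ?thesis .
    qed
    show "\<exists>\<psi>' R'. ext_const \<psi>' R' \<and> R + 1 \<le> R' \<and> (\<forall>s\<le>R. \<psi>' s = \<psi> s) \<and>
            (\<forall>\<theta>\<in>extensions. (\<forall>s\<le>R'. \<theta> s = \<psi>' s) \<longrightarrow> ennreal (real k) \<le> (\<integral>\<^sup>+ s. ennreal \<bar>f (\<theta> s)\<bar> \<partial>M))"
    proof (rule exI[of _ \<psi>'], rule exI[of _ "max (R + 1) (R + real n)"], intro conjI)
      show "ext_const \<psi>' (max (R + 1) (R + real n))"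
        unfolding \<psi>'_def by (rule ext_const_mono[OF ext_const_ramp(1)[OF ec order_refl]]) simp
      show "\<forall>s\<le>R. \<psi>' s = \<psi> s" by (simp add: \<psi>'_def ramp_zero)
    qed (use big in auto)
  qed
  then obtain \<theta> where \<theta>: "\<theta> \<in> extensions" "\<And>k. ennreal (real k) \<le> (\<integral>\<^sup>+ s. ennreal \<bar>f (\<theta> s)\<bar> \<partial>M)" by blast
  have "(\<integral>\<^sup>+ s. ennreal \<bar>f (\<theta> s)\<bar> \<partial>M) < \<infinity>"
    using i[OF \<theta>(1)] by (simp add: integrable_iff_bounded)
  then obtain y where y: "(\<integral>\<^sup>+ s. ennreal \<bar>f (\<theta> s)\<bar> \<partial>M) = ennreal y" "0 \<le> y"
    by (metis ennreal_cases infinity_ennreal_def less_irrefl)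
  obtain k where "y < real k" using reals_Archimedean2 by blast
  then show False using \<theta>(2)[of k] y by (simp add: ennreal_le_iff2 del: ennreal_of_nat_eq_real_of_nat)
qed

lemma null_beyond_exists:
  assumes t: "t \<in> {A..B}" shows "\<exists>R. null_beyond t R"
proof -
  obtain R1 where R1: "emeasure (\<mu>p t) {R1<..} = 0"
    using eventually_null[OF sets_mu(1)[OF t] finite_mu(1)[OF t]] int(1) t by blast
  obtain R2 where R2: "emeasure (\<mu>m t) {R2<..} = 0"
    using eventually_null[OF sets_mu(2)[OF t] finite_mu(2)[OF t]] int(2) t by blast
  have "emeasure (\<mu>p t) {max R1 R2<..} \<le> emeasure (\<mu>p t) {R1<..}"
    "emeasure (\<mu>m t) {max R1 R2<..} \<le> emeasure (\<mu>m t) {R2<..}"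
    using t by (auto intro!: emeasure_mono simp: sets_mu)
  then show ?thesis using R1 R2 by (intro exI[of _ "max R1 R2"]) (simp add: null_beyond_def)
qed

text \<open>If all increments of the primitives stayed below k, letting the height p of the bump grow would
  force every tail to integrate to zero; approximating a ramp by a staircase of tails then shows that
  bumps do not change G at all, against the nonvanishing of a tail at t0.\<close>

lemma amplify_on_interval:
  assumes ec: "ext_const \<psi> R" and t0: "t0 \<in> {a..b}" and ab: "A \<le> a" "a < b" "b \<le> B"
    and nn: "\<not> null_beyond t0 R"
  shows "\<exists>r\<ge>R. \<exists>p m a' b'. a \<le> a' \<and> a' \<le> b' \<and> b' \<le> b \<and> k \<le> \<bar>integral {a'..b'} (G (bump \<psi> p m r))\<bar>"
proof (rule ccontr)
  assume "\<not> ?thesis"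
  then have small: "\<bar>integral {a'..b'} (G (bump \<psi> p m r))\<bar> < k"
    if "R \<le> r" "a \<le> a'" "a' \<le> b'" "b' \<le> b" for r p m a' b'
    using that by (meson not_le)
  define H where "H p m r t = G (bump \<psi> p m r) t - G \<psi> t" for p m r t
  have tAB: "t \<in> {A..B}" if "t \<in> {a'..b'}" "a \<le> a'" "b' \<le> b" for t a' b' using that ab by auto
  \<comment> \<open>A bump of height 0 is \<psi> itself, so the assumed bound also covers \<psi>,
    and differences are bounded by 2 * k.\<close>
  have bump0: "bump \<psi> 0 0 R = \<psi>" by (rule ext) (simp add: bump_def[OF ec])
  have G_int: "G (bump \<psi> p m r) integrable_on {a'..b'}" "G \<psi> integrable_on {a'..b'}"
    if "R \<le> r" "a \<le> a'" "a' \<le> b'" "b' \<le> b" for r p m a' b'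
    using G_integrable[OF bump_ext[OF ec that(1)], of a' b'] G_integrable[OF psi_ext[OF ec], of a' b'] that ab by auto
  have H_int: "H p m r integrable_on {a'..b'}" "\<bar>integral {a'..b'} (H p m r)\<bar> \<le> 2 * k"
    if "R \<le> r" "a \<le> a'" "a' \<le> b'" "b' \<le> b" for r p m a' b'
  proof -
    show "H p m r integrable_on {a'..b'}"
      unfolding H_def[abs_def] by (rule Henstock_Kurzweil_Integration.integrable_diff[OF G_int[OF that] ])
    have "integral {a'..b'} (H p m r) = integral {a'..b'} (G (bump \<psi> p m r)) - integral {a'..b'} (G \<psi>)"
      unfolding H_def[abs_def] by (rule Henstock_Kurzweil_Integration.integral_diff[OF G_int[OF that] ])
    then show "\<bar>integral {a'..b'} (H p m r)\<bar> \<le> 2 * k"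
      using small[OF that, of p m] small[OF order_refl that(2-4), of 0 0] unfolding bump0 by linarith
  qed
  have H_bound: "\<bar>H p m r t\<bar> \<le> 2 * V * (F * \<bar>p\<bar>)" if "R \<le> r" "t \<in> {A..B}" for p m r t
    unfolding H_def using G_bump_bound[OF ec that(2,1)] .
  have H_lim: "(\<lambda>m. H p m r t) \<longlonglongrightarrow> rise \<psi> R p * tail r t" if "R \<le> r" "t \<in> {A..B}" for p r t
    unfolding H_def using G_bump_tendsto[OF ec that(2,1)] .
  \<comment> \<open>The dominated limit in m also yields integrability of the tails as functions of
    t, about which the locale says nothing.\<close>
  have rise_tail: "(\<lambda>t. rise \<psi> R p * tail r t) integrable_on {a'..b'}"
     "\<bar>integral {a'..b'} (\<lambda>t. rise \<psi> R p * tail r t)\<bar> \<le> 2 * k"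
    if r: "R \<le> r" "a \<le> a'" "a' \<le> b'" "b' \<le> b" for r p a' b'
  proof -
    have *: "(\<lambda>t. rise \<psi> R p * tail r t) integrable_on {a'..b'} \<and>
      (\<lambda>m. integral {a'..b'} (H p m r)) \<longlonglongrightarrow> integral {a'..b'} (\<lambda>t. rise \<psi> R p * tail r t)"
      using dominated_convergence[of "\<lambda>m. H p m r" "{a'..b'}" "\<lambda>_. 2 * V * (F * \<bar>p\<bar>)" "\<lambda>t. rise \<psi> R p * tail r t"]
        H_int(1)[OF r] H_bound[OF r(1)] H_lim[OF r(1)] tAB[OF _ r(2,4)] by auto
    then show "(\<lambda>t. rise \<psi> R p * tail r t) integrable_on {a'..b'}" by blast
    show "\<bar>integral {a'..b'} (\<lambda>t. rise \<psi> R p * tail r t)\<bar> \<le> 2 * k"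
      by (rule LIMSEQ_le_const2[OF tendsto_rabs[OF conjunct2[OF *]]]) (use H_int(2)[OF r] in auto)
  qed
  have tail_int: "(tail r has_integral 0) {a'..b'}"
    if r: "R \<le> r" "a \<le> a'" "a' \<le> b'" "b' \<le> b" for r a' b'
  proof -
    obtain p where p: "0 < \<bar>rise \<psi> R p\<bar>" using rise_unbounded[OF ec] by blast
    have "(\<lambda>t. inverse (rise \<psi> R p) * (rise \<psi> R p * tail r t)) integrable_on {a'..b'}"
      by (intro integrable_on_mult_right rise_tail r)
    then have i: "tail r integrable_on {a'..b'}" using p by (simp add: mult.assoc[symmetric])
    have "integral {a'..b'} (tail r) = 0"
    proof (rule ccontr)
      assume nz: "integral {a'..b'} (tail r) \<noteq> 0"
      \<comment> \<open>The bound 2 * k does not depend on the height of the bump, but the left side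
        grows with \<open>rise\<close>.\<close>
      obtain q where q: "2 * k / \<bar>integral {a'..b'} (tail r)\<bar> < \<bar>rise \<psi> R q\<bar>" using rise_unbounded[OF ec] by blast
      have "integral {a'..b'} (\<lambda>t. rise \<psi> R q * tail r t) = rise \<psi> R q * integral {a'..b'} (tail r)"
        by simp
      with rise_tail(2)[OF r, of q] q nz show False
        by (simp add: abs_mult pos_divide_less_eq)
    qed
    then show ?thesis using i by (simp add: has_integral_integral)
  qed
  have H0: "integral {a'..b'} (H p m r) = 0" if r: "R \<le> r" "a \<le> a'" "a' \<le> b'" "b' \<le> b" for p m r a' b'
  proof -
    define \<Psi> where "\<Psi> x = f (\<psi> R + p * x)" for x
    have lipP: "\<bar>\<Psi> x - \<Psi> y\<bar> \<le> (F * \<bar>p\<bar>) * \<bar>x - y\<bar>" for x y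
    proof -
      have "\<bar>\<Psi> x - \<Psi> y\<bar> \<le> F * \<bar>(\<psi> R + p * x) - (\<psi> R + p * y)\<bar>" unfolding \<Psi>_def by (rule lip)
      also have "(\<psi> R + p * x) - (\<psi> R + p * y) = p * (x - y)" by (simp add: algebra_simps)
      finally show ?thesis by (simp add: abs_mult mult.assoc)
    qed
    have K: "0 \<le> F * \<bar>p\<bar>" using F_nonneg by simp
    have est: "\<bar>integral {a'..b'} (H p m r)\<bar> \<le> 2 * V * (F * \<bar>p\<bar>) * (b' - a') * inverse (real (Suc n'))" for n'
    proof -
      define n where "n = Suc n'"
      have n: "0 < n" by (simp add: n_def)
      define co where "co l = \<Psi> (real (Suc l) / real n) - \<Psi> (real l / real n)" for l
      define rr where "rr l = r + real l / (real (Suc m) * real n)" for l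
      have rr: "R \<le> rr l" for l using r(1) by (simp add: rr_def add_increasing2)
      define st where "st s = (\<Sum>l<n. co l * indicator {rr l<..} s)" for s
      have stair: "\<bar>\<Psi> (ramp m r s) - \<Psi> 0 - st s\<bar> \<le> (F * \<bar>p\<bar>) / real n" for s
        unfolding st_def co_def rr_def by (rule ramp_staircase[OF lipP n K])
      define S where "S t = (\<Sum>l<n. co l * tail (rr l) t)" for t
      \<comment> \<open>A finite combination of tails has integral 0, and the staircase makes it
        uniformly close to the increment caused by the bump.\<close>
      have Sint: "(S has_integral (\<Sum>l<n. co l * 0)) {a'..b'}"
        unfolding S_def by (intro has_integral_sum has_integral_mult_right tail_int rr r) simp
      have pt: "\<bar>H p m r t - S t\<bar> \<le> 2 * V * (F * \<bar>p\<bar>) * inverse (real n)" if t: "t \<in> {a'..b'}" for t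
      proof -
        note tt = tAB[OF t r(2,4)]
        have st_M: "(\<integral>s. st s \<partial>M) = (\<Sum>l<n. co l * measure M {rr l<..}) \<and> integrable M st"
          if M: "sets M = sets borel" "finite_measure M" for M
        proof -
          interpret finite_measure M by fact
          note [measurable_cong] = M(1)
          have i: "integrable M (\<lambda>s. co l * indicator {rr l<..} s :: real)" for l
            by (intro integrable_mult_right integrable_indicator) (auto simp: M(1) less_top[symmetric])
          have "(\<integral>s. st s \<partial>M) = (\<Sum>l<n. \<integral>s. co l * indicator {rr l<..} s \<partial>M)"
            unfolding st_def by (rule Bochner_Integration.integral_sum) (rule i)
          also have "\<dots> = (\<Sum>l<n. co l * measure M {rr l<..})" by simp
          finally have "(\<integral>s. st s \<partial>M) = (\<Sum>l<n. co l * measure M {rr l<..})" .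
          moreover have "integrable M st"
            unfolding st_def[abs_def] by (intro Bochner_Integration.integrable_sum i)
          ultimately show ?thesis by blast
        qed
        have Psi_borel: "(\<lambda>s. \<Psi> (ramp m r s) - \<Psi> 0) \<in> borel_measurable borel"
          unfolding \<Psi>_def using borel_f borel_ramp by measurable
        have st_borel: "st \<in> borel_measurable borel"
          unfolding st_def[abs_def] by measurable
        have "\<bar>\<Psi> (ramp m r s) - \<Psi> 0\<bar> \<le> F * \<bar>p\<bar>" for s
          unfolding \<Psi>_def using f_diff_bound[OF ramp_scaled[of p m r s], of "\<psi> R"] by simp
        note ib = mu_integral_bound(1,2)[OF tt Psi_borel this]
        have "H p m r t - S t = (\<integral>s. (\<Psi> (ramp m r s) - \<Psi> 0) - st s \<partial>\<mu>p t) - (\<integral>s. (\<Psi> (ramp m r s) - \<Psi> 0) - st s \<partial>\<mu>m t)"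
          using G_bump[OF ec tt r(1), of p m] ib st_M[OF sets_mu(1)[OF tt] finite_mu(1)[OF tt]] st_M[OF sets_mu(2)[OF tt] finite_mu(2)[OF tt]]
          by (simp add: H_def S_def tail_def \<Psi>_def Bochner_Integration.integral_diff right_diff_distrib sum_subtractf)
        moreover have "\<bar>(\<integral>s. (\<Psi> (ramp m r s) - \<Psi> 0) - st s \<partial>\<mu>p t) - (\<integral>s. (\<Psi> (ramp m r s) - \<Psi> 0) - st s \<partial>\<mu>m t)\<bar>
            \<le> 2 * V * ((F * \<bar>p\<bar>) / real n)"
          by (rule mu_integral_bound(3)[OF tt _ stair]) (intro borel_measurable_diff Psi_borel st_borel)
        ultimately show ?thesis by (simp add: divide_inverse mult.assoc)
      qed
      have "((\<lambda>t. H p m r t - S t) has_integral (integral {a'..b'} (H p m r) - 0)) (cbox a' b')"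
        using has_integral_diff[OF integrable_integral[OF H_int(1)[OF r]] Sint] by simp
      then have "norm (integral {a'..b'} (H p m r) - 0) \<le> 2 * V * (F * \<bar>p\<bar>) * inverse (real n) * measure lborel (cbox a' b')"
        by (rule has_integral_bound[rotated]) (use pt V K in auto)
      then show ?thesis using r(3) by (simp add: n_def algebra_simps)
    qed
    have "(\<lambda>n'. 2 * V * (F * \<bar>p\<bar>) * (b' - a') * inverse (real (Suc n'))) \<longlonglongrightarrow> 2 * V * (F * \<bar>p\<bar>) * (b' - a') * 0"
      by (intro tendsto_mult tendsto_const LIMSEQ_inverse_real_of_nat)
    from LIMSEQ_le_const[OF this, of "\<bar>integral {a'..b'} (H p m r)\<bar>"] est show ?thesis by auto
  qed
  \<comment> \<open>Vanishing integrals alone would say nothing about the single point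
    \<open>t0\<close>. But H is the derivative of Z, and Z is constant on the interval, so H
    vanishes at \<open>t0\<close> exactly.\<close>
  have Hz: "H p m r t0 = 0" if r: "R \<le> r" for p m r
  proof -
    obtain W1 where W1: "\<And>t. t \<in> {A..B} \<Longrightarrow> (W1 has_real_derivative G (bump \<psi> p m r) t) (at t within {A..B})"
      using G_primitive[OF bump_ext[OF ec r]] by blast
    obtain W0 where W0: "\<And>t. t \<in> {A..B} \<Longrightarrow> (W0 has_real_derivative G \<psi> t) (at t within {A..B})"
      using G_primitive[OF psi_ext[OF ec]] by blast
    define Z where "Z t = W1 t - W0 t" for t
    have "(Z has_real_derivative H p m r t0) (at t0 within {A..B})"
      unfolding Z_def H_def using t0 ab by (intro derivative_intros W1 W0) auto
    then have d1: "(Z has_real_derivative H p m r t0) (at t0 within {a..b})"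
      by (rule DERIV_subset) (use ab in auto)
    have Zc: "Z t = Z a" if t: "t \<in> {a..b}" for t
    proof -
      have "(G (bump \<psi> p m r) has_integral (W1 t - W1 a)) {a..t}" "(G \<psi> has_integral (W0 t - W0 a)) {a..t}"
        using t ab by (auto intro!: G_has_integral W1 W0)
      from has_integral_diff[OF this] have "(H p m r has_integral (Z t - Z a)) {a..t}"
        by (simp add: H_def[abs_def] Z_def algebra_simps)
      then have "Z t - Z a = integral {a..t} (H p m r)" by (simp add: integral_unique)
      also have "\<dots> = 0" using t by (intro H0 r) auto
      finally show ?thesis by simp
    qed
    have d2: "(Z has_real_derivative 0) (at t0 within {a..b})"
    proof (rule has_field_derivative_transform_within[OF DERIV_const zero_less_one t0])
      show "Z a = Z x" if "x \<in> {a..b}" "dist x t0 < 1" for x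
        by (rule Zc[OF that(1), symmetric])
    qed
    have "at t0 within {a..b} \<noteq> bot"
      using t0 ab by (simp add: trivial_limit_within islimpt_Icc)
    from has_field_derivative_unique[OF d1 d2 this] show ?thesis .
  qed
  obtain r where r: "R \<le> r" "tail r t0 \<noteq> 0" using tail_nonzero[OF tAB[OF t0 order_refl order_refl] nn] by blast
  obtain p where p: "0 < \<bar>rise \<psi> R p\<bar>" using rise_unbounded[OF ec] by blast
  have "(\<lambda>m. H p m r t0) \<longlonglongrightarrow> rise \<psi> R p * tail r t0"
    by (rule H_lim[OF r(1) tAB[OF t0 order_refl order_refl]])
  then have "rise \<psi> R p * tail r t0 = 0" using Hz[OF r(1)] by (simp add: LIMSEQ_const_iff)
  then show False using p r by simp
qed

text \<open>A time t is good if one R serves a whole neighbourhood of it; one bound then serves all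
  good times. Otherwise there are good times whose supports reach beyond any R. Hump k is placed
  near such a time so that a primitive gains k there; the local bound hides later humps from these
  times. The glued function would have a primitive that is unbounded on a compact interval.\<close>

lemma uniformly_null_beyond_off_bad_set:
  shows "\<exists>R1. \<forall>t\<in>{A..B}. (\<exists>\<delta>>0. \<exists>R. \<forall>t'\<in>{A..B}. \<bar>t' - t\<bar> < \<delta> \<longrightarrow> null_beyond t' R) \<longrightarrow> null_beyond t R1"
proof (rule ccontr)
  assume "\<not> ?thesis"
  then have bad: "\<exists>t\<in>{A..B}. (\<exists>\<delta>>0. \<exists>R1. \<forall>t'\<in>{A..B}. \<bar>t' - t\<bar> < \<delta> \<longrightarrow> null_beyond t' R1) \<and> \<not> null_beyond t R" for R
    by blast
  have "\<exists>\<theta>\<in>extensions. \<forall>k. \<exists>a' b'. A \<le> a' \<and> a' \<le> b' \<and> b' \<le> B \<and> real k \<le> \<bar>integral {a'..b'} (G \<theta>)\<bar>"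
  proof (rule gliding_hump)
    fix k :: nat and \<psi> R
    assume ec: "ext_const \<psi> R"
    obtain t0 \<delta> R1 where t0: "t0 \<in> {A..B}" "\<not> null_beyond t0 R" and \<delta>: "\<delta> > 0"
      and R1: "\<And>t'. t' \<in> {A..B} \<Longrightarrow> \<bar>t' - t0\<bar> < \<delta> \<Longrightarrow> null_beyond t' R1" using bad[of R] by blast
    define a where "a = max A (t0 - \<delta> / 2)"
    define b where "b = min B (t0 + \<delta> / 2)"
    have ab: "A \<le> a" "a < b" "b \<le> B" "t0 \<in> {a..b}"
      using t0 \<delta> AB by (auto simp: a_def b_def)
    have near: "null_beyond t' R1" if "t' \<in> {a..b}" for t'
      using that \<delta> by (intro R1) (auto simp: a_def b_def abs_less_iff)
    obtain r p m a' b' where r: "R \<le> r" and ab': "a \<le> a'" "a' \<le> b'" "b' \<le> b"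
      and big: "real k \<le> \<bar>integral {a'..b'} (G (bump \<psi> p m r))\<bar>"
      using amplify_on_interval[OF ec ab(4,1,2,3) t0(2), of "real k"] by blast
    \<comment> \<open>Beyond \<open>R1\<close> the measures vanish for all times of the subinterval,
      so freezing the function up to R' freezes the integral.\<close>
    define R' where "R' = max R1 (r + 1)"
    have "\<exists>a' b'. A \<le> a' \<and> a' \<le> b' \<and> b' \<le> B \<and> real k \<le> \<bar>integral {a'..b'} (G \<theta>)\<bar>"
      if \<theta>: "\<theta> \<in> extensions" "\<forall>s\<le>R'. \<theta> s = bump \<psi> p m r s" for \<theta>
    proof -
      have "G \<theta> t = G (bump \<psi> p m r) t" if t: "t \<in> {a'..b'}" for t
      proof (rule G_cong[OF bump_ext[OF ec r] \<theta>(1)])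
        show "t \<in> {A..B}" using t ab ab' by auto
        show "null_beyond t R1" using t ab' by (intro near) auto
        show "\<theta> s = bump \<psi> p m r s" if "s \<le> R1" for s using \<theta>(2) that by (simp add: R'_def)
      qed
      then have "integral {a'..b'} (G \<theta>) = integral {a'..b'} (G (bump \<psi> p m r))"
        by (intro Henstock_Kurzweil_Integration.integral_cong) auto
      then show ?thesis using big ab ab' by (intro exI[of _ a'] exI[of _ b']) auto
    qed
    then show "\<exists>\<psi>' R'. ext_const \<psi>' R' \<and> R + 1 \<le> R' \<and> (\<forall>s\<le>R. \<psi>' s = \<psi> s) \<and>
        (\<forall>\<theta>\<in>extensions. (\<forall>s\<le>R'. \<theta> s = \<psi>' s) \<longrightarrow>
          (\<exists>a' b'. A \<le> a' \<and> a' \<le> b' \<and> b' \<le> B \<and> real k \<le> \<bar>integral {a'..b'} (G \<theta>)\<bar>))"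
      using ext_const_mono[OF bump_ext_const[OF ec r, of p m], of R'] bump_low[OF ec, of _ r p m] r
      by (intro exI[of _ "bump \<psi> p m r"] exI[of _ R']) (auto simp: R'_def)
  qed
  then obtain \<theta> where \<theta>: "\<theta> \<in> extensions"
    and big: "\<And>k. \<exists>a' b'. A \<le> a' \<and> a' \<le> b' \<and> b' \<le> B \<and> real k \<le> \<bar>integral {a'..b'} (G \<theta>)\<bar>" by blast
  obtain W where W: "\<And>t. t \<in> {A..B} \<Longrightarrow> (W has_real_derivative G \<theta> t) (at t within {A..B})"
    using G_primitive[OF \<theta>] by blast
  then have "continuous_on {A..B} W"
    by (meson continuous_on_eq_continuous_within DERIV_continuous)
  then have "bounded (W ` {A..B})" by (intro compact_imp_bounded compact_continuous_image) auto
  then obtain C where "\<forall>t\<in>{A..B}. \<bar>W t\<bar> \<le> C" unfolding bounded_iff by auto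
  then have C: "\<And>t. t \<in> {A..B} \<Longrightarrow> \<bar>W t\<bar> \<le> C" by blast
  obtain k :: nat where k: "2 * C < real k" using reals_Archimedean2 by blast
  obtain a' b' where ab: "A \<le> a'" "a' \<le> b'" "b' \<le> B" "real k \<le> \<bar>integral {a'..b'} (G \<theta>)\<bar>" using big by blast
  have "integral {a'..b'} (G \<theta>) = W b' - W a'"
    by (rule integral_unique[OF G_has_integral[OF W ab(1-3)]])
  then show False using ab k C[of a'] C[of b'] by auto
qed

text \<open>Points near which the supports are not uniformly bounded form a closed set; by the previous lemma
  the supports are unbounded on every portion of it.  A gliding hump then makes the derivative
  unbounded on every portion, against Baire's theorem.\<close>

theorem uniformly_null_beyond: "\<exists>R. \<forall>t\<in>{A..B}. null_beyond t R"
proof -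
  define good where "good t \<longleftrightarrow> (\<exists>\<delta>>0. \<exists>R. \<forall>t'\<in>{A..B}. \<bar>t' - t\<bar> < \<delta> \<longrightarrow> null_beyond t' R)" for t
  obtain R1 where R1: "\<And>t. t \<in> {A..B} \<Longrightarrow> good t \<Longrightarrow> null_beyond t R1"
    using uniformly_null_beyond_off_bad_set unfolding good_def by blast
  define P where "P = {t \<in> {A..B}. \<not> good t}"
  have "P = {}"
  proof (rule ccontr)
    assume ne: "P \<noteq> {}"
    have "open {t. good t}"
      unfolding open_dist
    proof (intro ballI)
      fix t assume "t \<in> {t. good t}"
      then obtain \<delta> R where \<delta>: "\<delta> > 0" "\<And>t'. t' \<in> {A..B} \<Longrightarrow> \<bar>t' - t\<bar> < \<delta> \<Longrightarrow> null_beyond t' R"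
        unfolding good_def by blast
      have "good y" if y: "dist y t < \<delta> / 2" for y
      proof -
        have "null_beyond t' R" if "t' \<in> {A..B}" "\<bar>t' - y\<bar> < \<delta> / 2" for t'
        proof (rule \<delta>(2)[OF that(1)])
          show "\<bar>t' - t\<bar> < \<delta>" using that(2) y unfolding dist_real_def by linarith
        qed
        then show ?thesis unfolding good_def using \<delta>(1) half_gt_zero by blast
      qed
      then show "\<exists>e>0. \<forall>y. dist y t < e \<longrightarrow> y \<in> {t. good t}" using \<delta>(1) by (intro exI[of _ "\<delta> / 2"]) auto
    qed
    then have "closed ({A..B} - {t. good t})" by (intro closed_Diff closed_atLeastAtMost)
    then have clP: "closed P" by (simp add: P_def set_diff_eq)
    \<comment> \<open>A countable base reduces all portions of P to countably many. The index k
      encodes a basic set together with a size, so each portion is revisited with every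
      size.\<close>
    obtain \<B> :: "nat \<Rightarrow> real set" where B: "\<And>n. open (\<B> n)" "\<And>S. open S \<Longrightarrow> \<exists>k. S = \<Union>{\<B> n |n. n \<in> k}"
      by (rule univ_second_countable_sequence) blast
    have "\<exists>\<theta>\<in>extensions. \<forall>k. \<B> (fst (prod_decode k)) \<inter> P \<noteq> {} \<longrightarrow>
      (\<exists>t\<in>\<B> (fst (prod_decode k)) \<inter> P. real (snd (prod_decode k)) < \<bar>G \<theta> t\<bar>)"
    proof (rule gliding_hump)
      fix k :: nat and \<psi> R
      assume ec: "ext_const \<psi> R"
      define N q where "N = \<B> (fst (prod_decode k))" and "q = snd (prod_decode k)"
      show "\<exists>\<psi>' R'. ext_const \<psi>' R' \<and> R + 1 \<le> R' \<and> (\<forall>s\<le>R. \<psi>' s = \<psi> s) \<and>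
        (\<forall>\<theta>\<in>extensions. (\<forall>s\<le>R'. \<theta> s = \<psi>' s) \<longrightarrow>
          (\<B> (fst (prod_decode k)) \<inter> P \<noteq> {} \<longrightarrow> (\<exists>t\<in>\<B> (fst (prod_decode k)) \<inter> P. real (snd (prod_decode k)) < \<bar>G \<theta> t\<bar>)))"
        unfolding N_def[symmetric] q_def[symmetric]
      proof (cases "N \<inter> P = {}")
        case True
        then show "\<exists>\<psi>' R'. ext_const \<psi>' R' \<and> R + 1 \<le> R' \<and> (\<forall>s\<le>R. \<psi>' s = \<psi> s) \<and>
          (\<forall>\<theta>\<in>extensions. (\<forall>s\<le>R'. \<theta> s = \<psi>' s) \<longrightarrow> (N \<inter> P \<noteq> {} \<longrightarrow> (\<exists>t\<in>N \<inter> P. real q < \<bar>G \<theta> t\<bar>)))"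
          using ext_const_mono[OF ec, of "R + 1"] by (intro exI[of _ \<psi>] exI[of _ "R + 1"] conjI) simp_all
      next
        case False
        then obtain t1 where t1: "t1 \<in> N" "t1 \<in> P" by blast
        have "open N" using B(1) by (simp add: N_def)
        then obtain \<delta> where \<delta>: "\<delta> > 0" "\<And>y. \<bar>y - t1\<bar> < \<delta> \<Longrightarrow> y \<in> N"
          using t1(1) unfolding open_dist dist_real_def by metis
        have "\<not> good t1" using t1 by (simp add: P_def)
        \<comment> \<open>Support beyond \<open>R1\<close> forces t into P, support beyond R leaves
          room for the next hump; hence the maximum of both.\<close>
        then obtain t where t: "t \<in> {A..B}" "\<bar>t - t1\<bar> < \<delta>" "\<not> null_beyond t (max R R1)"
          unfolding good_def using \<delta>(1) by blast
        have "\<not> null_beyond t R1" "\<not> null_beyond t R"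
          using t null_beyond_mono[OF t(1), of R1 "max R R1"] null_beyond_mono[OF t(1), of R "max R R1"] by auto
        then have tP: "t \<in> N \<inter> P" using R1[OF t(1)] t \<delta>(2) by (auto simp: P_def)
        obtain r p m where r: "R \<le> r" and big: "real q < \<bar>G (bump \<psi> p m r) t\<bar>"
          using amplify_at_point[OF ec t(1) \<open>\<not> null_beyond t R\<close>, of "real q"] by blast
        obtain R2 where R2: "null_beyond t R2" using null_beyond_exists[OF t(1)] by blast
        define R' where "R' = max R2 (r + 1)"
        have "G \<theta> t = G (bump \<psi> p m r) t" if "\<theta> \<in> extensions" "\<forall>s\<le>R'. \<theta> s = bump \<psi> p m r s" for \<theta>
          by (rule G_cong[OF bump_ext[OF ec r] that(1) t(1) R2]) (use that(2) in \<open>simp add: R'_def\<close>)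
        then show "\<exists>\<psi>' R'. ext_const \<psi>' R' \<and> R + 1 \<le> R' \<and> (\<forall>s\<le>R. \<psi>' s = \<psi> s) \<and>
          (\<forall>\<theta>\<in>extensions. (\<forall>s\<le>R'. \<theta> s = \<psi>' s) \<longrightarrow> (N \<inter> P \<noteq> {} \<longrightarrow> (\<exists>t\<in>N \<inter> P. real q < \<bar>G \<theta> t\<bar>)))"
          using ext_const_mono[OF bump_ext_const[OF ec r, of p m], of R'] bump_low[OF ec, of _ r p m] r big tP
          by (intro exI[of _ "bump \<psi> p m r"] exI[of _ R']) (force simp: R'_def)
      qed
    qed
    then obtain \<theta> where \<theta>: "\<theta> \<in> extensions"
      and big: "\<And>k. \<B> (fst (prod_decode k)) \<inter> P \<noteq> {} \<Longrightarrow>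
         \<exists>t\<in>\<B> (fst (prod_decode k)) \<inter> P. real (snd (prod_decode k)) < \<bar>G \<theta> t\<bar>" by blast
    obtain W where W: "\<And>t. t \<in> {A..B} \<Longrightarrow> (W has_real_derivative G \<theta> t) (at t within {A..B})"
      using G_primitive[OF \<theta>] by blast
    have "P \<subseteq> {A..B}" by (auto simp: P_def)
    from derivative_bounded_on_portion[OF W clP ne this AB] obtain U c'
      where U: "open U" "U \<inter> P \<noteq> {}" "\<And>t. t \<in> U \<inter> P \<Longrightarrow> \<bar>G \<theta> t\<bar> \<le> c'" by blast
    obtain K where "U = \<Union>{\<B> n |n. n \<in> K}" using B(2)[OF U(1)] by blast
    then obtain n where n: "\<B> n \<subseteq> U" "\<B> n \<inter> P \<noteq> {}" using U(2) by blast
    obtain q :: nat where q: "c' < real q" using reals_Archimedean2 by blast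
    from big[of "prod_encode (n, q)"] n obtain t where "t \<in> \<B> n \<inter> P" "real q < \<bar>G \<theta> t\<bar>" by auto
    then show False using U(3)[of t] n q by auto
  qed
  then have "good t" if "t \<in> {A..B}" for t using that by (auto simp: P_def)
  then show ?thesis using R1 by blast
qed

end

section \<open>A priori bounds for the delay system\<close>

text \<open>The lower bound is an attained value, so pointwise positivity turns into a positive
  constant; this is how the delays get a uniform lower bound.\<close>

lemma periodic_bounds:
  fixes h :: "real \<Rightarrow> real"
  assumes \<omega>: "\<omega> > 0" and c: "continuous_on {0..} h" and p: "\<And>t. 0 \<le> t \<Longrightarrow> h (t + \<omega>) = h t"
  shows "\<exists>l\<ge>0. \<exists>b. (\<forall>t\<ge>0. h l \<le> h t \<and> \<bar>h t\<bar> \<le> b)"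
proof -
  have k: "h (t + real k * \<omega>) = h t" if "0 \<le> t" for t k
  proof (induction k)
    case (Suc k)
    have "t + real (Suc k) * \<omega> = (t + real k * \<omega>) + \<omega>" by (simp add: algebra_simps)
    moreover have "0 \<le> t + real k * \<omega>" using that \<omega> by simp
    ultimately show ?case using p[of "t + real k * \<omega>"] Suc by (metis (no_types))
  qed simp
  have c': "continuous_on {0..\<omega>} h" using c by (rule continuous_on_subset) auto
  obtain l where l: "l \<in> {0..\<omega>}" "\<And>t. t \<in> {0..\<omega>} \<Longrightarrow> h l \<le> h t"
    using continuous_attains_inf[OF compact_Icc _ c'] \<omega> by auto
  have "bounded (h ` {0..\<omega>})" by (intro compact_imp_bounded compact_continuous_image c' compact_Icc)
  then obtain b where "\<forall>t\<in>{0..\<omega>}. \<bar>h t\<bar> \<le> b" unfolding bounded_iff by auto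
  then have b: "\<And>t. t \<in> {0..\<omega>} \<Longrightarrow> \<bar>h t\<bar> \<le> b" by blast
  have "h l \<le> h t \<and> \<bar>h t\<bar> \<le> b" if t: "0 \<le> t" for t
  proof -
    define k where "k = nat \<lfloor>t / \<omega>\<rfloor>"
    have "real k = of_int \<lfloor>t / \<omega>\<rfloor>" using t \<omega> by (simp add: k_def)
    then have "real k \<le> t / \<omega>" "t / \<omega> < real k + 1" by linarith+
    then have "real k * \<omega> \<le> t" "t < real k * \<omega> + \<omega>" using \<omega> by (simp_all add: field_simps)
    then have "t - real k * \<omega> \<in> {0..\<omega>}" by auto
    moreover have "h t = h (t - real k * \<omega>)" using k[of "t - real k * \<omega>" k] \<open>real k * \<omega> \<le> t\<close> by simp
    ultimately show ?thesis using l(2) b by metis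
  qed
  then show ?thesis using l(1) by auto
qed

text \<open>Outward slope at a crossing: the damping term keeps its sign while the coupling terms
  enter through absolute values.\<close>

lemma sgn_affine_bound:
  fixes P Q p q :: "'n::finite \<Rightarrow> real"
  assumes "\<And>j. \<bar>P j\<bar> \<le> p j" "\<And>j. \<bar>Q j\<bar> \<le> q j"
  shows "sgn y * (- \<delta> * y + (\<Sum>j\<in>UNIV. P j) + (\<Sum>j\<in>UNIV. Q j) + J)
     \<le> - \<delta> * \<bar>y\<bar> + (\<Sum>j\<in>UNIV. p j) + (\<Sum>j\<in>UNIV. q j) + \<bar>J\<bar>"
proof -
  have s: "sgn y * X \<le> \<bar>X\<bar>" for X by (auto simp: sgn_if)
  have "\<bar>\<Sum>j\<in>UNIV. P j\<bar> \<le> (\<Sum>j\<in>UNIV. p j)" "\<bar>\<Sum>j\<in>UNIV. Q j\<bar> \<le> (\<Sum>j\<in>UNIV. q j)"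
    using assms by (auto intro!: order_trans[OF sum_abs] sum_mono)
  moreover have "sgn y * (- \<delta> * y) = - \<delta> * \<bar>y\<bar>" by (simp add: abs_sgn mult_ac)
  ultimately show ?thesis
    using s[of "\<Sum>j\<in>UNIV. P j"] s[of "\<Sum>j\<in>UNIV. Q j"] s[of J] unfolding distrib_left by linarith
qed

lemma signed_integral_bound:
  fixes h b :: "real \<Rightarrow> real"
  assumes "integrable M h" "integrable N h" "integrable M b" "integrable N b"
    and "AE s in M. \<bar>h s\<bar> \<le> b s" "AE s in N. \<bar>h s\<bar> \<le> b s"
  shows "\<bar>(\<integral>s. h s \<partial>M) - (\<integral>s. h s \<partial>N)\<bar> \<le> (\<integral>s. b s \<partial>M) + (\<integral>s. b s \<partial>N)"
proof -
  have "\<bar>\<integral>s. h s \<partial>L\<bar> \<le> (\<integral>s. b s \<partial>L)" if L: "integrable L h" "integrable L b" "AE s in L. \<bar>h s\<bar> \<le> b s" for L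
  proof -
    have "\<bar>\<integral>s. h s \<partial>L\<bar> \<le> (\<integral>s. \<bar>h s\<bar> \<partial>L)" by (rule integral_abs_bound)
    also have "\<dots> \<le> (\<integral>s. b s \<partial>L)" using L by (intro integral_mono_AE) auto
    finally show ?thesis .
  qed
  from this[of M] this[of N] assms show ?thesis by linarith
qed

lemma tv_int_exp:
  assumes fin: "tv_int Kp Km (\<lambda>s. exp (\<alpha> * s)) < \<infinity>" and LS: "LS_signed Kp Km"
  shows "integrable Kp (\<lambda>s. exp (\<alpha> * s))" "integrable Km (\<lambda>s. exp (\<alpha> * s))"
    "enn2real (tv_int Kp Km (\<lambda>s. exp (\<alpha> * s))) = (\<integral>s. exp (\<alpha> * s) \<partial>Kp) + (\<integral>s. exp (\<alpha> * s) \<partial>Km)"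
proof -
  have sets: "sets Kp = sets borel" "sets Km = sets borel" using LS by (auto simp: LS_signed_def)
  have m: "(\<lambda>s. exp (\<alpha> * s)) \<in> borel_measurable M" if "sets M = sets borel" for M
    using that by (subst measurable_cong_sets[OF that refl]) measurable
  have lt: "(\<integral>\<^sup>+ s. ennreal (exp (\<alpha> * s)) \<partial>Kp) < \<infinity>" "(\<integral>\<^sup>+ s. ennreal (exp (\<alpha> * s)) \<partial>Km) < \<infinity>"
    using fin by (auto simp: tv_int_def)
  show i: "integrable Kp (\<lambda>s. exp (\<alpha> * s))" "integrable Km (\<lambda>s. exp (\<alpha> * s))"
    using lt m sets by (auto simp: integrable_iff_bounded)
  show "enn2real (tv_int Kp Km (\<lambda>s. exp (\<alpha> * s))) = (\<integral>s. exp (\<alpha> * s) \<partial>Kp) + (\<integral>s. exp (\<alpha> * s) \<partial>Km)"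
    unfolding tv_int_def using i by (simp add: nn_integral_eq_integral enn2real_plus)
qed

locale delay_system =
  fixes \<omega> \<eta> :: real
    and d I :: "'n::finite \<Rightarrow> real \<Rightarrow> real"
    and a tau :: "'n \<Rightarrow> 'n \<Rightarrow> real \<Rightarrow> real"
    and Kp Km :: "'n \<Rightarrow> 'n \<Rightarrow> real \<Rightarrow> real measure"
    and g f :: "'n \<Rightarrow> real \<Rightarrow> real"
    and G F C D \<xi> :: "'n \<Rightarrow> real"
  assumes omega_pos: "\<omega> > 0"
    and cont_d: "\<forall>i. continuous_on {0..} (d i)"
    and cont_I: "\<forall>i. continuous_on {0..} (I i)"
    and cont_a: "\<forall>i j. continuous_on {0..} (a i j)"
    and cont_tau: "\<forall>i j. continuous_on {0..} (tau i j)"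
    and per: "\<forall>t\<ge>0. \<forall>i j. d i (t + \<omega>) = d i t \<and> I i (t + \<omega>) = I i t \<and>
                a i j (t + \<omega>) = a i j t \<and> tau i j (t + \<omega>) = tau i j t \<and>
                Kp i j (t + \<omega>) = Kp i j t \<and> Km i j (t + \<omega>) = Km i j t"
    and tau_pos: "\<forall>t\<ge>0. \<forall>i j. tau i j t > 0"
    and K_meas: "\<forall>t\<ge>0. \<forall>i j. LS_signed (Kp i j t) (Km i j t)"
    and uniq: "\<forall>\<phi>::real \<Rightarrow> real ^ 'n. continuous_on {..0} \<phi> \<longrightarrow>
                 (\<exists>!u. is_solution d a I tau Kp Km g f u \<and> (\<forall>s\<le>0. u s = \<phi> s))"
    and cont_dep: "\<forall>u T \<epsilon>. is_solution d a I tau Kp Km g f u \<and> T \<ge> 0 \<and> \<epsilon> > 0 \<longrightarrow>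
                 (\<exists>\<delta>>0. \<forall>v. is_solution d a I tau Kp Km g f v \<and> (\<forall>s\<le>0. norm (v s - u s) < \<delta>)
                    \<longrightarrow> (\<forall>t\<in>{0..T}. norm (v t - u t) < \<epsilon>))"
    and G_pos: "\<forall>j. G j > 0" and F_pos: "\<forall>j. F j > 0"
    and g_growth: "\<forall>j s. \<bar>g j s\<bar> \<le> G j * \<bar>s\<bar> + C j"
    and f_growth: "\<forall>j s. \<bar>f j s\<bar> \<le> F j * \<bar>s\<bar> + D j"
    and xi_pos: "\<forall>i. \<xi> i > 0" and eta_pos: "\<eta> > 0"
    and cond1: "\<forall>t>0. \<forall>i. (\<forall>j. tv_int (Kp i j t) (Km i j t) (\<lambda>s. 1) < \<infinity>) \<and>
                 - \<xi> i * d i t + (\<Sum>j\<in>UNIV. \<xi> j * G j * \<bar>a i j t\<bar>)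
                 + (\<Sum>j\<in>UNIV. \<xi> j * F j * enn2real (tv_int (Kp i j t) (Km i j t) (\<lambda>s. 1))) < - \<eta>"
begin

abbreviation sol :: "(real \<Rightarrow> real ^ 'n) \<Rightarrow> bool" where
  "sol \<equiv> is_solution d a I tau Kp Km g f"

definition TV :: "'n \<Rightarrow> 'n \<Rightarrow> real \<Rightarrow> real" where
  "TV i j t = measure (Kp i j t) UNIV + measure (Km i j t) UNIV"

definition sint :: "'n \<Rightarrow> 'n \<Rightarrow> (real \<Rightarrow> real) \<Rightarrow> real \<Rightarrow> real" where
  "sint i j h t = (\<integral>s. h (t - tau i j t - s) \<partial>Kp i j t) - (\<integral>s. h (t - tau i j t - s) \<partial>Km i j t)"

lemma sets_K: assumes "0 \<le> t" shows "sets (Kp i j t) = sets borel" "sets (Km i j t) = sets borel"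
  using K_meas assms by (auto simp: LS_signed_def)

lemma space_K: assumes "0 \<le> t" shows "space (Kp i j t) = UNIV" "space (Km i j t) = UNIV"
  using sets_K[OF assms, THEN sets_eq_imp_space_eq] by auto

lemma AE_nonneg: assumes "0 \<le> t" shows "AE s in Kp i j t. 0 \<le> s" "AE s in Km i j t. 0 \<le> s"
proof -
  have "emeasure (Kp i j t) {..<0} = 0" "emeasure (Km i j t) {..<0} = 0"
    using K_meas assms by (auto simp: LS_signed_def)
  then show "AE s in Kp i j t. 0 \<le> s" "AE s in Km i j t. 0 \<le> s"
    using sets_K[OF assms, of i j] by (auto intro!: AE_I[of _ _ "{..<0}"])
qed

lemma cond1':
  assumes "0 \<le> t"
  shows "finite_measure (Kp i j t)" "finite_measure (Km i j t)"
    "- \<xi> i * d i t + (\<Sum>j\<in>UNIV. \<xi> j * G j * \<bar>a i j t\<bar>) + (\<Sum>j\<in>UNIV. \<xi> j * F j * TV i j t) < - \<eta>"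
proof -
  \<comment> \<open>The row condition is stated for positive times; reading it one period later
    reaches t = 0 as well.\<close>
  have shift: "0 < t + \<omega>" using assms omega_pos by simp
  have p: "d i (t + \<omega>) = d i t" "a i j (t + \<omega>) = a i j t" "Kp i j (t + \<omega>) = Kp i j t" "Km i j (t + \<omega>) = Km i j t" for i j
    using per assms by auto
  have fin: "tv_int (Kp i j t) (Km i j t) (\<lambda>s. 1) < \<infinity>" for j
    using cond1[rule_format, OF shift, THEN conjunct1] by (simp add: p)
  have e: "emeasure (Kp i j t) UNIV < \<infinity>" "emeasure (Km i j t) UNIV < \<infinity>" for j
    using fin[of j] space_K[OF assms, of i j] by (auto simp: tv_int_def)
  then show "finite_measure (Kp i j t)" "finite_measure (Km i j t)"
    using space_K[OF assms, of i j] by (auto intro!: finite_measureI simp: less_top[symmetric])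
  have "enn2real (tv_int (Kp i j t) (Km i j t) (\<lambda>s. 1)) = TV i j t" for j
    using e[of j] space_K[OF assms, of i j] by (simp add: tv_int_def TV_def enn2real_plus measure_def)
  moreover have "- \<xi> i * d i t + (\<Sum>j\<in>UNIV. \<xi> j * G j * \<bar>a i j t\<bar>)
                 + (\<Sum>j\<in>UNIV. \<xi> j * F j * enn2real (tv_int (Kp i j t) (Km i j t) (\<lambda>s. 1))) < - \<eta>"
    using cond1[rule_format, OF shift, THEN conjunct2, of i] by (simp add: p)
  ultimately show "- \<xi> i * d i t + (\<Sum>j\<in>UNIV. \<xi> j * G j * \<bar>a i j t\<bar>) + (\<Sum>j\<in>UNIV. \<xi> j * F j * TV i j t) < - \<eta>"
    by simp
qed

lemma TV_nonneg: "0 \<le> TV i j t" by (simp add: TV_def)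

lemma tau_lower: obtains \<tau>m where "0 < \<tau>m" "\<And>t i j. 0 \<le> t \<Longrightarrow> \<tau>m \<le> tau i j t"
proof -
  have "\<exists>m>0. \<forall>t\<ge>0. m \<le> tau i j t" for i j
    using periodic_bounds[OF omega_pos, of "tau i j"] cont_tau per tau_pos by metis
  then obtain m where m: "\<And>i j. 0 < m i j" "\<And>i j t. 0 \<le> t \<Longrightarrow> m i j \<le> tau i j t" by metis
  have "0 < Min (range (\<lambda>(i, j). m i j))" using m(1) by (subst Min_gr_iff) auto
  moreover have "Min (range (\<lambda>(i, j). m i j)) \<le> tau i j t" if "0 \<le> t" for t i j
    by (rule order_trans[OF Min_le m(2)[OF that]]) (auto intro!: image_eqI[of _ _ "(i, j)"])
  ultimately show ?thesis using that by blast
qed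

lemma coefficient_bound:
  obtains B where "\<And>t i j. 0 \<le> t \<Longrightarrow> \<bar>d i t\<bar> \<le> B \<and> \<bar>I i t\<bar> \<le> B \<and> \<bar>a i j t\<bar> \<le> B \<and> TV i j t \<le> B"
proof -
  have "\<exists>b. \<forall>t\<ge>0. \<bar>d i t\<bar> \<le> b" for i
    using periodic_bounds[OF omega_pos, of "d i"] cont_d per by metis
  then obtain bd where bd: "\<And>i t. 0 \<le> t \<Longrightarrow> \<bar>d i t\<bar> \<le> bd i" by metis
  have "\<exists>b. \<forall>t\<ge>0. \<bar>I i t\<bar> \<le> b" for i
    using periodic_bounds[OF omega_pos, of "I i"] cont_I per by metis
  then obtain bI where bI: "\<And>i t. 0 \<le> t \<Longrightarrow> \<bar>I i t\<bar> \<le> bI i" by metis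
  have "\<exists>b. \<forall>t\<ge>0. \<bar>a i j t\<bar> \<le> b" for i j
    using periodic_bounds[OF omega_pos, of "a i j"] cont_a per by metis
  then obtain ba where ba: "\<And>i j t. 0 \<le> t \<Longrightarrow> \<bar>a i j t\<bar> \<le> ba i j" by metis
  \<comment> \<open>With no continuity of the kernels in t, their total variation is bounded through
    the row condition: each summand is at most \<open>\<xi> i * d i t\<close>.\<close>
  have bT: "TV i j t \<le> \<xi> i * bd i / (\<xi> j * F j)" if t: "0 \<le> t" for i j t
  proof -
    have pos: "0 < \<xi> j * F j" using xi_pos F_pos by simp
    have "\<xi> j * F j * TV i j t \<le> (\<Sum>j\<in>UNIV. \<xi> j * F j * TV i j t)"
    proof (rule member_le_sum)
      show "0 \<le> \<xi> j * F j * TV i j t" for j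
        using xi_pos[rule_format, of j] F_pos[rule_format, of j] TV_nonneg by (simp add: less_imp_le)
    qed auto
    also have "\<dots> \<le> \<xi> i * d i t"
    proof -
      have "0 \<le> (\<Sum>j\<in>UNIV. \<xi> j * G j * \<bar>a i j t\<bar>)"
        using xi_pos G_pos by (intro sum_nonneg mult_nonneg_nonneg) (auto intro: less_imp_le)
      then show ?thesis using cond1'(3)[OF t, of i] eta_pos by simp
    qed
    also have "\<dots> \<le> \<xi> i * bd i" using bd[OF t, of i] xi_pos by (intro mult_left_mono) (auto intro: less_imp_le)
    finally show ?thesis using pos by (simp add: pos_le_divide_eq mult.commute)
  qed
  define bnd where "bnd i j = max (max (bd i) (bI i)) (max (ba i j) (\<xi> i * bd i / (\<xi> j * F j)))" for i j
  have le: "bnd i j \<le> Max (range (\<lambda>(i, j). bnd i j))" for i j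
    by (rule Max_ge) (auto intro!: image_eqI[of _ _ "(i, j)"])
  show ?thesis
  proof (rule that, intro conjI)
    fix t i j assume t: "0 \<le> (t::real)"
    have "\<bar>d i t\<bar> \<le> bnd i j" "\<bar>I i t\<bar> \<le> bnd i j" "\<bar>a i j t\<bar> \<le> bnd i j" "TV i j t \<le> bnd i j"
      using bd[OF t, of i] bI[OF t, of i] ba[OF t, of i j] bT[OF t, of i j] by (auto simp: bnd_def)
    then show "\<bar>d i t\<bar> \<le> Max (range (\<lambda>(i, j). bnd i j))" "\<bar>I i t\<bar> \<le> Max (range (\<lambda>(i, j). bnd i j))"
      "\<bar>a i j t\<bar> \<le> Max (range (\<lambda>(i, j). bnd i j))" "TV i j t \<le> Max (range (\<lambda>(i, j). bnd i j))"
      using le[of i j] by linarith+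
  qed
qed

lemma sol_cont: "sol u \<Longrightarrow> continuous_on UNIV u"
  by (simp add: is_solution_def)

lemma sol_integrable:
  assumes "sol u" "0 \<le> t"
  shows "integrable (Kp i j t) (\<lambda>s. f j (u (t - tau i j t - s) $ j))" "integrable (Km i j t) (\<lambda>s. f j (u (t - tau i j t - s) $ j))"
  using assms by (auto simp: is_solution_def)

lemma sol_deriv:
  assumes "sol u" "0 \<le> t"
  shows "((\<lambda>t. u t $ i) has_real_derivative
     (- d i t * u t $ i + (\<Sum>j\<in>UNIV. a i j t * g j (u t $ j)) + (\<Sum>j\<in>UNIV. sint i j (\<lambda>r. f j (u r $ j)) t) + I i t))
     (at t within {0..})"
proof -
  have "(u has_vector_derivative dde_rhs d a I tau Kp Km g f u t) (at t within {0..})"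
    using assms by (auto simp: is_solution_def)
  from bounded_linear.has_vector_derivative[OF bounded_linear_vec_nth this, of i]
  show ?thesis by (simp add: has_real_derivative_iff_has_vector_derivative dde_rhs_def sint_def)
qed

lemma sol_term_bounds:
  assumes u: "sol u" and t: "0 \<le> t" and box: "\<And>s j. s \<le> t \<Longrightarrow> \<bar>u s $ j\<bar> \<le> \<xi> j * M"
  shows "\<bar>a i j t * g j (u t $ j)\<bar> \<le> \<bar>a i j t\<bar> * (G j * (\<xi> j * M) + C j)"
    "\<bar>sint i j (\<lambda>r. f j (u r $ j)) t\<bar> \<le> TV i j t * (F j * (\<xi> j * M) + D j)"
proof -
  have "\<bar>g j (u t $ j)\<bar> \<le> G j * (\<xi> j * M) + C j"
    using g_growth[rule_format, of j "u t $ j"] mult_left_mono[OF box[OF order_refl, of j], of "G j"] G_pos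
    by (smt (verit))
  then show "\<bar>a i j t * g j (u t $ j)\<bar> \<le> \<bar>a i j t\<bar> * (G j * (\<xi> j * M) + C j)"
    unfolding abs_mult by (intro mult_left_mono) auto
  interpret p: finite_measure "Kp i j t" using cond1' t by blast
  interpret m: finite_measure "Km i j t" using cond1' t by blast
  define b where "b = F j * (\<xi> j * M) + D j"
  have fb: "\<bar>f j (u (t - tau i j t - s) $ j)\<bar> \<le> b" if "0 \<le> s" for s
  proof -
    have "t - tau i j t - s \<le> t" using tau_pos that t by (smt (verit))
    then have "F j * \<bar>u (t - tau i j t - s) $ j\<bar> \<le> F j * (\<xi> j * M)"
      using box F_pos by (intro mult_left_mono) (auto intro: less_imp_le)
    then show ?thesis unfolding b_def
      using f_growth[rule_format, of j "u (t - tau i j t - s) $ j"] by linarith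
  qed
  have "\<bar>sint i j (\<lambda>r. f j (u r $ j)) t\<bar> \<le> (\<integral>s. b \<partial>Kp i j t) + (\<integral>s. b \<partial>Km i j t)"
    unfolding sint_def
    by (rule signed_integral_bound) (use sol_integrable[OF u t] AE_nonneg[OF t, of i j] fb in \<open>auto elim!: eventually_mono\<close>)
  also have "\<dots> = TV i j t * b"
    using space_K[OF t, of i j] by (simp add: TV_def distrib_right)
  finally show "\<bar>sint i j (\<lambda>r. f j (u r $ j)) t\<bar> \<le> TV i j t * (F j * (\<xi> j * M) + D j)" by (simp add: b_def)
qed

lemma growth_nonneg: "0 \<le> C j" "0 \<le> D j"
  using g_growth[rule_format, of j 0] f_growth[rule_format, of j 0] abs_ge_zero[of "g j 0"] abs_ge_zero[of "f j 0"] by simp_all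

text \<open>At a first contact with the level \<xi> i * M the row condition bounds the outward slope
  by E - \<eta> * M. The threshold E / \<eta> is common to all solutions. The whole past must lie in
  the box, since the kernels may see all of it.\<close>

lemma invariant_box:
  obtains M0 where "\<And>M u t i. M0 \<le> M \<Longrightarrow> sol u \<Longrightarrow> (\<And>s i. s \<le> 0 \<Longrightarrow> \<bar>u s $ i\<bar> \<le> \<xi> i * M) \<Longrightarrow> 0 \<le> t \<Longrightarrow> \<bar>u t $ i\<bar> \<le> \<xi> i * M"
proof -
  obtain B where B: "\<And>t i j. 0 \<le> t \<Longrightarrow> \<bar>d i t\<bar> \<le> B \<and> \<bar>I i t\<bar> \<le> B \<and> \<bar>a i j t\<bar> \<le> B \<and> TV i j t \<le> B"
    using coefficient_bound by blast
  note CD = growth_nonneg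
  \<comment> \<open>Everything that does not scale with the size of the box: the additive growth
    constants, weighted by the coefficient bound, and the forcing.\<close>
  define E where "E = (\<Sum>j\<in>UNIV. B * C j) + (\<Sum>j\<in>UNIV. B * D j) + B"
  have strict: "\<bar>u t $ i\<bar> < \<xi> i * M'"
    if u: "sol u" and M': "E / \<eta> < M'" and init: "\<And>s i. s \<le> 0 \<Longrightarrow> \<bar>u s $ i\<bar> < \<xi> i * M'" and t: "0 \<le> t"
    for u t i M'
  proof (rule first_crossing[where \<rho> = "\<lambda>i _. \<xi> i * M'" and T = t])
    show "continuous_on {0..t} u" using sol_cont[OF u] by (rule continuous_on_subset) simp
    fix t0 i
    assume t0: "0 < t0" and upto: "\<And>s j. 0 \<le> s \<Longrightarrow> s \<le> t0 \<Longrightarrow> \<bar>u s $ j\<bar> \<le> \<xi> j * M'" and eq: "\<bar>u t0 $ i\<bar> = \<xi> i * M'"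
    have t0': "0 \<le> t0" using t0 by simp
    have all: "\<bar>u s $ j\<bar> \<le> \<xi> j * M'" if "s \<le> t0" for s j
      using upto[of s j] init[of s j] that by (cases "0 \<le> s") (auto intro: less_imp_le)
    define P where "P j = a i j t0 * g j (u t0 $ j)" for j
    define Q where "Q j = sint i j (\<lambda>r. f j (u r $ j)) t0" for j
    have Pb: "\<bar>P j\<bar> \<le> \<bar>a i j t0\<bar> * (G j * (\<xi> j * M')) + B * C j" for j
    proof -
      have "\<bar>P j\<bar> \<le> \<bar>a i j t0\<bar> * (G j * (\<xi> j * M') + C j)"
        unfolding P_def by (rule sol_term_bounds[OF u t0' all])
      also have "\<dots> \<le> \<bar>a i j t0\<bar> * (G j * (\<xi> j * M')) + B * C j"
        using B[OF t0', of i j] CD by (simp add: distrib_left mult_right_mono)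
      finally show ?thesis .
    qed
    have Qb: "\<bar>Q j\<bar> \<le> TV i j t0 * (F j * (\<xi> j * M')) + B * D j" for j
    proof -
      have "\<bar>Q j\<bar> \<le> TV i j t0 * (F j * (\<xi> j * M') + D j)"
        unfolding Q_def by (rule sol_term_bounds[OF u t0' all])
      also have "\<dots> \<le> TV i j t0 * (F j * (\<xi> j * M')) + B * D j"
        using B[OF t0', of i j] CD by (simp add: distrib_left mult_right_mono)
      finally show ?thesis .
    qed
    have "sgn (u t0 $ i) * (- d i t0 * u t0 $ i + (\<Sum>j\<in>UNIV. P j) + (\<Sum>j\<in>UNIV. Q j) + I i t0)
      \<le> - d i t0 * \<bar>u t0 $ i\<bar> + (\<Sum>j\<in>UNIV. \<bar>a i j t0\<bar> * (G j * (\<xi> j * M')) + B * C j)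
         + (\<Sum>j\<in>UNIV. TV i j t0 * (F j * (\<xi> j * M')) + B * D j) + \<bar>I i t0\<bar>"
      by (rule sgn_affine_bound[OF Pb Qb])
    also have "\<dots> \<le> M' * (- \<xi> i * d i t0 + (\<Sum>j\<in>UNIV. \<xi> j * G j * \<bar>a i j t0\<bar>) + (\<Sum>j\<in>UNIV. \<xi> j * F j * TV i j t0)) + E"
      using B[OF t0', of i i] unfolding eq E_def
      by (simp add: sum.distrib sum_distrib_left algebra_simps)
    also have "\<dots> < 0"
    proof -
      have "0 < \<xi> i * M'" using init[of 0 i] by (smt (verit))
      then have "0 < M'" using xi_pos[rule_format, of i] by (simp add: zero_less_mult_iff)
      then have "M' * (- \<xi> i * d i t0 + (\<Sum>j\<in>UNIV. \<xi> j * G j * \<bar>a i j t0\<bar>) + (\<Sum>j\<in>UNIV. \<xi> j * F j * TV i j t0)) \<le> M' * (- \<eta>)"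
        using cond1'(3)[OF t0', of i] by (intro mult_left_mono) auto
      moreover have "E < M' * \<eta>" using M' eta_pos by (simp add: pos_divide_less_eq)
      ultimately show ?thesis by simp
    qed
    finally show "\<exists>D E. ((\<lambda>s. u s $ i) has_real_derivative D) (at t0 within {0..t0}) \<and>
        ((\<lambda>_. \<xi> i * M') has_real_derivative E) (at t0 within {0..t0}) \<and> sgn (u t0 $ i) * D < E"
      using DERIV_subset[OF sol_deriv[OF u t0', of i], of "{0..t0}"] unfolding P_def Q_def
      by (intro exI[of _ 0] exI conjI) auto
  qed (use init t in auto)
  show ?thesis
  proof (rule that[of "E / \<eta>"])
    fix M u t i
    assume M: "E / \<eta> \<le> M" and u: "sol u" and init: "\<And>s i. s \<le> 0 \<Longrightarrow> \<bar>u s $ i\<bar> \<le> \<xi> i * M" and t: "0 \<le> (t::real)"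
    \<comment> \<open>The crossing argument needs strict room on the past, so it is run for every
      larger M' and the closed box is recovered by letting M' decrease to M.\<close>
    have *: "\<bar>u t $ i\<bar> < \<xi> i * M'" if M': "M < M'" for M'
    proof (rule strict[OF u _ _ t])
      show "E / \<eta> < M'" using M M' by simp
      show "\<bar>u s $ i\<bar> < \<xi> i * M'" if "s \<le> 0" for s i
        using init[OF that, of i] mult_strict_left_mono[OF M', of "\<xi> i"] xi_pos by (meson le_less_trans)
    qed
    show "\<bar>u t $ i\<bar> \<le> \<xi> i * M"
    proof (rule field_le_epsilon)
      fix e :: real assume e: "0 < e"
      have "\<bar>u t $ i\<bar> < \<xi> i * (M + e / \<xi> i)" using e xi_pos by (intro *) simp
      also have "\<dots> = \<xi> i * M + e" using xi_pos[rule_format, of i] by (simp add: distrib_left)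
      finally show "\<bar>u t $ i\<bar> \<le> \<xi> i * M + e" by simp
    qed
  qed
qed

end

section \<open>Exponential decay of differences\<close>

definition exp_condition :: "real \<Rightarrow> ('n::finite \<Rightarrow> real \<Rightarrow> real) \<Rightarrow> ('n \<Rightarrow> 'n \<Rightarrow> real \<Rightarrow> real) \<Rightarrow> ('n \<Rightarrow> 'n \<Rightarrow> real \<Rightarrow> real) \<Rightarrow>
   ('n \<Rightarrow> 'n \<Rightarrow> real \<Rightarrow> real measure) \<Rightarrow> ('n \<Rightarrow> 'n \<Rightarrow> real \<Rightarrow> real measure) \<Rightarrow>
   ('n \<Rightarrow> real) \<Rightarrow> ('n \<Rightarrow> real) \<Rightarrow> ('n \<Rightarrow> real) \<Rightarrow> bool" where
  "exp_condition \<alpha> d a tau Kp Km G F \<xi> \<longleftrightarrow>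
    (\<forall>t>0. \<forall>i. (\<forall>j. tv_int (Kp i j t) (Km i j t) (\<lambda>s. exp (\<alpha> * s)) < \<infinity>) \<and>
       - \<xi> i * (d i t - \<alpha>) + (\<Sum>j\<in>UNIV. \<xi> j * G j * \<bar>a i j t\<bar>)
       + (\<Sum>j\<in>UNIV. \<xi> j * F j * exp (\<alpha> * tau i j t)
             * enn2real (tv_int (Kp i j t) (Km i j t) (\<lambda>s. exp (\<alpha> * s)))) \<le> 0)"

locale lipschitz_delay_system = delay_system \<omega> \<eta> d I a tau Kp Km g f G F C D \<xi>
  for \<omega> \<eta> :: real
    and d I :: "'n::finite \<Rightarrow> real \<Rightarrow> real"
    and a tau :: "'n \<Rightarrow> 'n \<Rightarrow> real \<Rightarrow> real"
    and Kp Km :: "'n \<Rightarrow> 'n \<Rightarrow> real \<Rightarrow> real measure"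
    and g f :: "'n \<Rightarrow> real \<Rightarrow> real"
    and G F C D \<xi> :: "'n \<Rightarrow> real" +
  assumes lip_g: "\<And>i x y. \<bar>g i x - g i y\<bar> \<le> G i * \<bar>x - y\<bar>"
    and lip_f: "\<And>i x y. \<bar>f i x - f i y\<bar> \<le> F i * \<bar>x - y\<bar>"
begin

abbreviation "decay_condition \<alpha> \<equiv> exp_condition \<alpha> d a tau Kp Km G F \<xi>"

text \<open>Opens the comparison lemma at rate 0 without any exponential hypothesis. This propagates
  the coincidence of solutions with the same visible past, and later settles negative rates.\<close>

lemma decay_condition_zero: "decay_condition 0"
  unfolding exp_condition_def
proof (intro allI impI conjI)
  fix t i assume t: "0 < (t::real)"
  note c = cond1[rule_format, OF t, of i]
  show "tv_int (Kp i j t) (Km i j t) (\<lambda>s. exp (0 * s)) < \<infinity>" for j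
    using conjunct1[OF c] by simp
  show "- \<xi> i * (d i t - 0) + (\<Sum>j\<in>UNIV. \<xi> j * G j * \<bar>a i j t\<bar>)
       + (\<Sum>j\<in>UNIV. \<xi> j * F j * exp (0 * tau i j t)
             * enn2real (tv_int (Kp i j t) (Km i j t) (\<lambda>s. exp (0 * s)))) \<le> 0"
    using conjunct2[OF c] eta_pos by simp
qed

text \<open>The histories are compared only through increments of f, and only almost everywhere for
  the kernels, because the initial functions themselves may differ without bound. With Q = 0 it says
  that agreement of the present state and of the visible past persists.\<close>

lemma comparison:
  assumes u: "sol u" and v: "sol v" and cond: "decay_condition \<alpha>" and Q: "0 \<le> Q" and T: "0 \<le> T"
    and init: "\<And>i. \<bar>u 0 $ i - v 0 $ i\<bar> \<le> \<xi> i * Q"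
    and hist_p: "\<And>t i j. 0 < t \<Longrightarrow> t \<le> T \<Longrightarrow> AE s in Kp i j t. t - tau i j t - s \<le> 0 \<longrightarrow>
        \<bar>f j (u (t - tau i j t - s) $ j) - f j (v (t - tau i j t - s) $ j)\<bar> \<le> F j * \<xi> j * Q * exp (- \<alpha> * (t - tau i j t - s))"
    and hist_m: "\<And>t i j. 0 < t \<Longrightarrow> t \<le> T \<Longrightarrow> AE s in Km i j t. t - tau i j t - s \<le> 0 \<longrightarrow>
        \<bar>f j (u (t - tau i j t - s) $ j) - f j (v (t - tau i j t - s) $ j)\<bar> \<le> F j * \<xi> j * Q * exp (- \<alpha> * (t - tau i j t - s))"
  shows "\<bar>u T $ i - v T $ i\<bar> \<le> \<xi> i * Q * exp (- \<alpha> * T)"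
proof -
  \<comment> \<open>The hypothesis only gives a weak inequality; the summand \<open>\<epsilon> * t\<close> makes the slopes differ strictly at a crossing.\<close>
  have strict: "\<bar>(u T - v T) $ i\<bar> < \<xi> i * (Q + \<epsilon> + \<epsilon> * T) * exp (- \<alpha> * T)" if \<epsilon>: "0 < \<epsilon>" for \<epsilon> i
  proof (rule first_crossing[where v = "\<lambda>t. u t - v t" and \<rho> = "\<lambda>i t. \<xi> i * (Q + \<epsilon> + \<epsilon> * t) * exp (- \<alpha> * t)" and T = T])
    show "continuous_on {0..T} (\<lambda>t. u t - v t)"
      using sol_cont[OF u] sol_cont[OF v] by (intro continuous_intros) (auto intro: continuous_on_subset)
    show "continuous_on {0..T} (\<lambda>t. \<xi> i * (Q + \<epsilon> + \<epsilon> * t) * exp (- \<alpha> * t))" for i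
      by (intro continuous_intros)
    show "\<bar>(u 0 - v 0) $ i\<bar> < \<xi> i * (Q + \<epsilon> + \<epsilon> * 0) * exp (- \<alpha> * 0)" for i
    proof -
      have "\<xi> i * Q < \<xi> i * (Q + \<epsilon>)" using xi_pos \<epsilon> by simp
      then show ?thesis using init[of i] by simp
    qed
    fix t i
    assume t: "0 < t" "t \<le> T"
      and upto: "\<And>s j. 0 \<le> s \<Longrightarrow> s \<le> t \<Longrightarrow> \<bar>(u s - v s) $ j\<bar> \<le> \<xi> j * (Q + \<epsilon> + \<epsilon> * s) * exp (- \<alpha> * s)"
      and eq: "\<bar>(u t - v t) $ i\<bar> = \<xi> i * (Q + \<epsilon> + \<epsilon> * t) * exp (- \<alpha> * t)"
    have t': "0 \<le> t" using t by simp
    \<comment> \<open>Growth factor of the envelope at the crossing time. It increases with time, so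
      it may replace the factor at all earlier times in [0, t].\<close>
    define q where "q = Q + \<epsilon> + \<epsilon> * t"
    have q: "0 < q" "Q \<le> q" using Q \<epsilon> t by (auto simp: q_def add_nonneg_pos add_pos_nonneg)
    have upto_q: "\<bar>u s $ j - v s $ j\<bar> \<le> \<xi> j * q * exp (- \<alpha> * s)" if "0 \<le> s" "s \<le> t" for s j
    proof -
      have "\<xi> j * (Q + \<epsilon> + \<epsilon> * s) * exp (- \<alpha> * s) \<le> \<xi> j * q * exp (- \<alpha> * s)"
        unfolding q_def using that xi_pos[rule_format, of j] \<epsilon> by (intro mult_right_mono mult_left_mono) auto
      then show ?thesis using upto[OF that, of j] by simp
    qed
    define P where "P j = a i j t * (g j (u t $ j) - g j (v t $ j))" for j
    define S where "S j = sint i j (\<lambda>r. f j (u r $ j)) t - sint i j (\<lambda>r. f j (v r $ j)) t" for j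
    define X where "X = - d i t * (u t $ i - v t $ i) + (\<Sum>j\<in>UNIV. P j) + (\<Sum>j\<in>UNIV. S j) + 0"
    have "((\<lambda>s. u s $ i - v s $ i) has_real_derivative X) (at t within {0..})"
      using DERIV_diff[OF sol_deriv[OF u t', of i] sol_deriv[OF v t', of i]]
      by (simp add: X_def P_def S_def sum_subtractf right_diff_distrib algebra_simps)
    then have derX: "((\<lambda>s. (u s - v s) $ i) has_real_derivative X) (at t within {0..t})"
      by (auto intro: DERIV_subset)
    define Y where "Y j = enn2real (tv_int (Kp i j t) (Km i j t) (\<lambda>s. exp (\<alpha> * s)))" for j
    have Pb: "\<bar>P j\<bar> \<le> q * exp (- \<alpha> * t) * (\<xi> j * G j * \<bar>a i j t\<bar>)" for j
    proof -
      have "\<bar>P j\<bar> \<le> \<bar>a i j t\<bar> * (G j * \<bar>u t $ j - v t $ j\<bar>)"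
        unfolding P_def abs_mult by (intro mult_left_mono lip_g) auto
      also have "\<dots> \<le> \<bar>a i j t\<bar> * (G j * (\<xi> j * q * exp (- \<alpha> * t)))"
        using upto_q[OF t' order_refl, of j] G_pos by (intro mult_left_mono) (auto intro: less_imp_le)
      finally show ?thesis by (simp add: mult_ac)
    qed
    have Sb: "\<bar>S j\<bar> \<le> q * exp (- \<alpha> * t) * (\<xi> j * F j * exp (\<alpha> * tau i j t) * Y j)" for j
    proof -
      define k where "k = q * exp (- \<alpha> * t) * (\<xi> j * F j * exp (\<alpha> * tau i j t))"
      define h where "h s = f j (u (t - tau i j t - s) $ j) - f j (v (t - tau i j t - s) $ j)" for s
      have LS: "LS_signed (Kp i j t) (Km i j t)" using K_meas t' by blast
      have fin: "tv_int (Kp i j t) (Km i j t) (\<lambda>s. exp (\<alpha> * s)) < \<infinity>" using cond t unfolding exp_condition_def by blast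
      note E = tv_int_exp[OF fin LS]
      have hi: "integrable (Kp i j t) h" "integrable (Km i j t) h"
        unfolding h_def by (intro Bochner_Integration.integrable_diff sol_integrable u v t')+
      have Sj: "S j = (\<integral>s. h s \<partial>Kp i j t) - (\<integral>s. h s \<partial>Km i j t)"
        unfolding S_def sint_def h_def using sol_integrable[OF u t', of i j] sol_integrable[OF v t', of i j]
        by (simp add: Bochner_Integration.integral_diff)
      \<comment> \<open>A value read at the earlier time t - tau - s is controlled by the envelope
        of that time; splitting the exponential leaves exactly the weights of the exponential
        condition.\<close>
      have kexp: "F j * (\<xi> j * q * exp (- \<alpha> * (t - tau i j t - s))) = k * exp (\<alpha> * s)" for s
      proof -
        have "exp (- \<alpha> * (t - tau i j t - s)) = exp (- \<alpha> * t) * exp (\<alpha> * tau i j t) * exp (\<alpha> * s)"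
          by (simp add: exp_add[symmetric] algebra_simps)
        then show ?thesis by (simp add: k_def mult_ac)
      qed
      have hb: "\<bar>h s\<bar> \<le> k * exp (\<alpha> * s)"
        if s: "0 \<le> s" and old: "t - tau i j t - s \<le> 0 \<longrightarrow> \<bar>h s\<bar> \<le> F j * \<xi> j * Q * exp (- \<alpha> * (t - tau i j t - s))" for s
      proof (cases "t - tau i j t - s \<le> 0")
        case True
        then have "\<bar>h s\<bar> \<le> F j * \<xi> j * Q * exp (- \<alpha> * (t - tau i j t - s))" using old by blast
        also have "\<dots> \<le> F j * \<xi> j * q * exp (- \<alpha> * (t - tau i j t - s))"
          using q F_pos[rule_format, of j] xi_pos[rule_format, of j] by (intro mult_right_mono mult_left_mono) auto
        also have "\<dots> = k * exp (\<alpha> * s)" using kexp[of s] by (simp add: mult_ac)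
        finally show ?thesis .
      next
        case False
        have "t - tau i j t - s \<le> t" using s tau_pos[rule_format, OF t', of i j] by simp
        then have "\<bar>u (t - tau i j t - s) $ j - v (t - tau i j t - s) $ j\<bar> \<le> \<xi> j * q * exp (- \<alpha> * (t - tau i j t - s))"
          using False by (intro upto_q) auto
        then have "\<bar>h s\<bar> \<le> F j * (\<xi> j * q * exp (- \<alpha> * (t - tau i j t - s)))"
          unfolding h_def using F_pos[rule_format, of j]
          by (intro order_trans[OF lip_f] mult_left_mono) auto
        then show ?thesis unfolding kexp .
      qed
      have "\<bar>S j\<bar> \<le> (\<integral>s. k * exp (\<alpha> * s) \<partial>Kp i j t) + (\<integral>s. k * exp (\<alpha> * s) \<partial>Km i j t)"
        unfolding Sj
      proof (rule signed_integral_bound[OF hi])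
        show "AE s in Kp i j t. \<bar>h s\<bar> \<le> k * exp (\<alpha> * s)"
          using AE_nonneg(1)[OF t', of i j] hist_p[OF t, of i j] by eventually_elim (rule hb, auto simp: h_def)
        show "AE s in Km i j t. \<bar>h s\<bar> \<le> k * exp (\<alpha> * s)"
          using AE_nonneg(2)[OF t', of i j] hist_m[OF t, of i j] by eventually_elim (rule hb, auto simp: h_def)
      qed (intro integrable_mult_right E)+
      also have "\<dots> = k * Y j" using E by (simp add: Y_def distrib_left)
      finally show ?thesis by (simp add: k_def mult_ac)
    qed
    have "sgn ((u t - v t) $ i) * X \<le> - d i t * \<bar>u t $ i - v t $ i\<bar>
        + (\<Sum>j\<in>UNIV. q * exp (- \<alpha> * t) * (\<xi> j * G j * \<bar>a i j t\<bar>))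
        + (\<Sum>j\<in>UNIV. q * exp (- \<alpha> * t) * (\<xi> j * F j * exp (\<alpha> * tau i j t) * Y j)) + \<bar>0\<bar>"
      unfolding X_def vector_minus_component by (rule sgn_affine_bound[OF Pb Sb])
    \<comment> \<open>Equality at the crossing turns the damping term into a multiple of the common
      factor. Adding and subtracting \<alpha> isolates the row expression and leaves the slope of a
      pure exponential.\<close>
    also have "\<dots> = q * exp (- \<alpha> * t) * (- \<xi> i * (d i t - \<alpha>) + (\<Sum>j\<in>UNIV. \<xi> j * G j * \<bar>a i j t\<bar>)
        + (\<Sum>j\<in>UNIV. \<xi> j * F j * exp (\<alpha> * tau i j t) * Y j)) - \<alpha> * (\<xi> i * q * exp (- \<alpha> * t))"
      using eq unfolding q_def[symmetric] vector_minus_component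
      by (simp add: sum_distrib_left algebra_simps)
    also have "\<dots> \<le> 0 - \<alpha> * (\<xi> i * q * exp (- \<alpha> * t))"
    proof -
      have "- \<xi> i * (d i t - \<alpha>) + (\<Sum>j\<in>UNIV. \<xi> j * G j * \<bar>a i j t\<bar>)
        + (\<Sum>j\<in>UNIV. \<xi> j * F j * exp (\<alpha> * tau i j t) * Y j) \<le> 0"
        using cond t unfolding exp_condition_def Y_def by blast
      then show ?thesis using q by (intro diff_right_mono mult_nonneg_nonpos) auto
    qed
    also have "\<dots> < \<xi> i * \<epsilon> * exp (- \<alpha> * t) - \<alpha> * (\<xi> i * q * exp (- \<alpha> * t))"
      using xi_pos \<epsilon> by simp
    finally have less: "sgn ((u t - v t) $ i) * X < \<xi> i * \<epsilon> * exp (- \<alpha> * t) - \<alpha> * (\<xi> i * q * exp (- \<alpha> * t))" .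
    have derE: "((\<lambda>t. \<xi> i * (Q + \<epsilon> + \<epsilon> * t) * exp (- \<alpha> * t)) has_real_derivative
        (\<xi> i * \<epsilon> * exp (- \<alpha> * t) - \<alpha> * (\<xi> i * q * exp (- \<alpha> * t)))) (at t within {0..t})"
      by (auto intro!: derivative_eq_intros simp: q_def algebra_simps)
    show "\<exists>D E. ((\<lambda>s. (u s - v s) $ i) has_real_derivative D) (at t within {0..t}) \<and>
      ((\<lambda>t. \<xi> i * (Q + \<epsilon> + \<epsilon> * t) * exp (- \<alpha> * t)) has_real_derivative E) (at t within {0..t}) \<and>
      sgn ((u t - v t) $ i) * D < E"
      using derX derE less by blast
  qed (use T in auto)
  show ?thesis
  proof (rule field_le_epsilon)
    fix e :: real assume e: "0 < e"
    \<comment> \<open>Chosen so that the perturbed envelope exceeds the unperturbed one at T by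
      exactly e.\<close>
    define \<epsilon> where "\<epsilon> = e / (\<xi> i * (1 + T) * exp (- \<alpha> * T))"
    have den: "0 < \<xi> i * (1 + T) * exp (- \<alpha> * T)" using xi_pos T by simp
    then have \<epsilon>: "0 < \<epsilon>" using e by (simp add: \<epsilon>_def)
    have "\<bar>u T $ i - v T $ i\<bar> \<le> \<xi> i * (Q + \<epsilon> + \<epsilon> * T) * exp (- \<alpha> * T)" using strict[OF \<epsilon>, of i] by simp
    also have "\<dots> = \<xi> i * Q * exp (- \<alpha> * T) + \<epsilon> * (\<xi> i * (1 + T) * exp (- \<alpha> * T))" by (simp add: algebra_simps)
    also have "\<epsilon> * (\<xi> i * (1 + T) * exp (- \<alpha> * T)) = e"
      unfolding \<epsilon>_def by (rule nonzero_eq_divide_eq[THEN iffD1, OF _ refl]) (use den in linarith)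
    finally show "\<bar>u T $ i - v T $ i\<bar> \<le> \<xi> i * Q * exp (- \<alpha> * T) + e" .
  qed
qed

end

section \<open>Periodicity of the kernels and the solution operator\<close>

context delay_system
begin

lemma K_shift: assumes "0 \<le> t"
  shows "tau i j (t + real k * \<omega>) = tau i j t" "Kp i j (t + real k * \<omega>) = Kp i j t" "Km i j (t + real k * \<omega>) = Km i j t"
proof -
  have "tau i j (t + real k * \<omega>) = tau i j t \<and> Kp i j (t + real k * \<omega>) = Kp i j t \<and> Km i j (t + real k * \<omega>) = Km i j t"
  proof (induction k)
    case (Suc k)
    have e: "t + real (Suc k) * \<omega> = (t + real k * \<omega>) + \<omega>" by (simp add: algebra_simps)
    have "0 \<le> t + real k * \<omega>" using assms omega_pos by simp
    then have "tau i j (t + real k * \<omega> + \<omega>) = tau i j (t + real k * \<omega>) \<and> Kp i j (t + real k * \<omega> + \<omega>) = Kp i j (t + real k * \<omega>)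
      \<and> Km i j (t + real k * \<omega> + \<omega>) = Km i j (t + real k * \<omega>)" using per by blast
    then show ?case using Suc unfolding e by simp
  qed simp
  then show "tau i j (t + real k * \<omega>) = tau i j t" "Kp i j (t + real k * \<omega>) = Kp i j t" "Km i j (t + real k * \<omega>) = Km i j t"
    by blast+
qed

lemma tail_null_mono:
  assumes "0 \<le> t" "emeasure (Kp i j t) {x<..} = 0 \<and> emeasure (Km i j t) {x<..} = 0" "x \<le> y"
  shows "emeasure (Kp i j t) {y<..} = 0 \<and> emeasure (Km i j t) {y<..} = 0"
proof -
  have "emeasure (Kp i j t) {y<..} \<le> emeasure (Kp i j t) {x<..}" "emeasure (Km i j t) {y<..} \<le> emeasure (Km i j t) {x<..}"
    using assms(3) sets_K[OF assms(1), of i j] by (auto intro!: emeasure_mono)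
  then show ?thesis using assms(2) by simp
qed

definition sol_of :: "(real \<Rightarrow> real ^ 'n) \<Rightarrow> real \<Rightarrow> real ^ 'n" where
  "sol_of \<phi> = (THE u. sol u \<and> (\<forall>s\<le>0. u s = \<phi> s))"

lemma sol_of:
  assumes "continuous_on {..0} \<phi>"
  shows "sol (sol_of \<phi>)" "s \<le> 0 \<Longrightarrow> sol_of \<phi> s = \<phi> s"
proof -
  have "sol (sol_of \<phi>) \<and> (\<forall>s\<le>0. sol_of \<phi> s = \<phi> s)"
    unfolding sol_of_def by (rule theI'[OF uniq[rule_format, OF assms]])
  then show "sol (sol_of \<phi>)" "s \<le> 0 \<Longrightarrow> sol_of \<phi> s = \<phi> s" by blast+
qed

lemma sol_unique:
  assumes "sol u" "sol v" "\<And>s. s \<le> 0 \<Longrightarrow> u s = v s"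
  shows "u = v"
proof -
  have "continuous_on {..0} v" using sol_cont[OF assms(2)] by (rule continuous_on_subset) simp
  from uniq[rule_format, OF this] show ?thesis using assms by blast
qed

end

section \<open>How far back the initial function is seen\<close>

context lipschitz_delay_system
begin

text \<open>The half-line consists of the delays s with t - tau - s < -R. Thus at time t no equation
  reads component j before time -R; measuring by absolute time rather than by s makes one R
  meaningful for a range of t.\<close>

definition supp_bound :: "'n \<Rightarrow> real \<Rightarrow> real \<Rightarrow> bool" where
  "supp_bound j t R \<longleftrightarrow> (\<forall>i. emeasure (Kp i j t) {R + t - tau i j t <..} = 0 \<and> emeasure (Km i j t) {R + t - tau i j t <..} = 0)"

lemma supp_bound_mono: "0 \<le> t \<Longrightarrow> supp_bound j t R \<Longrightarrow> R \<le> R' \<Longrightarrow> supp_bound j t R'"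
  unfolding supp_bound_def
proof (intro allI)
  fix i assume t: "0 \<le> t" and s: "\<forall>i. emeasure (Kp i j t) {R + t - tau i j t <..} = 0 \<and> emeasure (Km i j t) {R + t - tau i j t <..} = 0" and R: "R \<le> R'"
  show "emeasure (Kp i j t) {R' + t - tau i j t <..} = 0 \<and> emeasure (Km i j t) {R' + t - tau i j t <..} = 0"
    by (rule tail_null_mono[OF t s[rule_format]]) (use R in simp)
qed

lemma supp_bound_AE:
  assumes "0 \<le> t" "supp_bound j t R"
  shows "AE s in Kp i j t. - R \<le> t - tau i j t - s" "AE s in Km i j t. - R \<le> t - tau i j t - s"
proof -
  have "emeasure (Kp i j t) {R + t - tau i j t <..} = 0" "emeasure (Km i j t) {R + t - tau i j t <..} = 0"
    using assms(2) by (auto simp: supp_bound_def)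
  then show "AE s in Kp i j t. - R \<le> t - tau i j t - s" "AE s in Km i j t. - R \<le> t - tau i j t - s"
    using sets_K[OF assms(1), of i j]
    by (intro AE_I[of _ _ "{R + t - tau i j t <..}"]; auto)+
qed

lemma continuous_fg: "continuous_on UNIV (f j)" "continuous_on UNIV (g j)"
proof -
  have "(F j)-lipschitz_on UNIV (f j)" "(G j)-lipschitz_on UNIV (g j)"
    using lip_f lip_g F_pos G_pos by (auto intro!: lipschitz_onI simp: dist_real_def less_imp_le)
  then show "continuous_on UNIV (f j)" "continuous_on UNIV (g j)" by (auto intro: lipschitz_on_continuous_on)
qed

text \<open>On a window no longer than the smallest delay the history integrals only involve values that are
  already known, so solvability forces them, as functions of time, to be derivatives whatever the
  initial function is.\<close>

lemma supp_bound_window: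
  assumes unb: "\<And>k. \<exists>p. k < \<bar>f j p\<bar>" and T: "0 \<le> T"
    and \<tau>: "0 < \<tau>" "\<And>t i j. 0 \<le> t \<Longrightarrow> \<tau> \<le> tau i j t"
    and old: "\<And>t. 0 < t \<Longrightarrow> t \<le> T \<Longrightarrow> supp_bound j t R0" and R0: "0 \<le> R0"
  shows "\<exists>R. \<forall>t\<in>{T..T + \<tau>}. emeasure (Kp i j t) {R + t - tau i j t <..} = 0 \<and> emeasure (Km i j t) {R + t - tau i j t <..} = 0"
proof -
  obtain V where "\<And>t i j. 0 \<le> t \<Longrightarrow> \<bar>d i t\<bar> \<le> V \<and> \<bar>I i t\<bar> \<le> V \<and> \<bar>a i j t\<bar> \<le> V \<and> TV i j t \<le> V"
    using coefficient_bound by blast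
  then have V: "\<And>t i j. 0 \<le> t \<Longrightarrow> TV i j t \<le> V" by blast
  \<comment> \<open>Reference solution. Only component j of its history will be altered, and only
    before -\<open>R0\<close>, which no equation sees at times in (0, T].\<close>
  define u0 where "u0 = sol_of (\<lambda>_. 0)"
  have u0: "sol u0" unfolding u0_def by (rule sol_of) simp
  define w where "w s = u0 (- s) $ j" for s
  define c where "c t = (\<Sum>j'\<in>UNIV - {j}. sint i j' (\<lambda>r. f j' (u0 r $ j')) t)" for t
  \<comment> \<open>Minus the time that is read through the delay s. Pushing the kernels forward
    along \<open>age\<close> lets the same history function be integrated at every t of the
    window.\<close>
  define age where "age t s = s + tau i j t - t" for t s
  define \<mu>p where "\<mu>p t = distr (Kp i j t) borel (age t)" for t
  define \<mu>m where "\<mu>m t = distr (Km i j t) borel (age t)" for t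
  have age_borel[measurable]: "age t \<in> borel_measurable borel" for t
    unfolding age_def[abs_def] by measurable
  have age_meas: "age t \<in> measurable (Kp i j t) borel" "age t \<in> measurable (Km i j t) borel" if "0 \<le> t" for t
    using age_borel sets_K[OF that, of i j] by (simp_all cong: measurable_cong_sets)
  interpret glued_functions w R0
    by unfold_locales (auto simp: w_def intro!: continuous_intros continuous_on_compose2[OF sol_cont[OF u0]])
  define ini where "ini \<psi> t = (\<chi> j'. if j' = j then \<psi> (- t) else u0 t $ j')" for \<psi> t
  define U where "U \<psi> = sol_of (ini \<psi>)" for \<psi>
  have U: "sol (U \<psi>)" "\<And>s. s \<le> 0 \<Longrightarrow> U \<psi> s = ini \<psi> s" if \<psi>: "\<psi> \<in> extensions" for \<psi>
  proof -
    have "continuous_on {..0} (\<lambda>t. ini \<psi> t $ j')" for j'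
    proof (cases "j' = j")
      case True
      have "continuous_on UNIV \<psi>" using \<psi> by (simp add: extensions_def)
      then show ?thesis unfolding ini_def using True
        by (auto intro!: continuous_on_compose2[of UNIV \<psi>] continuous_intros)
    next
      case False
      then show ?thesis unfolding ini_def using sol_cont[OF u0]
        by (auto intro!: continuous_intros intro: continuous_on_subset)
    qed
    then have "continuous_on {..0} (\<lambda>t. \<chi> j'. ini \<psi> t $ j')" by (intro continuous_on_vec_lambda)
    then have "continuous_on {..0} (ini \<psi>)" by simp
    then show "sol (U \<psi>)" "\<And>s. s \<le> 0 \<Longrightarrow> U \<psi> s = ini \<psi> s" unfolding U_def by (rule sol_of)+
  qed
  have w_psi: "\<psi> s = w s" if "\<psi> \<in> extensions" "s \<le> R0" for \<psi> s
    using that by (simp add: extensions_def)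
  \<comment> \<open>The altered part of the past is invisible up to T, so the comparison at rate 0
    with Q = 0 identifies both solutions on [0, T].\<close>
  have U_early: "U \<psi> t = u0 t" if \<psi>: "\<psi> \<in> extensions" and t: "0 \<le> t" "t \<le> T" for \<psi> t
  proof -
    have same: "f j' (U \<psi> r $ j') = f j' (u0 r $ j')" if "r \<le> 0" "- R0 \<le> r \<or> j' \<noteq> j" for r j'
      using that U(2)[OF \<psi>, of r] w_psi[OF \<psi>, of "- r"] by (auto simp: ini_def w_def)
    have AE: "AE s in M. t1 - tau i' j' t1 - s \<le> 0 \<longrightarrow>
        \<bar>f j' (U \<psi> (t1 - tau i' j' t1 - s) $ j') - f j' (u0 (t1 - tau i' j' t1 - s) $ j')\<bar>
        \<le> F j' * \<xi> j' * 0 * exp (- 0 * (t1 - tau i' j' t1 - s))"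
      if "j' = j \<Longrightarrow> AE s in M. - R0 \<le> t1 - tau i' j' t1 - s" for M t1 i' j'
    proof (cases "j' = j")
      case True
      show ?thesis using that[OF True] by eventually_elim (auto simp: same)
    qed (auto simp: same)
    have "\<bar>U \<psi> t $ i - u0 t $ i\<bar> \<le> \<xi> i * 0 * exp (- 0 * t)" for i
    proof (rule comparison[OF U(1)[OF \<psi>] u0 decay_condition_zero order_refl t(1)])
      show "\<bar>U \<psi> 0 $ i - u0 0 $ i\<bar> \<le> \<xi> i * 0" for i
        using U(2)[OF \<psi>, of 0] w_psi[OF \<psi>, of 0] R0 by (auto simp: ini_def w_def)
    qed (use supp_bound_AE old t(2) in \<open>intro AE; force\<close>)+
    then show ?thesis by (simp add: vec_eq_iff)
  qed
  \<comment> \<open>This includes positive times up to T: for negative arguments every extension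
    equals \<open>w\<close>, which stores the future of \<open>u0\<close>.\<close>
  have U_j: "U \<psi> r $ j = \<psi> (- r)" if "\<psi> \<in> extensions" "r \<le> T" for \<psi> r
    using that U(2)[OF that(1), of r] U_early[OF that(1), of r] w_psi[OF that(1), of "- r"] R0
    by (cases "r \<le> 0") (auto simp: ini_def w_def)
  have U_other: "U \<psi> r $ j' = u0 r $ j'" if "\<psi> \<in> extensions" "r \<le> T" "j' \<noteq> j" for \<psi> r j'
    using that U(2)[OF that(1), of r] U_early[OF that(1), of r] by (cases "r \<le> 0") (auto simp: ini_def)
  \<comment> \<open>The window is no longer than the smallest delay, so only times up to T are read
    in it.\<close>
  have past: "t - tau i j' t - s \<le> T" if "t \<in> {T..T + \<tau>}" "0 \<le> s" for t s j'
    using that T \<tau>(2)[of t i j'] by auto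
  have J0: "0 \<le> t" if "t \<in> {T..T + \<tau>}" for t using that T by auto
  have fpsi: "(\<lambda>s. f j (\<psi> s)) \<in> borel_measurable borel" if "\<psi> \<in> extensions" for \<psi>
    using that by (intro borel_measurable_continuous_onI continuous_on_compose2[OF continuous_fg(1)]) (auto simp: extensions_def)
  have transfer: "integrable (distr M borel (age t)) (\<lambda>s. f j (\<psi> s)) \<and>
      (\<integral>s. f j (\<psi> s) \<partial>distr M borel (age t)) = (\<integral>s. f j (U \<psi> (t - tau i j t - s) $ j) \<partial>M)"
    if \<psi>: "\<psi> \<in> extensions" and t: "t \<in> {T..T + \<tau>}" and M: "sets M = sets borel" "AE s in M. 0 \<le> s"
      "integrable M (\<lambda>s. f j (U \<psi> (t - tau i j t - s) $ j))" for \<psi> t M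
  proof -
    have am: "age t \<in> measurable M borel" using age_borel M(1) by (simp cong: measurable_cong_sets)
    have m: "(\<lambda>s. f j (\<psi> (age t s))) \<in> borel_measurable M"
      using measurable_compose[OF am fpsi[OF \<psi>]] .
    have ae: "AE s in M. f j (U \<psi> (t - tau i j t - s) $ j) = f j (\<psi> (age t s))"
      using M(2)
    proof eventually_elim
      case (elim s)
      have "- (t - tau i j t - s) = age t s" by (simp add: age_def)
      then show ?case using U_j[OF \<psi> past[OF t elim]] by simp
    qed
    have "integrable M (\<lambda>s. f j (\<psi> (age t s)))"
      using integrable_cong_AE[OF borel_measurable_integrable[OF M(3)] m ae] M(3) by blast
    moreover have "(\<integral>s. f j (U \<psi> (t - tau i j t - s) $ j) \<partial>M) = (\<integral>s. f j (\<psi> (age t s)) \<partial>M)"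
      by (rule integral_cong_AE[OF borel_measurable_integrable[OF M(3)] m ae])
    ultimately show ?thesis
      by (simp add: integrable_distr_eq[OF am fpsi[OF \<psi>]] integral_distr[OF am fpsi[OF \<psi>]])
  qed
  have tp: "integrable (\<mu>p t) (\<lambda>s. f j (\<psi> s)) \<and> (\<integral>s. f j (\<psi> s) \<partial>\<mu>p t) = (\<integral>s. f j (U \<psi> (t - tau i j t - s) $ j) \<partial>Kp i j t)"
    and tm: "integrable (\<mu>m t) (\<lambda>s. f j (\<psi> s)) \<and> (\<integral>s. f j (\<psi> s) \<partial>\<mu>m t) = (\<integral>s. f j (U \<psi> (t - tau i j t - s) $ j) \<partial>Km i j t)"
    if \<psi>: "\<psi> \<in> extensions" and t: "t \<in> {T..T + \<tau>}" for \<psi> t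
    unfolding \<mu>p_def \<mu>m_def
    by (intro transfer[OF \<psi> t] sets_K AE_nonneg sol_integrable U J0[OF t] \<psi>)+
  have emu: "emeasure (\<mu>p t) X = emeasure (Kp i j t) (age t -` X)" "emeasure (\<mu>m t) X = emeasure (Km i j t) (age t -` X)"
    if "0 \<le> t" "X \<in> sets borel" for t X
    unfolding \<mu>p_def \<mu>m_def using that age_meas[OF that(1)] space_K[OF that(1), of i j]
    by (simp_all add: emeasure_distr)
  interpret tail_measures w R0 T "T + \<tau>" V "F j" \<mu>p \<mu>m "f j" c
  proof unfold_locales
    show "T < T + \<tau>" using \<tau> by simp
    have V0: "0 \<le> V" using order_trans[OF TV_nonneg V[OF order_refl, of i j]] .
    show "0 \<le> V" by (fact V0)
    fix t assume t: "t \<in> {T..T + \<tau>}"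
    show "sets (\<mu>p t) = sets borel" "sets (\<mu>m t) = sets borel" by (simp_all add: \<mu>p_def \<mu>m_def)
    interpret kp: finite_measure "Kp i j t" using cond1' J0[OF t] by blast
    interpret km: finite_measure "Km i j t" using cond1' J0[OF t] by blast
    have mV: "measure (Kp i j t) UNIV \<le> V" "measure (Km i j t) UNIV \<le> V"
      using V[OF J0[OF t], of i j] measure_nonneg[of "Kp i j t" UNIV] measure_nonneg[of "Km i j t" UNIV]
      unfolding TV_def by linarith+
    show "emeasure (\<mu>p t) UNIV \<le> ennreal V" "emeasure (\<mu>m t) UNIV \<le> ennreal V"
      using mV by (auto simp: emu[OF J0[OF t]] kp.emeasure_eq_measure km.emeasure_eq_measure intro!: ennreal_leI)
    obtain S where S: "S \<in> sets borel" "emeasure (Kp i j t) (- S) = 0" "emeasure (Km i j t) S = 0"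
      using K_meas[rule_format, OF J0[OF t], of i j] unfolding LS_signed_def by blast
    define S' where "S' = (\<lambda>r. r - tau i j t + t) -` S"
    have S': "S' \<in> sets borel" unfolding S'_def
      by (rule measurable_sets_borel[OF _ S(1)]) measurable
    have "age t -` S' = S" "age t -` (- S') = - S" by (auto simp: S'_def age_def)
    then show "\<exists>S\<in>sets borel. emeasure (\<mu>p t) (- S) = 0 \<and> emeasure (\<mu>m t) S = 0"
      using S S' emu[OF J0[OF t]] by (intro bexI[of _ S']) auto
  next
    show "\<bar>f j x - f j y\<bar> \<le> F j * \<bar>x - y\<bar>" for x y by (rule lip_f)
    show "\<exists>p. k < \<bar>f j p\<bar>" for k by (rule unb)
  next
    fix \<psi> assume \<psi>: "\<psi> \<in> extensions"
    show "integrable (\<mu>p t) (\<lambda>s. f j (\<psi> s))" "integrable (\<mu>m t) (\<lambda>s. f j (\<psi> s))" if "t \<in> {T..T + \<tau>}" for t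
      using tp[OF \<psi> that] tm[OF \<psi> that] by blast+
    \<comment> \<open>Negative of the terms without delay, continuous along the solution. Adding its
      primitive to the solution component leaves the history integral as the derivative.\<close>
    define e where "e t = d i t * U \<psi> t $ i - (\<Sum>j'\<in>UNIV. a i j' t * g j' (U \<psi> t $ j')) - I i t" for t
    have coeff: "continuous_on {T..T + \<tau>} (d i)" "continuous_on {T..T + \<tau>} (I i)" "continuous_on {T..T + \<tau>} (a i j')" for j'
      using cont_d cont_I cont_a T by (auto intro: continuous_on_subset[of "{0..}"])
    have Uc: "continuous_on {T..T + \<tau>} (U \<psi>)"
      using sol_cont[OF U(1)[OF \<psi>]] by (rule continuous_on_subset) simp
    have ec: "continuous_on {T..T + \<tau>} e"
      unfolding e_def
      by (intro continuous_intros Uc coeff continuous_on_compose2[OF continuous_fg(2)]) auto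
    define W where "W t = U \<psi> t $ i + integral {T..t} e" for t
    have "(W has_real_derivative ((\<integral>s. f j (\<psi> s) \<partial>\<mu>p t) - (\<integral>s. f j (\<psi> s) \<partial>\<mu>m t) + c t)) (at t within {T..T + \<tau>})"
      if t: "t \<in> {T..T + \<tau>}" for t
    proof -
      have "sint i j' (\<lambda>r. f j' (U \<psi> r $ j')) t = sint i j' (\<lambda>r. f j' (u0 r $ j')) t" if "j' \<noteq> j" for j'
      proof -
        have ae: "AE s in M. f j' (U \<psi> (t - tau i j' t - s) $ j') = f j' (u0 (t - tau i j' t - s) $ j')"
          if "AE s in M. 0 \<le> s" for M
          using that by eventually_elim (simp add: U_other[OF \<psi> past[OF t] \<open>j' \<noteq> j\<close>])
        show ?thesis unfolding sint_def
          using sol_integrable[OF U(1)[OF \<psi>] J0[OF t], of i j'] sol_integrable[OF u0 J0[OF t], of i j']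
            ae[OF AE_nonneg(1)[OF J0[OF t], of i j']] ae[OF AE_nonneg(2)[OF J0[OF t], of i j']]
          by (intro arg_cong2[of _ _ _ _ "(-)"] integral_cong_AE) auto
      qed
      then have c_eq: "c t = (\<Sum>j'\<in>UNIV - {j}. sint i j' (\<lambda>r. f j' (U \<psi> r $ j')) t)"
        unfolding c_def by (intro sum.cong) auto
      have "(\<Sum>j'\<in>UNIV. sint i j' (\<lambda>r. f j' (U \<psi> r $ j')) t) = sint i j (\<lambda>r. f j (U \<psi> r $ j)) t + c t"
        unfolding c_eq by (simp add: sum.remove[of UNIV j])
      also have "sint i j (\<lambda>r. f j (U \<psi> r $ j)) t = (\<integral>s. f j (\<psi> s) \<partial>\<mu>p t) - (\<integral>s. f j (\<psi> s) \<partial>\<mu>m t)"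
        using tp[OF \<psi> t] tm[OF \<psi> t] by (simp add: sint_def)
      finally have eq: "(\<Sum>j'\<in>UNIV. sint i j' (\<lambda>r. f j' (U \<psi> r $ j')) t)
         = (\<integral>s. f j (\<psi> s) \<partial>\<mu>p t) - (\<integral>s. f j (\<psi> s) \<partial>\<mu>m t) + c t" .
      have d1: "((\<lambda>t. U \<psi> t $ i) has_real_derivative
         (- d i t * U \<psi> t $ i + (\<Sum>j\<in>UNIV. a i j t * g j (U \<psi> t $ j)) +
          ((\<integral>s. f j (\<psi> s) \<partial>\<mu>p t) - (\<integral>s. f j (\<psi> s) \<partial>\<mu>m t) + c t) + I i t)) (at t within {T..T + \<tau>})"
        using DERIV_subset[OF sol_deriv[OF U(1)[OF \<psi>] J0[OF t], of i], of "{T..T + \<tau>}"] T unfolding eq by auto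
      have d2: "((\<lambda>t. integral {T..t} e) has_real_derivative e t) (at t within {T..T + \<tau>})"
        by (rule integral_has_real_derivative[OF ec t])
      have "- d i t * U \<psi> t $ i + (\<Sum>j\<in>UNIV. a i j t * g j (U \<psi> t $ j)) +
          ((\<integral>s. f j (\<psi> s) \<partial>\<mu>p t) - (\<integral>s. f j (\<psi> s) \<partial>\<mu>m t) + c t) + I i t + e t
          = (\<integral>s. f j (\<psi> s) \<partial>\<mu>p t) - (\<integral>s. f j (\<psi> s) \<partial>\<mu>m t) + c t"
        by (simp add: e_def)
      from DERIV_add[OF d1 d2, unfolded this] show ?thesis unfolding W_def[abs_def] .
    qed
    then show "\<exists>W. \<forall>t\<in>{T..T + \<tau>}. (W has_real_derivative
        ((\<integral>s. f j (\<psi> s) \<partial>\<mu>p t) - (\<integral>s. f j (\<psi> s) \<partial>\<mu>m t) + c t)) (at t within {T..T + \<tau>})" by blast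
  qed
  obtain R where R: "\<And>t. t \<in> {T..T + \<tau>} \<Longrightarrow> null_beyond t R" using uniformly_null_beyond by blast
  have vimage: "age t -` {R<..} = {R + t - tau i j t <..}" for t by (auto simp: age_def)
  show ?thesis
  proof (intro exI[of _ R] ballI)
    fix t assume t: "t \<in> {T..T + \<tau>}"
    show "emeasure (Kp i j t) {R + t - tau i j t <..} = 0 \<and> emeasure (Km i j t) {R + t - tau i j t <..} = 0"
      using R[OF t] unfolding null_beyond_def by (simp add: emu[OF J0[OF t]] vimage)
  qed
qed

text \<open>Windows of the length of the smallest delay are chained until they cover one period;
  each needs the bound already established up to its start. Periodicity extends the result to all
  times.\<close>

lemma supp_bound_uniform:
  assumes unb: "\<And>k. \<exists>p. k < \<bar>f j p\<bar>"
  obtains R where "0 \<le> R" "\<And>t. 0 < t \<Longrightarrow> supp_bound j t R"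
proof -
  obtain \<tau> where \<tau>: "0 < \<tau>" "\<And>t i j. 0 \<le> t \<Longrightarrow> \<tau> \<le> tau i j t" using tau_lower by blast
  have win: "\<exists>R\<ge>0. \<forall>t. 0 < t \<longrightarrow> t \<le> real n * \<tau> \<longrightarrow> supp_bound j t R" for n
  proof (induction n)
    case 0 show ?case by (intro exI[of _ 0]) auto
  next
    case (Suc n)
    then obtain R0 where R0: "0 \<le> R0" "\<And>t. 0 < t \<Longrightarrow> t \<le> real n * \<tau> \<Longrightarrow> supp_bound j t R0" by blast
    define T where "T = real n * \<tau>"
    have T: "0 \<le> T" using \<tau> by (simp add: T_def)
    have "\<forall>i. \<exists>R. \<forall>t\<in>{T..T + \<tau>}. emeasure (Kp i j t) {R + t - tau i j t <..} = 0 \<and> emeasure (Km i j t) {R + t - tau i j t <..} = 0"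
      by (intro allI supp_bound_window[OF unb T \<tau> _ R0(1)]) (use R0(2) in \<open>auto simp: T_def\<close>)
    then obtain R where R: "\<And>i t. t \<in> {T..T + \<tau>} \<Longrightarrow> emeasure (Kp i j t) {R i + t - tau i j t <..} = 0 \<and> emeasure (Km i j t) {R i + t - tau i j t <..} = 0"
      by metis
    define R' where "R' = max R0 (Max (range R))"
    have Ri: "R i \<le> R'" for i unfolding R'_def by (rule order_trans[OF Max_ge max.cobounded2]) auto
    have "supp_bound j t R'" if t: "0 < t" "t \<le> real (Suc n) * \<tau>" for t
    proof (cases "t \<le> T")
      case True
      then have "supp_bound j t R0" using R0(2) t by (simp add: T_def)
      from supp_bound_mono[OF less_imp_le[OF t(1)] this, of R'] show ?thesis by (simp add: R'_def)
    next
      case False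
      then have tJ: "t \<in> {T..T + \<tau>}" using t by (simp add: T_def algebra_simps)
      show ?thesis unfolding supp_bound_def
      proof
        fix i show "emeasure (Kp i j t) {R' + t - tau i j t <..} = 0 \<and> emeasure (Km i j t) {R' + t - tau i j t <..} = 0"
          by (rule tail_null_mono[OF _ R[OF tJ, of i]]) (use t Ri[of i] in auto)
      qed
    qed
    moreover have "0 \<le> R'" using R0(1) by (simp add: R'_def)
    ultimately show ?case by blast
  qed
  obtain n where n: "\<omega> < real n * \<tau>" using ex_less_of_nat_mult[OF \<tau>(1)] by blast
  obtain R where R: "0 \<le> R" "\<And>t. 0 < t \<Longrightarrow> t \<le> real n * \<tau> \<Longrightarrow> supp_bound j t R" using win[of n] by blast
  have "supp_bound j t R" if t: "0 < t" for t
  proof -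
    \<comment> \<open>The ceiling minus one places the remainder in (0, \<omega>], avoiding time 0,
      where the bound is not asserted.\<close>
    define k where "k = nat (\<lceil>t / \<omega>\<rceil> - 1)"
    define t0 where "t0 = t - real k * \<omega>"
    have "0 < t / \<omega>" using t omega_pos by simp
    then have "0 < \<lceil>t / \<omega>\<rceil>" by simp
    then have "real k = of_int \<lceil>t / \<omega>\<rceil> - 1" by (simp add: k_def)
    then have "real k < t / \<omega>" "t / \<omega> \<le> real k + 1" by linarith+
    then have "real k * \<omega> < t" "t \<le> real k * \<omega> + \<omega>" using omega_pos by (simp_all add: field_simps)
    then have t0: "0 < t0" "t0 \<le> \<omega>" by (simp_all add: t0_def)
    have tt: "t = t0 + real k * \<omega>" by (simp add: t0_def)
    have sb: "supp_bound j t0 R" using R(2)[OF t0(1)] t0 n by simp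
    have t0': "0 \<le> t0" using t0 by simp
    show ?thesis unfolding supp_bound_def
    proof
      fix i
      \<comment> \<open>Going k periods forward leaves the kernels unchanged and moves the threshold
        up by k * \<omega>, so the same R still works.\<close>
      show "emeasure (Kp i j t) {R + t - tau i j t <..} = 0 \<and> emeasure (Km i j t) {R + t - tau i j t <..} = 0"
        unfolding tt K_shift[OF t0']
        by (rule tail_null_mono[OF t0', of i j "R + t0 - tau i j t0"])
          (use sb omega_pos in \<open>auto simp: supp_bound_def\<close>)
    qed
  qed
  then show ?thesis using that R(1) by blast
qed

text \<open>Initial functions may be unbounded: where f is bounded its increments are trivially
  controlled, and where it is unbounded only a bounded part of the history is ever seen.\<close>

lemma exponential_decay:
  assumes u: "sol u" and v: "sol v" and \<alpha>: "0 \<le> \<alpha>" and cond: "decay_condition \<alpha>"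
  shows "\<exists>Q. \<forall>t\<ge>0. \<forall>i. \<bar>u t $ i - v t $ i\<bar> \<le> \<xi> i * Q * exp (- \<alpha> * t)"
proof -
  define inc where "inc j r = \<bar>f j (u r $ j) - f j (v r $ j)\<bar>" for j r
  \<comment> \<open>This is where \<alpha> \<ge> 0 enters: on the past the envelope is at least 1,
    so constant bounds on increments of f suffice.\<close>
  have ge1: "1 \<le> exp (- \<alpha> * r)" if "r \<le> 0" for r
    using mult_nonneg_nonpos[OF \<alpha> that] by simp
  have "\<exists>Q\<ge>0. \<forall>t>0. \<forall>i.
     (AE s in Kp i j t. t - tau i j t - s \<le> 0 \<longrightarrow> inc j (t - tau i j t - s) \<le> F j * \<xi> j * Q * exp (- \<alpha> * (t - tau i j t - s))) \<and>
     (AE s in Km i j t. t - tau i j t - s \<le> 0 \<longrightarrow> inc j (t - tau i j t - s) \<le> F j * \<xi> j * Q * exp (- \<alpha> * (t - tau i j t - s)))" for j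
  proof (cases "\<exists>k. \<forall>p. \<bar>f j p\<bar> \<le> k")
    case True
    then obtain k where k: "\<And>p. \<bar>f j p\<bar> \<le> k" by blast
    have k0: "0 \<le> k" using k[of 0] by linarith
    have pos: "0 < F j * \<xi> j" using F_pos xi_pos by simp
    have "inc j r \<le> F j * \<xi> j * (2 * k / (F j * \<xi> j)) * exp (- \<alpha> * r)" if "r \<le> 0" for r
    proof -
      have "inc j r \<le> 2 * k" unfolding inc_def using k[of "u r $ j"] k[of "v r $ j"] by linarith
      also have "\<dots> \<le> 2 * k * exp (- \<alpha> * r)" using ge1[OF that] k0 by (simp add: mult_le_cancel_left1)
      finally show ?thesis using F_pos[rule_format, of j] xi_pos[rule_format, of j] by simp
    qed
    then show ?thesis using k0 pos by (intro exI[of _ "2 * k / (F j * \<xi> j)"]) auto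
  next
    case False
    then have unb: "\<exists>p. k < \<bar>f j p\<bar>" for k by (meson not_le)
    obtain R where R: "0 \<le> R" "\<And>t. 0 < t \<Longrightarrow> supp_bound j t R"
      using supp_bound_uniform[of j, OF unb] by blast
    have "continuous_on {- R..0} (\<lambda>r. u r $ j - v r $ j)"
      using sol_cont[OF u] sol_cont[OF v] by (intro continuous_intros) (auto intro: continuous_on_subset)
    then have "bounded ((\<lambda>r. u r $ j - v r $ j) ` {- R..0})"
      by (intro compact_imp_bounded compact_continuous_image compact_Icc)
    then obtain Y where "\<forall>r\<in>{- R..0}. \<bar>u r $ j - v r $ j\<bar> \<le> Y" unfolding bounded_iff by auto
    then have Y: "\<bar>u r $ j - v r $ j\<bar> \<le> Y" if "r \<in> {- R..0}" for r using that by blast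
    have Y0: "0 \<le> Y" using Y[of 0] R(1) by simp
    have seen: "inc j r \<le> F j * \<xi> j * (Y / \<xi> j) * exp (- \<alpha> * r)" if "r \<le> 0" "- R \<le> r" for r
    proof -
      have "inc j r \<le> F j * \<bar>u r $ j - v r $ j\<bar>" unfolding inc_def by (rule lip_f)
      also have "\<dots> \<le> F j * Y" using Y[of r] that F_pos by (intro mult_left_mono) (auto intro: less_imp_le)
      also have "\<dots> \<le> F j * Y * exp (- \<alpha> * r)" 
        using mult_left_mono[OF ge1[OF that(1)], of "F j * Y"] Y0 F_pos[rule_format, of j] by simp
      finally show ?thesis using xi_pos[rule_format, of j] by simp
    qed
    have "(AE s in Kp i j t. t - tau i j t - s \<le> 0 \<longrightarrow> inc j (t - tau i j t - s) \<le> F j * \<xi> j * (Y / \<xi> j) * exp (- \<alpha> * (t - tau i j t - s))) \<and>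
     (AE s in Km i j t. t - tau i j t - s \<le> 0 \<longrightarrow> inc j (t - tau i j t - s) \<le> F j * \<xi> j * (Y / \<xi> j) * exp (- \<alpha> * (t - tau i j t - s)))"
      if t: "0 < t" for t i
    proof
      note A = supp_bound_AE[OF less_imp_le[OF t] R(2)[OF t], of i]
      show "AE s in Kp i j t. t - tau i j t - s \<le> 0 \<longrightarrow> inc j (t - tau i j t - s) \<le> F j * \<xi> j * (Y / \<xi> j) * exp (- \<alpha> * (t - tau i j t - s))"
        using A(1) by eventually_elim (use seen in blast)
      show "AE s in Km i j t. t - tau i j t - s \<le> 0 \<longrightarrow> inc j (t - tau i j t - s) \<le> F j * \<xi> j * (Y / \<xi> j) * exp (- \<alpha> * (t - tau i j t - s))"
        using A(2) by eventually_elim (use seen in blast)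
    qed
    moreover have "0 \<le> Y / \<xi> j" using Y0 xi_pos[rule_format, of j] by simp
    ultimately show ?thesis by blast
  qed
  then have "\<exists>q. \<forall>j. 0 \<le> q j \<and> (\<forall>t>0. \<forall>i.
     (AE s in Kp i j t. t - tau i j t - s \<le> 0 \<longrightarrow> inc j (t - tau i j t - s) \<le> F j * \<xi> j * q j * exp (- \<alpha> * (t - tau i j t - s))) \<and>
     (AE s in Km i j t. t - tau i j t - s \<le> 0 \<longrightarrow> inc j (t - tau i j t - s) \<le> F j * \<xi> j * q j * exp (- \<alpha> * (t - tau i j t - s))))"
    by (intro choice allI)
  then obtain q where q: "\<forall>j. 0 \<le> q j \<and> (\<forall>t>0. \<forall>i.
     (AE s in Kp i j t. t - tau i j t - s \<le> 0 \<longrightarrow> inc j (t - tau i j t - s) \<le> F j * \<xi> j * q j * exp (- \<alpha> * (t - tau i j t - s))) \<and>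
     (AE s in Km i j t. t - tau i j t - s \<le> 0 \<longrightarrow> inc j (t - tau i j t - s) \<le> F j * \<xi> j * q j * exp (- \<alpha> * (t - tau i j t - s))))"
    by blast
  then have q0: "\<And>j. 0 \<le> q j"
    and qp: "\<And>j t i. 0 < t \<Longrightarrow> AE s in Kp i j t. t - tau i j t - s \<le> 0 \<longrightarrow> inc j (t - tau i j t - s) \<le> F j * \<xi> j * q j * exp (- \<alpha> * (t - tau i j t - s))"
    and qm: "\<And>j t i. 0 < t \<Longrightarrow> AE s in Km i j t. t - tau i j t - s \<le> 0 \<longrightarrow> inc j (t - tau i j t - s) \<le> F j * \<xi> j * q j * exp (- \<alpha> * (t - tau i j t - s))"
    by blast+
  define z where "z i = \<bar>u 0 $ i - v 0 $ i\<bar> / \<xi> i" for i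
  have z0: "0 \<le> z i" for i using xi_pos[rule_format, of i] by (simp add: z_def)
  define Q where "Q = (\<Sum>j\<in>UNIV. q j) + (\<Sum>i\<in>UNIV. z i)"
  have "q j \<le> (\<Sum>j\<in>UNIV. q j)" "z j \<le> (\<Sum>j\<in>UNIV. z j)" for j
    using q0 z0 by (intro member_le_sum; simp)+
  moreover have "0 \<le> (\<Sum>j\<in>UNIV. q j)" "0 \<le> (\<Sum>j\<in>UNIV. z j)"
    using q0 z0 by (intro sum_nonneg; simp)+
  ultimately have qQ: "q j \<le> Q" and zQ: "z j \<le> Q" for j
    unfolding Q_def by (meson add_increasing add_increasing2)+
  have Q0: "0 \<le> Q" using qQ q0 order_trans by blast
  have up: "inc j r \<le> F j * \<xi> j * Q * exp (- \<alpha> * r)" if "inc j r \<le> F j * \<xi> j * q j * exp (- \<alpha> * r)" for j r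
  proof -
    have "F j * \<xi> j * q j * exp (- \<alpha> * r) \<le> F j * \<xi> j * Q * exp (- \<alpha> * r)"
      using qQ[of j] F_pos[rule_format, of j] xi_pos[rule_format, of j] by (intro mult_right_mono mult_left_mono) auto
    with that show ?thesis by linarith
  qed
  have "\<bar>u T $ i - v T $ i\<bar> \<le> \<xi> i * Q * exp (- \<alpha> * T)" if T: "0 \<le> T" for T i
  proof (rule comparison[OF u v cond Q0 T])
    show "\<bar>u 0 $ i - v 0 $ i\<bar> \<le> \<xi> i * Q" for i
      using mult_left_mono[OF zQ[of i], of "\<xi> i"] xi_pos[rule_format, of i] by (simp add: z_def)
    fix t i j assume t: "0 < (t::real)"
    show "AE s in Kp i j t. t - tau i j t - s \<le> 0 \<longrightarrow>
        \<bar>f j (u (t - tau i j t - s) $ j) - f j (v (t - tau i j t - s) $ j)\<bar> \<le> F j * \<xi> j * Q * exp (- \<alpha> * (t - tau i j t - s))"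
      using qp[OF t, of i j] by eventually_elim (use up in \<open>auto simp: inc_def\<close>)
    show "AE s in Km i j t. t - tau i j t - s \<le> 0 \<longrightarrow>
        \<bar>f j (u (t - tau i j t - s) $ j) - f j (v (t - tau i j t - s) $ j)\<bar> \<le> F j * \<xi> j * Q * exp (- \<alpha> * (t - tau i j t - s))"
      using qm[OF t, of i j] by eventually_elim (use up in \<open>auto simp: inc_def\<close>)
  qed
  then show ?thesis by blast
qed

text \<open>For negative \<alpha> the envelope grows, and the bound at rate 0, which rests on the
  row condition alone, is already stronger.\<close>

lemma decay_bigo:
  assumes u: "sol u" and v: "sol v" and cond: "decay_condition \<alpha>"
  shows "(\<lambda>t. norm (u t - v t)) \<in> O[at_top](\<lambda>t. exp (- \<alpha> * t))"
proof -
  have "\<exists>Q. \<forall>t\<ge>0. \<forall>i. \<bar>u t $ i - v t $ i\<bar> \<le> \<xi> i * Q * exp (- \<alpha> * t)"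
  proof (cases "0 \<le> \<alpha>")
    case True then show ?thesis using exponential_decay[OF u v _ cond] by blast
  next
    case False
    obtain Q where Q: "\<And>t i. 0 \<le> t \<Longrightarrow> \<bar>u t $ i - v t $ i\<bar> \<le> \<xi> i * Q * exp (- 0 * t)"
      using exponential_decay[OF u v order_refl decay_condition_zero] by blast
    have "\<bar>u t $ i - v t $ i\<bar> \<le> \<xi> i * Q * exp (- \<alpha> * t)" if t: "0 \<le> t" for t i
    proof -
      have 1: "\<bar>u t $ i - v t $ i\<bar> \<le> \<xi> i * Q" using Q[OF t, of i] by simp
      then have "0 \<le> \<xi> i * Q" using abs_ge_zero order_trans by blast
      moreover have "1 \<le> exp (- \<alpha> * t)" using False t by (simp add: mult_nonpos_nonneg)
      ultimately have "\<xi> i * Q * 1 \<le> \<xi> i * Q * exp (- \<alpha> * t)" by (intro mult_left_mono) auto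
      with 1 show ?thesis by simp
    qed
    then show ?thesis by blast
  qed
  then obtain Q where Q: "\<And>t i. 0 \<le> t \<Longrightarrow> \<bar>u t $ i - v t $ i\<bar> \<le> \<xi> i * Q * exp (- \<alpha> * t)" by blast
  show ?thesis
  proof (rule bigoI[of _ "\<Sum>i\<in>UNIV. \<xi> i * Q"], rule eventually_mono[OF eventually_ge_at_top[of 0]])
    fix t :: real assume t: "0 \<le> t"
    have "norm (u t - v t) \<le> (\<Sum>i\<in>UNIV. \<bar>(u t - v t) $ i\<bar>)" by (rule norm_le_l1_cart)
    also have "\<dots> \<le> (\<Sum>i\<in>UNIV. \<xi> i * Q * exp (- \<alpha> * t))" using Q[OF t] by (intro sum_mono) simp
    finally show "norm (norm (u t - v t)) \<le> (\<Sum>i\<in>UNIV. \<xi> i * Q) * norm (exp (- \<alpha> * t))"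
      by (simp add: sum_distrib_right)
  qed
qed

end

section \<open>Existence of a periodic solution\<close>

lemma cos_le_cos_of_far:
  assumes "0 \<le> \<delta>" "\<delta> \<le> \<bar>\<theta>\<bar>" "\<bar>\<theta>\<bar> \<le> 2 * pi - \<delta>"
  shows "cos \<theta> \<le> cos \<delta>"
proof (cases "\<bar>\<theta>\<bar> \<le> pi")
  case True
  have "cos \<bar>\<theta>\<bar> \<le> cos \<delta>" by (rule cos_monotone_0_pi_le) (use assms True in auto)
  then show ?thesis by simp
next
  case False
  have "cos (2 * pi - \<bar>\<theta>\<bar>) \<le> cos \<delta>" by (rule cos_monotone_0_pi_le) (use assms False in auto)
  then show ?thesis by (simp add: cos_diff)
qed

text \<open>Truncated cosines, periodic by nature, positive exactly within one mesh width of their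
  node on the circle, then normalised. The node N at time \<omega> is also the node at time 0, which
  accounts for the second alternative in the localisation.\<close>

lemma periodic_partition_of_unity:
  fixes \<omega> :: real and N :: nat
  assumes \<omega>: "0 < \<omega>" and N: "2 \<le> N"
  obtains \<Lambda> :: "nat \<Rightarrow> real \<Rightarrow> real" where
    "\<And>k. continuous_on UNIV (\<Lambda> k)" "\<And>k s. 0 \<le> \<Lambda> k s" "\<And>k s. \<Lambda> k (s + \<omega>) = \<Lambda> k s"
    "\<And>s. (\<Sum>k\<in>{1..N}. \<Lambda> k s) = 1"
    "\<And>k s. k \<in> {1..N} \<Longrightarrow> s \<in> {0..\<omega>} \<Longrightarrow> \<Lambda> k s \<noteq> 0 \<Longrightarrow>
        \<bar>s - real k * (\<omega> / real N)\<bar> < \<omega> / real N \<or> (k = N \<and> s < \<omega> / real N)"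
proof -
  define h where "h = \<omega> / real N"
  define \<delta> where "\<delta> = 2 * pi / real N"
  have h: "0 < h" "real N * h = \<omega>" using \<omega> N by (auto simp: h_def)
  have \<delta>: "0 < \<delta>" "\<delta> \<le> pi" using N pi_gt_zero by (auto simp: \<delta>_def field_simps)
  have ang: "2 * pi * x / \<omega> = \<delta> * (x / h)" for x
    using \<omega> N by (simp add: \<delta>_def h_def)
  define b where "b k s = max 0 (cos (2 * pi * (s - real k * h) / \<omega>) - cos \<delta>)" for k s
  have b0: "0 \<le> b k s" for k s by (simp add: b_def)
  have bcont: "continuous_on UNIV (b k)" for k
    unfolding b_def[abs_def] using \<omega> by (intro continuous_intros) auto
  have bper: "b k (s + \<omega>) = b k s" for k s
  proof -
    have "2 * pi * (s + \<omega> - real k * h) / \<omega> = 2 * pi * (s - real k * h) / \<omega> + 2 * pi"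
      using \<omega> by (simp add: field_simps)
    then show ?thesis by (simp add: b_def)
  qed
  have bpos: "0 < (\<Sum>k\<in>{1..N}. b k s)" for s
  proof -
    \<comment> \<open>Index of the grid cell containing s. The shifts by one around
      \<open>mod\<close> select its representative among 1, ..., N instead of 0, ..., N - 1.\<close>
    define k0 where "k0 = \<lfloor>s / h\<rfloor>"
    define m where "m = (k0 - 1) mod int N"
    define z where "z = (k0 - 1) div int N"
    define k where "k = nat m + 1"
    have m: "0 \<le> m" "m < int N" using N by (auto simp: m_def)
    then have k: "k \<in> {1..N}" by (auto simp: k_def)
    have "k0 - 1 = z * int N + m" by (simp add: z_def m_def)
    then have "int k = k0 - z * int N" using m by (simp add: k_def)
    then have rk: "real k = of_int k0 - of_int z * real N"
      by (metis of_int_diff of_int_mult of_int_of_nat_eq)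
    have "real k * h = of_int k0 * h - of_int z * \<omega>"
      unfolding rk by (simp add: left_diff_distrib h(2) mult.assoc)
    then have "s - real k * h = (s - of_int k0 * h) + of_int z * \<omega>" by simp
    then have eq: "2 * pi * (s - real k * h) / \<omega> = \<delta> * ((s - of_int k0 * h) / h) + (2 * pi) * of_int z"
      using \<omega> unfolding ang[symmetric] by (simp add: field_simps)
    have "of_int k0 \<le> s / h" "s / h < of_int k0 + 1" by (simp_all add: k0_def floor_correct)
    then have fr: "0 \<le> (s - of_int k0 * h) / h" "(s - of_int k0 * h) / h < 1" using h by (simp_all add: field_simps)
    have "cos (2 * pi * (s - real k * h) / \<omega>) = cos (\<delta> * ((s - of_int k0 * h) / h))"
      unfolding eq by (simp add: cos_add)
    moreover have "cos \<delta> < cos (\<delta> * ((s - of_int k0 * h) / h))"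
    proof (rule cos_monotone_0_pi)
      show "\<delta> * ((s - of_int k0 * h) / h) < \<delta>" using mult_strict_left_mono[OF fr(2) \<delta>(1)] by simp
      show "0 \<le> \<delta> * ((s - of_int k0 * h) / h)" using fr \<delta> by (intro mult_nonneg_nonneg) auto
    qed (use \<delta> in auto)
    ultimately have "0 < b k s" by (simp add: b_def)
    then show ?thesis using k b0 by (intro sum_pos2[of _ k]) auto
  qed
  have bloc: "\<bar>s - real k * h\<bar> < h \<or> (k = N \<and> s < h)" if k: "k \<in> {1..N}" and s: "s \<in> {0..\<omega>}" and nz: "b k s \<noteq> 0" for k s
  proof (rule ccontr)
    assume far: "\<not> ?thesis"
    have "real 1 * h \<le> real k * h" "real k * h \<le> real N * h" using k h by (intro mult_right_mono; simp)+
    then have kh: "h \<le> real k * h" "real k * h \<le> \<omega>" using h by simp_all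
    have up: "\<bar>s - real k * h\<bar> \<le> \<omega> - h"
    proof (cases "k = N")
      case True
      then have "h \<le> s" using far by auto
      then show ?thesis using s True h by auto
    next
      case False
      then have "real k + 1 \<le> real N" using k by auto
      then have "(real k + 1) * h \<le> real N * h" using h by (intro mult_right_mono) auto
      then have "real k * h \<le> \<omega> - h" using h(2) by (simp add: distrib_right)
      moreover have "0 \<le> s" "s \<le> \<omega>" using s by auto
      ultimately show ?thesis using kh(1) by linarith
    qed
    have lo: "1 \<le> \<bar>s - real k * h\<bar> / h" using far h by (auto simp: field_simps not_less)
    have hi: "\<bar>s - real k * h\<bar> / h \<le> real N - 1" using up h by (simp add: field_simps)
    have "\<bar>\<delta> * ((s - real k * h) / h)\<bar> = \<delta> * (\<bar>s - real k * h\<bar> / h)" using \<delta> h by (simp add: abs_mult)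
    moreover have "\<delta> * 1 \<le> \<delta> * (\<bar>s - real k * h\<bar> / h)" "\<delta> * (\<bar>s - real k * h\<bar> / h) \<le> \<delta> * (real N - 1)"
      using lo hi \<delta> by (intro mult_left_mono; simp)+
    moreover have "\<delta> * (real N - 1) = 2 * pi - \<delta>" using N by (simp add: \<delta>_def field_simps)
    ultimately have "cos (\<delta> * ((s - real k * h) / h)) \<le> cos \<delta>"
      using \<delta> by (intro cos_le_cos_of_far) auto
    then have "b k s = 0" by (simp add: b_def ang)
    with nz show False by simp
  qed
  show ?thesis
  proof (rule that[of "\<lambda>k s. b k s / (\<Sum>l\<in>{1..N}. b l s)"])
    show "continuous_on UNIV (\<lambda>s. b k s / (\<Sum>l\<in>{1..N}. b l s))" for k
      using bpos by (intro continuous_intros bcont ballI) (metis less_irrefl)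
    show "0 \<le> b k s / (\<Sum>l\<in>{1..N}. b l s)" for k s using b0 bpos[of s] by (simp add: less_imp_le)
    show "b k (s + \<omega>) / (\<Sum>l\<in>{1..N}. b l (s + \<omega>)) = b k s / (\<Sum>l\<in>{1..N}. b l s)" for k s by (simp add: bper)
    show "(\<Sum>k\<in>{1..N}. b k s / (\<Sum>l\<in>{1..N}. b l s)) = 1" for s
      using bpos[of s] by (simp add: sum_divide_distrib[symmetric])
    show "\<bar>s - real k * (\<omega> / real N)\<bar> < \<omega> / real N \<or> (k = N \<and> s < \<omega> / real N)"
      if "k \<in> {1..N}" "s \<in> {0..\<omega>}" "b k s / (\<Sum>l\<in>{1..N}. b l s) \<noteq> 0" for k s
      using bloc[OF that(1,2)] that(3) by (simp add: h_def)
  qed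
qed

section \<open>The discretised period map and the passage to the limit\<close>

context delay_system
begin

lemma sol_shift:
  assumes u: "sol u" shows "sol (\<lambda>t. u (t + \<omega>))"
  unfolding is_solution_def
proof (intro conjI allI impI)
  show "continuous_on UNIV (\<lambda>t. u (t + \<omega>))"
    by (intro continuous_on_compose2[OF sol_cont[OF u]] continuous_intros) auto
  fix t :: real assume t: "0 \<le> t"
  then have t\<omega>: "0 \<le> t + \<omega>" using omega_pos by simp
  note p = per[rule_format, OF t]
  have arg: "t - tau i j t - s + \<omega> = t + \<omega> - tau i j (t + \<omega>) - s" for i j s using p by simp
  show "integrable (Kp i j t) (\<lambda>s. f j (u (t - tau i j t - s + \<omega>) $ j))"
    "integrable (Km i j t) (\<lambda>s. f j (u (t - tau i j t - s + \<omega>) $ j))" for i j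
    unfolding arg using sol_integrable[OF u t\<omega>, of i j] p by simp_all
  have rhs: "dde_rhs d a I tau Kp Km g f (\<lambda>t. u (t + \<omega>)) t = dde_rhs d a I tau Kp Km g f u (t + \<omega>)"
    unfolding dde_rhs_def arg using p by (simp add: vec_eq_iff)
  have "(u has_vector_derivative dde_rhs d a I tau Kp Km g f u (t + \<omega>)) (at (t + \<omega>) within {0..})"
    using u t\<omega> by (auto simp: is_solution_def)
  then have du: "(u has_vector_derivative dde_rhs d a I tau Kp Km g f u (t + \<omega>)) (at (t + \<omega>) within (\<lambda>t. t + \<omega>) ` {0..})"
    by (rule has_vector_derivative_within_subset) (use omega_pos in auto)
  have "((\<lambda>t. t + \<omega>) has_vector_derivative 1) (at t within {0..})"
    by (auto intro!: derivative_eq_intros)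
  from vector_diff_chain_within[OF this du] show "((\<lambda>t. u (t + \<omega>)) has_vector_derivative dde_rhs d a I tau Kp Km g f (\<lambda>t. u (t + \<omega>)) t) (at t within {0..})"
    unfolding rhs by (simp add: o_def)
qed

text \<open>L depends on the box alone. It serves as the interpolation error at every mesh and as
  the common modulus of continuity for Arzela-Ascoli.\<close>

lemma sol_lipschitz:
  obtains L where "0 \<le> L" "\<And>u i s t. sol u \<Longrightarrow> (\<And>s j. \<bar>u s $ j\<bar> \<le> \<xi> j * M) \<Longrightarrow> 0 \<le> s \<Longrightarrow> 0 \<le> t \<Longrightarrow> \<bar>u s $ i - u t $ i\<bar> \<le> L * \<bar>s - t\<bar>"
proof -
  obtain B where B: "\<And>t i j. 0 \<le> t \<Longrightarrow> \<bar>d i t\<bar> \<le> B \<and> \<bar>I i t\<bar> \<le> B \<and> \<bar>a i j t\<bar> \<le> B \<and> TV i j t \<le> B"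
    using coefficient_bound by blast
  have B0: "0 \<le> B" using B[of 0] abs_ge_zero order_trans by blast
  have mm: "x * c \<le> B * \<bar>c\<bar>" if "0 \<le> x" "x \<le> B" for x c :: real
    using mult_left_mono[OF abs_ge_self[of c] that(1)] mult_right_mono[OF that(2) abs_ge_zero[of c]] by linarith
  define L where "L = (\<Sum>i\<in>UNIV. B * \<bar>\<xi> i * M\<bar> + (\<Sum>j\<in>UNIV. B * \<bar>G j * (\<xi> j * M) + C j\<bar>) + (\<Sum>j\<in>UNIV. B * \<bar>F j * (\<xi> j * M) + D j\<bar>) + B)"
  have L0: "0 \<le> L" unfolding L_def using B0 by (intro sum_nonneg add_nonneg_nonneg mult_nonneg_nonneg) auto
  have "\<bar>u s $ i - u t $ i\<bar> \<le> L * \<bar>s - t\<bar>"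
    if u: "sol u" and box: "\<And>s j. \<bar>u s $ j\<bar> \<le> \<xi> j * M" and st: "0 \<le> s" "0 \<le> t" for u i s t
  proof -
    define X where "X t = - d i t * u t $ i + (\<Sum>j\<in>UNIV. a i j t * g j (u t $ j)) + (\<Sum>j\<in>UNIV. sint i j (\<lambda>r. f j (u r $ j)) t) + I i t" for t
    have bX: "\<bar>X z\<bar> \<le> L" if z: "0 \<le> z" for z
    proof -
      have b1: "\<bar>- d i z * u z $ i\<bar> \<le> B * \<bar>\<xi> i * M\<bar>"
        unfolding abs_mult[of "- d i z"] using B[OF z, of i i] box[of z i] by (intro mult_mono) auto
      have "\<bar>a i j z * g j (u z $ j)\<bar> \<le> B * \<bar>G j * (\<xi> j * M) + C j\<bar>" for j
        by (rule order_trans[OF sol_term_bounds(1)[OF u z box]]) (use B[OF z, of i j] in \<open>intro mm; simp\<close>)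
      then have b2: "\<bar>\<Sum>j\<in>UNIV. a i j z * g j (u z $ j)\<bar> \<le> (\<Sum>j\<in>UNIV. B * \<bar>G j * (\<xi> j * M) + C j\<bar>)"
        by (intro order_trans[OF sum_abs] sum_mono)
      have "\<bar>sint i j (\<lambda>r. f j (u r $ j)) z\<bar> \<le> B * \<bar>F j * (\<xi> j * M) + D j\<bar>" for j
        by (rule order_trans[OF sol_term_bounds(2)[OF u z box]]) (use B[OF z, of i j] TV_nonneg in \<open>intro mm; simp\<close>)
      then have b3: "\<bar>\<Sum>j\<in>UNIV. sint i j (\<lambda>r. f j (u r $ j)) z\<bar> \<le> (\<Sum>j\<in>UNIV. B * \<bar>F j * (\<xi> j * M) + D j\<bar>)"
        by (intro order_trans[OF sum_abs] sum_mono)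
      have "\<bar>X z\<bar> \<le> B * \<bar>\<xi> i * M\<bar> + (\<Sum>j\<in>UNIV. B * \<bar>G j * (\<xi> j * M) + C j\<bar>) + (\<Sum>j\<in>UNIV. B * \<bar>F j * (\<xi> j * M) + D j\<bar>) + B"
        unfolding X_def using b1 b2 b3 B[OF z, of i i] by linarith
      also have "\<dots> \<le> L" unfolding L_def
        by (rule member_le_sum[of i]) (use B0 in \<open>auto intro!: sum_nonneg add_nonneg_nonneg mult_nonneg_nonneg\<close>)
      finally show ?thesis .
    qed
    have "norm (u s $ i - u t $ i) \<le> L * norm (s - t)"
    proof (rule field_differentiable_bound[of "{0..}" "\<lambda>t. u t $ i" X])
      show "((\<lambda>t. u t $ i) has_field_derivative X z) (at z within {0..})" if "z \<in> {0..}" for z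
        unfolding X_def using that by (intro sol_deriv[OF u]) simp
    qed (use bX st in auto)
    then show ?thesis by simp
  qed
  then show ?thesis using that L0 by blast
qed

text \<open>The unknowns are the values of all components at the nodes; they are interpolated to a
  periodic history, and \<Phi> reads off the resulting solution at the nodes. At a fixed point
  history and solution agree at the nodes; elsewhere in the period the weights average over nodes
  within one mesh width, which costs at most L * h.\<close>

lemma approximate_periodic_solution:
  assumes N: "2 \<le> N" and M: "0 < M"
    and box: "\<And>u t i. sol u \<Longrightarrow> (\<And>s i. s \<le> 0 \<Longrightarrow> \<bar>u s $ i\<bar> \<le> \<xi> i * M) \<Longrightarrow> 0 \<le> t \<Longrightarrow> \<bar>u t $ i\<bar> \<le> \<xi> i * M"
    and L: "0 \<le> L" "\<And>u i s t. sol u \<Longrightarrow> (\<And>s j. \<bar>u s $ j\<bar> \<le> \<xi> j * M) \<Longrightarrow> 0 \<le> s \<Longrightarrow> 0 \<le> t \<Longrightarrow> \<bar>u s $ i - u t $ i\<bar> \<le> L * \<bar>s - t\<bar>"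
  shows "\<exists>u \<phi>. sol u \<and> (\<forall>s j. \<bar>u s $ j\<bar> \<le> \<xi> j * M) \<and> continuous_on UNIV \<phi> \<and> (\<forall>s. \<phi> (s + \<omega>) = \<phi> s) \<and>
     (\<forall>s\<le>0. u s = \<phi> s) \<and> (\<forall>s\<in>{0..\<omega>}. \<forall>i. \<bar>\<phi> s $ i - u s $ i\<bar> \<le> L * (\<omega> / real N))"
proof -
  define h where "h = \<omega> / real N"
  have h: "0 < h" "real N * h = \<omega>" using omega_pos N by (auto simp: h_def)
  obtain \<Lambda> :: "nat \<Rightarrow> real \<Rightarrow> real" where \<Lambda>: "\<And>k. continuous_on UNIV (\<Lambda> k)" "\<And>k s. 0 \<le> \<Lambda> k s" "\<And>k s. \<Lambda> k (s + \<omega>) = \<Lambda> k s"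
    and one: "\<And>s. (\<Sum>k\<in>{1..N}. \<Lambda> k s) = 1"
    and near: "\<And>k s. k \<in> {1..N} \<Longrightarrow> s \<in> {0..\<omega>} \<Longrightarrow> \<Lambda> k s \<noteq> 0 \<Longrightarrow>
        \<bar>s - real k * h\<bar> < h \<or> (k = N \<and> s < h)"
    unfolding h_def using periodic_partition_of_unity[OF omega_pos N] by blast
  define \<phi> where "\<phi> p s = (\<chi> i. \<Sum>k\<in>{1..N}. \<Lambda> k s * p (i, k))" for p :: "'n \<times> nat \<Rightarrow> real" and s
  define A where "A = (UNIV :: 'n set) \<times> {1..N}"
  define \<Phi> where "\<Phi> p = (\<lambda>(i, k). sol_of (\<phi> p) (real k * h) $ i)" for p
  have \<phi>_cont: "continuous_on UNIV (\<phi> p)" for p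
    unfolding \<phi>_def[abs_def] by (intro continuous_on_vec_lambda continuous_intros \<Lambda>)
  then have \<phi>_cont0: "continuous_on {..0} (\<phi> p)" for p by (rule continuous_on_subset) simp
  have mean: "\<bar>(\<Sum>k\<in>{1..N}. \<Lambda> k s * y k) - z\<bar> \<le> e"
    if "\<And>k. k \<in> {1..N} \<Longrightarrow> \<Lambda> k s \<noteq> 0 \<Longrightarrow> \<bar>y k - z\<bar> \<le> e" for y z e s
  proof -
    have "(\<Sum>k\<in>{1..N}. \<Lambda> k s * y k) - z = (\<Sum>k\<in>{1..N}. \<Lambda> k s * (y k - z))"
      using one[of s] by (simp add: right_diff_distrib sum_subtractf sum_distrib_right[symmetric])
    also have "\<bar>\<dots>\<bar> \<le> (\<Sum>k\<in>{1..N}. \<Lambda> k s * e)"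
    proof (rule order_trans[OF sum_abs sum_mono])
      fix k assume k: "k \<in> {1..N}"
      show "\<bar>\<Lambda> k s * (y k - z)\<bar> \<le> \<Lambda> k s * e"
        using that[OF k] \<Lambda>(2)[of k s] by (cases "\<Lambda> k s = 0") (auto simp: abs_mult intro: mult_left_mono)
    qed
    also have "\<dots> = e" using one[of s] by (simp add: sum_distrib_right[symmetric])
    finally show ?thesis .
  qed
  have \<phi>_box: "\<bar>\<phi> p s $ i\<bar> \<le> \<xi> i * M" if "\<And>b. b \<in> A \<Longrightarrow> \<bar>p b\<bar> \<le> \<xi> (fst b) * M" for p s i
    using mean[of s "\<lambda>k. p (i, k)" 0 "\<xi> i * M"] that by (auto simp: \<phi>_def A_def)
  have sol_box: "\<bar>sol_of (\<phi> p) s $ i\<bar> \<le> \<xi> i * M" if p: "\<And>b. b \<in> A \<Longrightarrow> \<bar>p b\<bar> \<le> \<xi> (fst b) * M" for p s i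
  proof -
    have past: "\<bar>sol_of (\<phi> p) s $ i\<bar> \<le> \<xi> i * M" if "s \<le> 0" for s i
      unfolding sol_of(2)[OF \<phi>_cont0 that] by (rule \<phi>_box[OF p])
    show ?thesis
    proof (cases "s \<le> 0")
      case False
      then have "0 \<le> s" by simp
      from box[OF sol_of(1)[OF \<phi>_cont0] past this] show ?thesis .
    qed (rule past)
  qed
  have "\<exists>p. \<forall>b\<in>A. \<bar>p b\<bar> \<le> \<xi> (fst b) * M \<and> \<Phi> p b = p b"
  proof (rule brouwer_finite_box)
    show "finite A" by (simp add: A_def)
    show "0 < \<xi> (fst b) * M" if "b \<in> A" for b using xi_pos M by simp
    show "\<bar>\<Phi> p b\<bar> \<le> \<xi> (fst b) * M" if "\<And>b. b \<in> A \<Longrightarrow> \<bar>p b\<bar> \<le> \<xi> (fst b) * M" "b \<in> A" for p b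
      using sol_box[OF that(1)] by (auto simp: \<Phi>_def split: prod.splits)
    fix X :: "nat \<Rightarrow> 'n \<times> nat \<Rightarrow> real" and p b
    assume lim: "\<And>b. b \<in> A \<Longrightarrow> (\<lambda>n. X n b) \<longlonglongrightarrow> p b" and b: "b \<in> A"
    obtain i k where ik: "b = (i, k)" "k \<in> {1..N}" using b by (auto simp: A_def)
    define \<sigma> where "\<sigma> n = (\<Sum>c\<in>A. \<bar>X n c - p c\<bar>)" for n
    have "(\<lambda>n. \<sigma> n) \<longlonglongrightarrow> (\<Sum>c\<in>A. \<bar>p c - p c\<bar>)"
      unfolding \<sigma>_def by (intro tendsto_intros lim)
    then have \<sigma>: "\<sigma> \<longlonglongrightarrow> 0" by simp
    \<comment> \<open>The estimate is uniform over the whole past, the only kind of closeness to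
      which continuous dependence applies.\<close>
    have close: "norm (\<phi> (X n) s - \<phi> p s) \<le> real CARD('n) * \<sigma> n" for n s
    proof -
      have "\<bar>(\<phi> (X n) s - \<phi> p s) $ i\<bar> \<le> \<sigma> n" for i
      proof -
        have "\<bar>(\<Sum>k\<in>{1..N}. \<Lambda> k s * (X n (i, k) - p (i, k))) - 0\<bar> \<le> \<sigma> n"
        proof (rule mean)
          fix k assume "k \<in> {1..N}"
          then have "(i, k) \<in> A" by (simp add: A_def)
          then show "\<bar>(X n (i, k) - p (i, k)) - 0\<bar> \<le> \<sigma> n"
            unfolding \<sigma>_def using member_le_sum[of "(i, k)" A "\<lambda>c. \<bar>X n c - p c\<bar>"] by (simp add: A_def)
        qed
        then show ?thesis by (simp add: \<phi>_def right_diff_distrib sum_subtractf)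
      qed
      then have "(\<Sum>i\<in>UNIV. \<bar>(\<phi> (X n) s - \<phi> p s) $ i\<bar>) \<le> (\<Sum>i\<in>(UNIV::'n set). \<sigma> n)" by (intro sum_mono)
      then show ?thesis using norm_le_l1_cart[of "\<phi> (X n) s - \<phi> p s"] by simp
    qed
    have "(\<lambda>n. sol_of (\<phi> (X n)) (real k * h)) \<longlonglongrightarrow> sol_of (\<phi> p) (real k * h)"
    proof (rule LIMSEQ_I)
      fix \<epsilon> :: real assume \<epsilon>: "0 < \<epsilon>"
      have kh: "0 \<le> real k * h" using h by simp
      obtain \<delta> where \<delta>: "\<delta> > 0" "\<And>v. sol v \<Longrightarrow> (\<forall>s\<le>0. norm (v s - sol_of (\<phi> p) s) < \<delta>) \<Longrightarrow>
          \<forall>t\<in>{0..real k * h}. norm (v t - sol_of (\<phi> p) t) < \<epsilon>"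
        using cont_dep[rule_format, of "sol_of (\<phi> p)" "real k * h" \<epsilon>] sol_of(1)[OF \<phi>_cont0, of p] kh \<epsilon> by auto
      have "(\<lambda>n. real CARD('n) * \<sigma> n) \<longlonglongrightarrow> real CARD('n) * 0" by (intro tendsto_intros \<sigma>)
      then have "\<forall>\<^sub>F n in sequentially. real CARD('n) * \<sigma> n < \<delta>"
        using \<delta>(1) by (intro order_tendstoD) auto
      then obtain n0 where n0: "\<And>n. n \<ge> n0 \<Longrightarrow> real CARD('n) * \<sigma> n < \<delta>" by (auto simp: eventually_sequentially)
      have "norm (sol_of (\<phi> (X n)) (real k * h) - sol_of (\<phi> p) (real k * h)) < \<epsilon>" if n: "n \<ge> n0" for n
      proof -
        have "\<forall>t\<in>{0..real k * h}. norm (sol_of (\<phi> (X n)) t - sol_of (\<phi> p) t) < \<epsilon>"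
        proof (rule \<delta>(2)[OF sol_of(1)[OF \<phi>_cont0]], intro allI impI)
          fix s :: real assume "s \<le> 0"
          then show "norm (sol_of (\<phi> (X n)) s - sol_of (\<phi> p) s) < \<delta>"
            using sol_of(2)[OF \<phi>_cont0] close[of n s] n0[OF n] by simp
        qed
        then show ?thesis using kh by auto
      qed
      then show "\<exists>no. \<forall>n\<ge>no. norm (sol_of (\<phi> (X n)) (real k * h) - sol_of (\<phi> p) (real k * h)) < \<epsilon>" by blast
    qed
    then show "(\<lambda>n. \<Phi> (X n) b) \<longlonglongrightarrow> \<Phi> p b"
      unfolding \<Phi>_def ik by (auto intro: tendsto_vec_nth)
  qed
  then obtain p where pb: "\<And>b. b \<in> A \<Longrightarrow> \<bar>p b\<bar> \<le> \<xi> (fst b) * M" and fix_p: "\<And>b. b \<in> A \<Longrightarrow> \<Phi> p b = p b" by blast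
  define u where "u = sol_of (\<phi> p)"
  have u: "sol u" "\<And>s. s \<le> 0 \<Longrightarrow> u s = \<phi> p s" unfolding u_def by (rule sol_of[OF \<phi>_cont0])+
  have ubox: "\<bar>u s $ j\<bar> \<le> \<xi> j * M" for s j unfolding u_def by (rule sol_box[OF pb])
  have node: "p (i, k) = u (real k * h) $ i" if "k \<in> {1..N}" for i k
    using fix_p[of "(i, k)"] that by (simp add: \<Phi>_def u_def A_def)
  \<comment> \<open>At time 0 every node other than N is at least one mesh width away, so the
    interpolant takes the value of node N, which is the solution at \<omega>.\<close>
  have u0\<omega>: "u 0 $ i = u \<omega> $ i" for i
  proof -
    have "\<bar>(\<Sum>k\<in>{1..N}. \<Lambda> k 0 * p (i, k)) - u \<omega> $ i\<bar> \<le> 0"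
    proof (rule mean)
      fix k assume k: "k \<in> {1..N}" and nz: "\<Lambda> k 0 \<noteq> 0"
      have "1 * h \<le> real k * h" using k h by (intro mult_right_mono) auto
      then have "k = N" using near[OF k _ nz] omega_pos h by auto
      then show "\<bar>p (i, k) - u \<omega> $ i\<bar> \<le> 0" using node[OF k, of i] h by simp
    qed
    then show ?thesis using u(2)[of 0] by (simp add: \<phi>_def)
  qed
  have "\<bar>\<phi> p s $ i - u s $ i\<bar> \<le> L * h" if s: "s \<in> {0..\<omega>}" for s i
  proof -
    have "\<bar>(\<Sum>k\<in>{1..N}. \<Lambda> k s * p (i, k)) - u s $ i\<bar> \<le> L * h"
    proof (rule mean)
      fix k assume k: "k \<in> {1..N}" and nz: "\<Lambda> k s \<noteq> 0"
      have le: "L * x \<le> L * h" if "x < h" for x using L(1) that by (intro mult_left_mono) auto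
      have kh: "0 \<le> real k * h" using h by simp
      from near[OF k s nz] show "\<bar>p (i, k) - u s $ i\<bar> \<le> L * h"
      proof
        assume "\<bar>s - real k * h\<bar> < h"
        then have "\<bar>real k * h - s\<bar> < h" by (simp add: abs_minus_commute)
        from le[OF this] show ?thesis
          using L(2)[OF u(1) ubox kh, of s i] s node[OF k, of i] by simp
      next
        \<comment> \<open>Wrap-around: node N acts near time 0, where its value is also the solution
          at 0.\<close>
        assume a: "k = N \<and> s < h"
        then have "p (i, k) = u 0 $ i" using node[OF k, of i] u0\<omega>[of i] h by simp
        moreover have "\<bar>u 0 $ i - u s $ i\<bar> \<le> L * \<bar>0 - s\<bar>" by (rule L(2)[OF u(1) ubox]) (use s in auto)
        ultimately show ?thesis using le[of s] a s by simp
      qed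
    qed
    then show ?thesis by (simp add: \<phi>_def)
  qed
  moreover have "\<phi> p (s + \<omega>) = \<phi> p s" for s by (simp add: \<phi>_def \<Lambda>(3))
  ultimately show ?thesis using u ubox \<phi>_cont[of p] unfolding h_def by blast
qed

theorem periodic_solution_exists: "\<exists>x. sol x \<and> (\<forall>t. x (t + \<omega>) = x t)"
proof -
  obtain M0 where M0: "\<And>M u t i. M0 \<le> M \<Longrightarrow> sol u \<Longrightarrow> (\<And>s i. s \<le> 0 \<Longrightarrow> \<bar>u s $ i\<bar> \<le> \<xi> i * M) \<Longrightarrow> 0 \<le> t \<Longrightarrow> \<bar>u t $ i\<bar> \<le> \<xi> i * M"
    using invariant_box by blast
  define M where "M = max M0 1"
  have M: "0 < M" "M0 \<le> M" by (auto simp: M_def)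
  obtain L where L: "0 \<le> L" "\<And>u i s t. sol u \<Longrightarrow> (\<And>s j. \<bar>u s $ j\<bar> \<le> \<xi> j * M) \<Longrightarrow> 0 \<le> s \<Longrightarrow> 0 \<le> t \<Longrightarrow> \<bar>u s $ i - u t $ i\<bar> \<le> L * \<bar>s - t\<bar>"
    using sol_lipschitz[of M] by blast
  have "\<exists>u \<phi>. sol u \<and> (\<forall>s j. \<bar>u s $ j\<bar> \<le> \<xi> j * M) \<and> continuous_on UNIV \<phi> \<and> (\<forall>s. \<phi> (s + \<omega>) = \<phi> s) \<and>
     (\<forall>s\<le>0. u s = \<phi> s) \<and> (\<forall>s\<in>{0..\<omega>}. \<forall>i. \<bar>\<phi> s $ i - u s $ i\<bar> \<le> L * (\<omega> / real (n + 2)))" for n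
  proof (rule approximate_periodic_solution[OF _ M(1)])
    show "\<bar>u t $ i\<bar> \<le> \<xi> i * M" if "sol u" "\<And>s i. s \<le> 0 \<Longrightarrow> \<bar>u s $ i\<bar> \<le> \<xi> i * M" "0 \<le> t" for u t i
      by (rule M0[OF M(2) that])
    show "\<bar>u s $ i - u t $ i\<bar> \<le> L * \<bar>s - t\<bar>" if "sol u" "\<And>s j. \<bar>u s $ j\<bar> \<le> \<xi> j * M" "0 \<le> s" "0 \<le> t" for u i s t
      by (rule L(2)[OF that])
  qed (use L(1) in auto)
  then obtain u \<phi> where u: "\<And>n. sol (u n)" and ub: "\<And>n s j. \<bar>u n s $ j\<bar> \<le> \<xi> j * M"
    and \<phi>c: "\<And>n. continuous_on UNIV (\<phi> n)" and \<phi>p: "\<And>n s. \<phi> n (s + \<omega>) = \<phi> n s"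
    and u\<phi>: "\<And>n s. s \<le> 0 \<Longrightarrow> u n s = \<phi> n s"
    and close: "\<And>n s i. s \<in> {0..\<omega>} \<Longrightarrow> \<bar>\<phi> n s $ i - u n s $ i\<bar> \<le> L * (\<omega> / real (n + 2))"
    by metis
  have nrm: "norm y \<le> real CARD('n) * e" if "\<And>i. \<bar>y $ i\<bar> \<le> e" for y :: "real^'n" and e
  proof -
    have "(\<Sum>i\<in>UNIV. \<bar>y $ i\<bar>) \<le> (\<Sum>i\<in>(UNIV::'n set). e)" using that by (intro sum_mono)
    then show ?thesis using norm_le_l1_cart[of y] by simp
  qed
  obtain v r where v: "strict_mono (r :: nat \<Rightarrow> nat)"
    "\<And>e. 0 < e \<Longrightarrow> \<exists>N. \<forall>n x. n \<ge> N \<and> x \<in> {0..\<omega>} \<longrightarrow> norm (u (r n) x - v x) < e"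
  proof (rule Arzela_Ascoli[of "{0..\<omega>}" u "\<Sum>i\<in>UNIV. \<xi> i * M"])
    show "compact {0..\<omega>}" by simp
    show "norm (u n x) \<le> (\<Sum>i\<in>UNIV. \<xi> i * M)" for n x
      by (rule order_trans[OF norm_le_l1_cart sum_mono]) (rule ub)
    show "\<exists>d>0. \<forall>n y. y \<in> {0..\<omega>} \<and> norm (x - y) < d \<longrightarrow> norm (u n x - u n y) < e"
      if x: "x \<in> {0..\<omega>}" and e: "0 < e" for x e
    proof (intro exI[of _ "e / (real CARD('n) * (L + 1))"] conjI allI impI)
      have c: "0 < real CARD('n) * (L + 1)" using L(1) by simp
      then show "0 < e / (real CARD('n) * (L + 1))" using e by simp
      fix n y assume y: "y \<in> {0..\<omega>} \<and> norm (x - y) < e / (real CARD('n) * (L + 1))"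
      have "norm (u n x - u n y) \<le> real CARD('n) * (L * \<bar>x - y\<bar>)"
        using L(2)[OF u ub] x y by (intro nrm) auto
      also have "\<dots> \<le> real CARD('n) * ((L + 1) * \<bar>x - y\<bar>)" by (intro mult_left_mono mult_right_mono) auto
      also have "\<dots> < e" using y c by (simp add: pos_less_divide_eq mult_ac)
      finally show "norm (u n x - u n y) < e" .
    qed
  qed blast
  have \<phi>lim: "\<exists>N. \<forall>n\<ge>N. \<forall>s\<in>{0..\<omega>}. norm (\<phi> (r n) s - v s) < e" if e: "0 < e" for e
  proof -
    obtain N1 where N1: "\<And>n x. n \<ge> N1 \<Longrightarrow> x \<in> {0..\<omega>} \<Longrightarrow> norm (u (r n) x - v x) < e / 2"
      using v(2)[of "e / 2"] e by auto
    obtain N2 :: nat where N2: "real CARD('n) * (L * \<omega>) / (e / 2) < real N2" using reals_Archimedean2 by blast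
    have "norm (\<phi> (r n) s - v s) < e" if n: "n \<ge> max N1 N2" and s: "s \<in> {0..\<omega>}" for n s
    proof -
      have rn: "real N2 \<le> real (r n + 2)" using n seq_suble[OF v(1), of n] by simp
      have "norm (\<phi> (r n) s - u (r n) s) \<le> real CARD('n) * (L * (\<omega> / real (r n + 2)))"
        using close[OF s] by (intro nrm) simp
      also have "\<dots> < e / 2"
      proof -
        have "real CARD('n) * (L * \<omega>) / (e / 2) < real (r n + 2)" using N2 rn by linarith
        then have "real CARD('n) * (L * \<omega>) < real (r n + 2) * (e / 2)" using e by (simp add: pos_divide_less_eq)
        then have "real CARD('n) * (L * \<omega>) / real (r n + 2) < e / 2" by (simp add: pos_divide_less_eq mult.commute)
        then show ?thesis by simp
      qed
      finally have "norm (\<phi> (r n) s - u (r n) s) < e / 2" .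
      moreover have "norm (u (r n) s - v s) < e / 2" using N1[of n s] n s by simp
      ultimately show ?thesis using norm_triangle_ineq[of "\<phi> (r n) s - u (r n) s" "u (r n) s - v s"] by simp
    qed
    then show ?thesis by blast
  qed
  \<comment> \<open>Reduction modulo \<omega> turns uniform convergence on one period into uniform
    convergence of the periodic histories on the whole line.\<close>
  define red where "red s = s - \<omega> * of_int \<lfloor>s / \<omega>\<rfloor>" for s
  have red: "red s \<in> {0..\<omega>}" for s
  proof -
    have "of_int \<lfloor>s / \<omega>\<rfloor> * \<omega> \<le> s"
      using of_int_floor_le[of "s / \<omega>"] unfolding pos_le_divide_eq[OF omega_pos] .
    moreover have "s < (of_int \<lfloor>s / \<omega>\<rfloor> + 1) * \<omega>"
      using real_of_int_floor_add_one_gt[of "s / \<omega>"] unfolding pos_divide_less_eq[OF omega_pos] .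
    ultimately show ?thesis by (simp add: red_def algebra_simps)
  qed
  have per_nat: "\<phi> n (s + \<omega> * real k) = \<phi> n s" for n s k
  proof (induction k)
    case (Suc k)
    have "s + \<omega> * real (Suc k) = (s + \<omega> * real k) + \<omega>" by (simp add: algebra_simps)
    then show ?case using \<phi>p Suc by metis
  qed simp
  have per_int: "\<phi> n (s + \<omega> * of_int z) = \<phi> n s" for n s z
  proof (cases "0 \<le> z")
    case True then show ?thesis using per_nat[of n s "nat z"] by simp
  next
    case False
    then show ?thesis using per_nat[of n "s + \<omega> * of_int z" "nat (- z)"] by simp
  qed
  have \<phi>red: "\<phi> n (red s) = \<phi> n s" for n s
    using per_int[of n "red s" "\<lfloor>s / \<omega>\<rfloor>"] by (simp add: red_def)
  define \<phi>\<^sub>0 where "\<phi>\<^sub>0 s = v (red s)" for s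
  have unif: "\<exists>N. \<forall>n\<ge>N. \<forall>s. norm (\<phi> (r n) s - \<phi>\<^sub>0 s) < e" if "0 < e" for e
    using \<phi>lim[OF that] red \<phi>red unfolding \<phi>\<^sub>0_def by metis
  have "uniform_limit UNIV (\<lambda>n. \<phi> (r n)) \<phi>\<^sub>0 sequentially"
    unfolding uniform_limit_sequentially_iff dist_norm using unif by blast
  then have \<phi>0c: "continuous_on UNIV \<phi>\<^sub>0"
    by (rule uniform_limit_theorem[rotated]) (auto simp: \<phi>c)
  have lim0: "(\<lambda>n. \<phi> (r n) s) \<longlonglongrightarrow> \<phi>\<^sub>0 s" for s
    by (rule LIMSEQ_I) (use unif in blast)
  have limv: "(\<lambda>n. \<phi> (r n) s) \<longlonglongrightarrow> v s" if "s \<in> {0..\<omega>}" for s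
    by (rule LIMSEQ_I) (use \<phi>lim that in blast)
  have \<phi>0v: "\<phi>\<^sub>0 s = v s" if "s \<in> {0..\<omega>}" for s
    using LIMSEQ_unique[OF lim0 limv[OF that]] .
  have \<phi>0p: "\<phi>\<^sub>0 (s + \<omega>) = \<phi>\<^sub>0 s" for s
    using LIMSEQ_unique[OF lim0[of "s + \<omega>"]] lim0[of s] by (simp add: \<phi>p)
  define x where "x = sol_of \<phi>\<^sub>0"
  have c0: "continuous_on {..0} \<phi>\<^sub>0" using \<phi>0c by (rule continuous_on_subset) simp
  have x: "sol x" "\<And>s. s \<le> 0 \<Longrightarrow> x s = \<phi>\<^sub>0 s" unfolding x_def by (rule sol_of[OF c0])+
  \<comment> \<open>The approximate solutions tend to v by compactness and to x by continuous
    dependence on their histories.\<close>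
  have xv: "x t = v t" if t: "t \<in> {0..\<omega>}" for t
  proof (rule LIMSEQ_unique)
    show "(\<lambda>n. u (r n) t) \<longlonglongrightarrow> v t"
      by (rule LIMSEQ_I) (use v(2) t in blast)
    show "(\<lambda>n. u (r n) t) \<longlonglongrightarrow> x t"
    proof (rule LIMSEQ_I)
      fix \<epsilon> :: real assume "0 < \<epsilon>"
      then obtain \<delta> where \<delta>: "\<delta> > 0" "\<And>v. sol v \<Longrightarrow> (\<forall>s\<le>0. norm (v s - x s) < \<delta>) \<Longrightarrow>
          \<forall>t\<in>{0..\<omega>}. norm (v t - x t) < \<epsilon>"
        using cont_dep[rule_format, of x \<omega> \<epsilon>] x(1) omega_pos by auto
      obtain N where N: "\<And>n s. n \<ge> N \<Longrightarrow> norm (\<phi> (r n) s - \<phi>\<^sub>0 s) < \<delta>" using unif[OF \<delta>(1)] by blast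
      have "norm (u (r n) t - x t) < \<epsilon>" if "n \<ge> N" for n
        using \<delta>(2)[OF u, of "r n"] N[OF that] u\<phi> x(2) t by simp
      then show "\<exists>no. \<forall>n\<ge>no. norm (u (r n) t - x t) < \<epsilon>" by blast
    qed
  qed
  \<comment> \<open>The shifted solution has the same past as x: for s + \<omega> \<le> 0 by
    periodicity of the history, otherwise because x continues the history over the first
    period.\<close>
  have "(\<lambda>t. x (t + \<omega>)) = x"
  proof (rule sol_unique[OF sol_shift[OF x(1)] x(1)])
    fix s :: real assume s: "s \<le> 0"
    have "x (s + \<omega>) = \<phi>\<^sub>0 (s + \<omega>)"
      using x(2)[of "s + \<omega>"] xv[of "s + \<omega>"] \<phi>0v[of "s + \<omega>"] s by (cases "s + \<omega> \<le> 0") auto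
    then show "x (s + \<omega>) = x s" using \<phi>0p x(2)[OF s] by simp
  qed
  then show ?thesis using x(1) by (metis (mono_tags))
qed

end

section \<open>The main theorem\<close>

theorem mainTheorem1:
  fixes \<omega> \<eta> :: real
    and d I :: "'n::finite \<Rightarrow> real \<Rightarrow> real"
    and a tau :: "'n \<Rightarrow> 'n \<Rightarrow> real \<Rightarrow> real"
    and Kp Km :: "'n \<Rightarrow> 'n \<Rightarrow> real \<Rightarrow> real measure"
    and g f :: "'n \<Rightarrow> real \<Rightarrow> real"
    and G F C D \<xi> :: "'n \<Rightarrow> real"
  assumes omega_pos: "\<omega> > 0"
    and cont_d: "\<forall>i. continuous_on {0..} (d i)"
    and cont_I: "\<forall>i. continuous_on {0..} (I i)"
    and cont_a: "\<forall>i j. continuous_on {0..} (a i j)"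
    and cont_tau: "\<forall>i j. continuous_on {0..} (tau i j)"
    and per: "\<forall>t\<ge>0. \<forall>i j. d i (t + \<omega>) = d i t \<and> I i (t + \<omega>) = I i t \<and>
                a i j (t + \<omega>) = a i j t \<and> tau i j (t + \<omega>) = tau i j t \<and>
                Kp i j (t + \<omega>) = Kp i j t \<and> Km i j (t + \<omega>) = Km i j t"
    and d_pos: "\<forall>t\<ge>0. \<forall>i. d i t > 0"
    and tau_pos: "\<forall>t\<ge>0. \<forall>i j. tau i j t > 0"
    and K_meas: "\<forall>t\<ge>0. \<forall>i j. LS_signed (Kp i j t) (Km i j t)"
    and uniq: "\<forall>\<phi>::real \<Rightarrow> real ^ 'n. continuous_on {..0} \<phi> \<longrightarrow>
                 (\<exists>!u. is_solution d a I tau Kp Km g f u \<and> (\<forall>s\<le>0. u s = \<phi> s))"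
    and cont_dep: "\<forall>u T \<epsilon>. is_solution d a I tau Kp Km g f u \<and> T \<ge> 0 \<and> \<epsilon> > 0 \<longrightarrow>
                 (\<exists>\<delta>>0. \<forall>v. is_solution d a I tau Kp Km g f v \<and> (\<forall>s\<le>0. norm (v s - u s) < \<delta>)
                    \<longrightarrow> (\<forall>t\<in>{0..T}. norm (v t - u t) < \<epsilon>))"
    and G_pos: "\<forall>j. G j > 0" and F_pos: "\<forall>j. F j > 0"
    and g_growth: "\<forall>j s. \<bar>g j s\<bar> \<le> G j * \<bar>s\<bar> + C j"
    and f_growth: "\<forall>j s. \<bar>f j s\<bar> \<le> F j * \<bar>s\<bar> + D j"
    and xi_pos: "\<forall>i. \<xi> i > 0" and eta_pos: "\<eta> > 0"
    and cond1: "\<forall>t>0. \<forall>i. (\<forall>j. tv_int (Kp i j t) (Km i j t) (\<lambda>s. 1) < \<infinity>) \<and>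
                 - \<xi> i * d i t + (\<Sum>j\<in>UNIV. \<xi> j * G j * \<bar>a i j t\<bar>)
                 + (\<Sum>j\<in>UNIV. \<xi> j * F j * enn2real (tv_int (Kp i j t) (Km i j t) (\<lambda>s. 1))) < - \<eta>"
  shows "\<exists>x. is_solution d a I tau Kp Km g f x \<and> (\<forall>t. x (t + \<omega>) = x t) \<and>
           (\<forall>\<alpha>::real.
              ((\<forall>i y h. \<bar>g i (y + h) - g i y\<bar> \<le> G i * \<bar>h\<bar> \<and> \<bar>f i (y + h) - f i y\<bar> \<le> F i * \<bar>h\<bar>) \<and>
               (\<forall>t>0. \<forall>i. (\<forall>j. tv_int (Kp i j t) (Km i j t) (\<lambda>s. exp (\<alpha> * s)) < \<infinity>) \<and>
                  - \<xi> i * (d i t - \<alpha>) + (\<Sum>j\<in>UNIV. \<xi> j * G j * \<bar>a i j t\<bar>)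
                  + (\<Sum>j\<in>UNIV. \<xi> j * F j * exp (\<alpha> * tau i j t)
                        * enn2real (tv_int (Kp i j t) (Km i j t) (\<lambda>s. exp (\<alpha> * s)))) \<le> 0))
              \<longrightarrow> (\<forall>u. is_solution d a I tau Kp Km g f u \<longrightarrow>
                     (\<lambda>t. norm (u t - x t)) \<in> O[at_top](\<lambda>t. exp (- \<alpha> * t))))"
proof -
  interpret delay_system \<omega> \<eta> d I a tau Kp Km g f G F C D \<xi>
    by unfold_locales fact+
  obtain x where x: "sol x" "\<forall>t. x (t + \<omega>) = x t" using periodic_solution_exists by blast
  \<comment> \<open>The periodic solution is fixed before \<alpha> and the Lipschitz bounds, so a
    single x serves every rate.\<close>
  have "(\<lambda>t. norm (u t - x t)) \<in> O[at_top](\<lambda>t. exp (- \<alpha> * t))"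
    if lip: "\<forall>i y h. \<bar>g i (y + h) - g i y\<bar> \<le> G i * \<bar>h\<bar> \<and> \<bar>f i (y + h) - f i y\<bar> \<le> F i * \<bar>h\<bar>"
      and cond: "exp_condition \<alpha> d a tau Kp Km G F \<xi>" and u: "sol u" for \<alpha> u
  proof -
    interpret lipschitz_delay_system \<omega> \<eta> d I a tau Kp Km g f G F C D \<xi>
    proof unfold_locales
      show "\<bar>g i y - g i z\<bar> \<le> G i * \<bar>y - z\<bar>" "\<bar>f i y - f i z\<bar> \<le> F i * \<bar>y - z\<bar>" for i y z
        using lip[rule_format, of i z "y - z"] by simp_all
    qed
    show ?thesis by (rule decay_bigo[OF u x(1) cond])
  qed
  then show ?thesis using x unfolding exp_condition_def by blast
qed

end
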